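(* Let $f$ and $\widetilde f$ be smooth, strictly positive probability density functions on $\mathbb{R}^2$, and let $f_1$, $f_2$, $G$, $\widetilde G$, the set $\mathcal{H}$ and the functional $L$ be as defined in the context. Suppose that a smooth, strictly positive $p\in\mathcal{H}$ minimizes $L$ over $\mathcal{H}$, that is, $L(p)$ is finite and $L(p)\le L(q)$ for all $q\in\mathcal{H}$. Define $$H(x,y)=\int_{-\infty}^x\int_{-\infty}^y p(u,v)\,dv\,du,\qquad (x,y)\in\mathbb{R}^2.$$ Then, for all $(x,y)\in\mathbb{R}^2$, $$\frac{\partial}{\partial x}\left[G\left(x,\frac{1}{f_1(x)}H_x(x,y)\right)\right]+\frac{\partial}{\partial y}\left[\widetilde G\left(\frac{1}{f_2(y)}H_y(x,y),\,y\right)\right]=0.$$ Moreover, for all $x,y\in\mathbb{R}$, $$H(x,-\infty)=0,\qquad H(-\infty,y)=0,\qquad H(x,+\infty)=\int_{-\infty}^x f_1(u)\,du,\qquad H(+\infty,y)=\int_{-\infty}^y f_2(v)\,dv,$$ where the values at $\pm\infty$ denote the corresponding limits.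
   Context: Let $f,\widetilde f$ be smooth strictly positive probability density functions on $\mathbb{R}^2$ (the densities of random vectors $(X_1,X_2)$ and $(Y_1,Y_2)$ respectively). Set $$f_1(x)=\int_{\mathbb{R}}f(x,v)\,dv,\qquad f_2(y)=\int_{\mathbb{R}}\widetilde f(u,y)\,du.$$ For each fixed $x$, $G(x,\cdot):(0,1)\to\mathbb{R}$ is the inverse function of the conditional distribution function $y\mapsto F_{X_2|X_1}(y|x)=\frac{1}{f_1(x)}\int_{-\infty}^y f(x,t)\,dt$. For each fixed $y$, $\widetilde G(\cdot,y):(0,1)\to\mathbb{R}$ is the inverse function of the conditional distribution function $x\mapsto F_{Y_1|Y_2}(x|y)=\frac{1}{f_2(y)}\int_{-\infty}^x\widetilde f(u,y)\,du$. $\mathcal{H}$ is the set of all probability density functions $q$ on $\mathbb{R}^2$ satisfying $\int_{\mathbb{R}}q(x,t)\,dt=f_1(x)$ for $x\in\mathbb{R}$ and $\int_{\mathbb{R}}q(u,y)\,du=f_2(y)$ for $y\in\mathbb{R}$. The functional $L$ on $\mathcal{H}$ is $$L(q)=\int_{\mathbb{R}}\int_{\mathbb{R}}\left(t-G\left(x,\int_{-\infty}^t\frac{q(x,v)}{f_1(x)}\,dv\right)\right)^2q(x,t)\,dt\,dx+\int_{\mathbb{R}}\int_{\mathbb{R}}\left(s-\widetilde G\left(\int_{-\infty}^s\frac{q(u,y)}{f_2(y)}\,du,\,y\right)\right)^2q(s,y)\,ds\,dy.$$ Subscripts on $H$ denote partial derivatives: $H_x(x,y)=\int_{-\infty}^y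 p(x,v)\,dv$ and $H_y(x,y)=\int_{-\infty}^x p(u,y)\,du$. *)

theory Defs
  imports "HOL-Analysis.Analysis"
begin

text \<open>On a finite-dimensional space, Frechet differentiability with all directional
  derivatives of class \<open>C_k k\<close> amounts to being \<open>k + 1\<close> times continuously differentiable.\<close>

primrec C_k :: "nat \<Rightarrow> (real \<times> real \<Rightarrow> real) \<Rightarrow> bool" where
  "C_k 0 g \<longleftrightarrow> continuous_on UNIV g"
| "C_k (Suc k) g \<longleftrightarrow>
     (\<forall>z. g differentiable (at z)) \<and> (\<forall>h. C_k k (\<lambda>z. frechet_derivative g (at z) h))"

definition smooth :: "(real \<times> real \<Rightarrow> real) \<Rightarrow> bool" where
  "smooth g \<longleftrightarrow> (\<forall>k. C_k k g)"

definition prob_density :: "(real \<times> real \<Rightarrow> real) \<Rightarrow> bool" where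
  "prob_density q \<longleftrightarrow> (\<forall>z. 0 \<le> q z) \<and> has_bochner_integral lborel q 1"

definition marg1 :: "(real \<times> real \<Rightarrow> real) \<Rightarrow> real \<Rightarrow> real" where
  "marg1 f x = (LBINT v. f (x, v))"

definition marg2 :: "(real \<times> real \<Rightarrow> real) \<Rightarrow> real \<Rightarrow> real" where
  "marg2 f y = (LBINT u. f (u, y))"

definition cond_cdf21 :: "(real \<times> real \<Rightarrow> real) \<Rightarrow> real \<Rightarrow> real \<Rightarrow> real" where
  "cond_cdf21 f x y = 1 / marg1 f x * (LBINT t:{..y}. f (x, t))"

definition cond_cdf12 :: "(real \<times> real \<Rightarrow> real) \<Rightarrow> real \<Rightarrow> real \<Rightarrow> real" where
  "cond_cdf12 f x y = 1 / marg2 f y * (LBINT u:{..x}. f (u, y))"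

text \<open>For strictly positive densities the conditional distribution functions are bijections
  from the real line onto the open unit interval.  Values of the inverses outside that interval
  are arbitrary; in the functional \<open>cost\<close> below they are only met on null sets of the measure
  with density \<open>q\<close>.\<close>

definition G :: "(real \<times> real \<Rightarrow> real) \<Rightarrow> real \<Rightarrow> real \<Rightarrow> real" where
  "G f x w = inv (\<lambda>y. cond_cdf21 f x y) w"

definition G_tilde :: "(real \<times> real \<Rightarrow> real) \<Rightarrow> real \<Rightarrow> real \<Rightarrow> real" where
  "G_tilde f w y = inv (\<lambda>x. cond_cdf12 f x y) w"

text \<open>The marginal constraints hold at every point and include integrability of every section
  of \<open>q\<close>.  A strictly positive admissible \<open>q\<close> therefore forces \<open>marg1 f\<close> and \<open>marg2 f'\<close> to be
  positive, so that all the sections of \<open>f\<close> and \<open>f'\<close> defining them are integrable as well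
  (the integral of a non-integrable function being 0).\<close>

definition admissible ::
  "(real \<times> real \<Rightarrow> real) \<Rightarrow> (real \<times> real \<Rightarrow> real) \<Rightarrow> (real \<times> real \<Rightarrow> real) set" where
  "admissible f f' = {q. prob_density q \<and>
     (\<forall>x. has_bochner_integral lborel (\<lambda>t. q (x, t)) (marg1 f x)) \<and>
     (\<forall>y. has_bochner_integral lborel (\<lambda>u. q (u, y)) (marg2 f' y))}"

definition cost ::
  "(real \<times> real \<Rightarrow> real) \<Rightarrow> (real \<times> real \<Rightarrow> real) \<Rightarrow> (real \<times> real \<Rightarrow> real) \<Rightarrow> ennreal" where
  "cost f f' q =
     (\<integral>\<^sup>+x. \<integral>\<^sup>+t. ennreal
        ((t - G f x (LBINT v:{..t}. q (x, v) / marg1 f x))\<^sup>2 * q (x, t)) \<partial>lborel \<partial>lborel) +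
     (\<integral>\<^sup>+y. \<integral>\<^sup>+s. ennreal
        ((s - G_tilde f' (LBINT u:{..s}. q (u, y) / marg2 f' y) y)\<^sup>2 * q (s, y)) \<partial>lborel \<partial>lborel)"

definition H :: "(real \<times> real \<Rightarrow> real) \<Rightarrow> real \<Rightarrow> real \<Rightarrow> real" where
  "H p x y = (LBINT u:{..x}. LBINT v:{..y}. p (u, v))"

text \<open>The partial derivatives of \<open>H p\<close> are taken in their integral form, which is meaningful
  at every point without further conditions on \<open>p\<close>: smoothness of \<open>p\<close> alone does not make
  \<open>x \<mapsto> H_x p x y\<close> continuous, since mass of \<open>p (x, \<cdot>)\<close> may escape to infinity as \<open>x\<close> varies.\<close>

definition H_x :: "(real \<times> real \<Rightarrow> real) \<Rightarrow> real \<Rightarrow> real \<Rightarrow> real" where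
  "H_x p x y = (LBINT v:{..y}. p (x, v))"

definition H_y :: "(real \<times> real \<Rightarrow> real) \<Rightarrow> real \<Rightarrow> real \<Rightarrow> real" where
  "H_y p x y = (LBINT u:{..x}. p (u, y))"

end

theory Submission
  imports Defs
begin

text \<open>
  Write \<open>T x t = G x (H_x x t / f_1 x)\<close>, the monotone map from the conditional density
  \<open>p(x, \<cdot>)\<close> to \<open>f(x, \<cdot>)\<close>, and \<open>U\<close> for the analogous map in the other variable. Perturb the
  minimizer to \<open>p + c * a(x) * b(y)\<close> with \<open>a = A'\<close>, \<open>b = B'\<close> for compactly supported \<open>A\<close>, \<open>B\<close>: the
  marginals do not change, and an integration by parts in each fibre bounds the change of the cost
  to first order. Minimality then gives \<open>\<integral>\<integral> T a B + \<integral>\<integral> U A b = 0\<close>, a weak form of the equation.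

  Regularity is not free, because \<open>f_1\<close> and \<open>x \<mapsto> H_x x y\<close> may be discontinuous. Since \<open>U\<close> is
  continuous and monotone in \<open>x\<close>, the weak equation and the du Bois-Reymond lemma make the averages
  \<open>\<integral> T x t * B t dt\<close> almost everywhere equal to \<open>C^1\<close> functions of \<open>x\<close>, so that \<open>T\<close> is locally
  essentially bounded. A jump of \<open>T\<close> at a single point \<open>x_0\<close> would force \<open>T x t\<close> to escape to infinity
  as \<open>x\<close> tends to \<open>x_0\<close>, for suitable \<open>t\<close>, so \<open>T\<close> is continuous at every point. It depends on \<open>x\<close>
  through the smooth data and a single scalar function of \<open>x\<close>, which inherits differentiability
  from the averages. A second use of the du Bois-Reymond lemma in the variable \<open>y\<close> turns the weak
  equation into the pointwise one.
\<close>

section \<open>Test functions and the du Bois-Reymond lemma\<close>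

text \<open>The cost is never differentiated in \<open>c\<close>. Convexity gives a one-sided
  estimate instead: the cost rises by at most \<open>-2 * c\<close> times a linear functional of
  \<open>a\<close> and \<open>B\<close> (and of \<open>b\<close> and \<open>A\<close>), formed with
  the maps of the perturbed density itself. Minimality fixes the sign of that functional for either
  sign of \<open>c\<close>, and letting \<open>c\<close> tend to 0 requires only pointwise
  convergence of the maps and a majorant independent of \<open>c\<close>.

  The obstacle to regularity is mass escaping to infinity along a fibre: integrals over a whole
  half-line need not depend continuously on \<open>x\<close>, whatever the smoothness of the
  densities. Increments of the distribution functions between finite levels do. The arguments are
  therefore phrased with increments, and what remains uncontrolled is the one scalar
  \<open>H_x p x 0 - H_x f x 0\<close>, for which an averaged form of the transport equation is
  solved.

  Each estimate is proved for one coordinate in a locale; the other coordinate is the same locale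
  applied to the densities with exchanged arguments.\<close>

lemma continuous_bounded_on_Icc:
  fixes g :: "real \<Rightarrow> real"
  assumes "continuous_on UNIV g"
  obtains K where "K > 0" "\<And>x. x \<in> {l..u} \<Longrightarrow> \<bar>g x\<bar> \<le> K"
proof -
  have "compact (g ` {l..u})"
    using assms by (intro compact_continuous_image) (auto intro: continuous_on_subset)
  then obtain K where K: "K > 0" "\<forall>y \<in> g ` {l..u}. norm y \<le> K"
    by (meson bounded_pos compact_imp_bounded)
  show ?thesis by (rule that[OF K(1)]) (use K in auto)
qed

lemma antiderivative_UNIV:
  fixes g :: "real \<Rightarrow> real"
  assumes "continuous_on UNIV g"
  obtains W where "\<And>x. (W has_real_derivative g x) (at x)"
proof -
  have "\<exists>F. \<forall>x::real. -\<infinity> < ereal x \<longrightarrow> ereal x < \<infinity> \<longrightarrow> (F has_vector_derivative g x) (at x)"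
    using assms by (intro einterval_antiderivative) (auto simp: continuous_on_eq_continuous_at)
  then obtain W where "\<And>x. (W has_vector_derivative g x) (at x)" by auto
  then show ?thesis
    by (intro that[of W]) (simp add: has_real_derivative_iff_has_vector_derivative)
qed

lemma bounded_support_integral:
  fixes g :: "real \<Rightarrow> real"
  assumes [measurable]: "g \<in> borel_measurable borel"
    and bnd: "\<And>x. x \<in> {l..u} \<Longrightarrow> \<bar>g x\<bar> \<le> K"
    and supp: "\<And>x. x \<notin> {l..u} \<Longrightarrow> g x = 0"
  shows "integrable lborel g" "(g has_integral (LBINT x. g x)) {l..u}"
proof -
  show int: "integrable lborel g"
  proof (rule integrableI_bounded_set[where A="{l..u}" and B=K])
    show "emeasure lborel {l..u} < \<infinity>" by (cases "l \<le> u") auto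
  qed (use bnd supp in auto)
  have "(g has_integral (LBINT x. g x)) UNIV"
    by (rule has_integral_integral_lborel[OF int])
  moreover have "g = (\<lambda>x. if x \<in> {l..u} then g x else 0)"
    using supp by auto
  ultimately show "(g has_integral (LBINT x. g x)) {l..u}"
    by (metis has_integral_restrict_UNIV)
qed

text \<open>Lipschitz functions of compact support with their derivatives. A finite exceptional set
  and a discontinuous \<open>a\<close> are allowed so that \<open>a\<close> can be a combination of
  indicators of intervals.\<close>

definition test_pair :: "(real \<Rightarrow> real) \<Rightarrow> (real \<Rightarrow> real) \<Rightarrow> bool" where
  "test_pair A a \<longleftrightarrow> a \<in> borel_measurable borel \<and> continuous_on UNIV A \<and>
     (\<exists>K. \<forall>x. \<bar>a x\<bar> \<le> K) \<and>
     (\<exists>S. finite S \<and> (\<forall>x. x \<notin> S \<longrightarrow> (A has_real_derivative a x) (at x))) \<and>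
     (\<exists>l u. \<forall>x. x \<notin> {l..u} \<longrightarrow> A x = 0 \<and> a x = 0)"

lemma test_pairE:
  assumes "test_pair A a"
  obtains l u K S where "l < u" "K > 0" "finite S"
    "\<And>x. \<bar>a x\<bar> \<le> K" "\<And>x. \<bar>A x\<bar> \<le> K"
    "\<And>x. x \<notin> {l<..<u} \<Longrightarrow> A x = 0" "\<And>x. x \<notin> {l<..<u} \<Longrightarrow> a x = 0"
    "\<And>x. x \<notin> S \<Longrightarrow> (A has_real_derivative a x) (at x)"
    "a \<in> borel_measurable borel" "A \<in> borel_measurable borel" "continuous_on UNIV A"
proof -
  from assms obtain K S l u where *: "\<And>x. \<bar>a x\<bar> \<le> K" "finite S"
    "\<And>x. x \<notin> S \<Longrightarrow> (A has_real_derivative a x) (at x)"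
    "\<And>x. x \<notin> {l..u} \<Longrightarrow> A x = 0 \<and> a x = 0"
    and m: "a \<in> borel_measurable borel" and c: "continuous_on UNIV A"
    unfolding test_pair_def by blast
  obtain K' where K': "\<And>x. x \<in> {l..u} \<Longrightarrow> \<bar>A x\<bar> \<le> K'"
    using continuous_bounded_on_Icc[OF c] by metis
  have K0: "0 \<le> K" using *(1)[of 0] by linarith
  \<comment> \<open>Widening by 1 makes both functions vanish at the endpoints themselves; the
    \<open>max\<close> keeps the interval nondegenerate even if the given one is empty.\<close>
  show ?thesis
  proof (rule that[of "l - 1" "max (u + 1) l" "max K K' + 1" S])
    show "\<bar>A x\<bar> \<le> max K K' + 1" for x
      using K'[of x] *(4)[of x] K0 by (cases "x \<in> {l..u}") fastforce+
    show "\<bar>a x\<bar> \<le> max K K' + 1" for x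
      using *(1)[of x] by linarith
    show "A x = 0" "a x = 0" if "x \<notin> {l - 1<..<max (u + 1) l}" for x
      using that *(4)[of x] by force+
    show "A \<in> borel_measurable borel" by (rule borel_measurable_continuous_onI[OF c])
  qed (use * m c K0 in auto)
qed

lemma test_pair_cmult:
  assumes "test_pair A a"
  shows "test_pair (\<lambda>x. c * A x) (\<lambda>x. c * a x)"
proof -
  from assms obtain K S l u where *: "\<And>x. \<bar>a x\<bar> \<le> K" "finite S"
    "\<And>x. x \<notin> S \<Longrightarrow> (A has_real_derivative a x) (at x)"
    "\<And>x. x \<notin> {l..u} \<Longrightarrow> A x = 0 \<and> a x = 0"
    and [measurable]: "a \<in> borel_measurable borel" and c: "continuous_on UNIV A"
    unfolding test_pair_def by blast
  show ?thesis
    unfolding test_pair_def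
  proof (intro conjI)
    show "\<exists>K. \<forall>x. \<bar>c * a x\<bar> \<le> K"
      using *(1) by (auto simp: abs_mult intro!: exI[of _ "\<bar>c\<bar> * K"] mult_left_mono)
    show "\<exists>S. finite S \<and> (\<forall>x. x \<notin> S \<longrightarrow> ((\<lambda>x. c * A x) has_real_derivative c * a x) (at x))"
      using * by (intro exI[of _ S]) (auto intro!: DERIV_cmult)
    show "\<exists>l u. \<forall>x. x \<notin> {l..u} \<longrightarrow> c * A x = 0 \<and> c * a x = 0"
      using *(4) by (intro exI[of _ l] exI[of _ u]) auto
  qed (auto intro!: continuous_intros c)
qed

lemma test_pair_minus:
  assumes "test_pair A a" "test_pair B b"
  shows "test_pair (\<lambda>x. A x - B x) (\<lambda>x. a x - b x)"
proof -
  from assms(1) obtain K S l u where *: "\<And>x. \<bar>a x\<bar> \<le> K" "finite S"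
    "\<And>x. x \<notin> S \<Longrightarrow> (A has_real_derivative a x) (at x)"
    "\<And>x. x \<notin> {l..u} \<Longrightarrow> A x = 0 \<and> a x = 0"
    and [measurable]: "a \<in> borel_measurable borel" and c: "continuous_on UNIV A"
    unfolding test_pair_def by blast
  from assms(2) obtain K' S' l' u' where **: "\<And>x. \<bar>b x\<bar> \<le> K'" "finite S'"
    "\<And>x. x \<notin> S' \<Longrightarrow> (B has_real_derivative b x) (at x)"
    "\<And>x. x \<notin> {l'..u'} \<Longrightarrow> B x = 0 \<and> b x = 0"
    and [measurable]: "b \<in> borel_measurable borel" and c': "continuous_on UNIV B"
    unfolding test_pair_def by blast
  show ?thesis
    unfolding test_pair_def
  proof (intro conjI)
    have "\<bar>a x - b x\<bar> \<le> K + K'" for x using *(1)[of x] **(1)[of x] by linarith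
    then show "\<exists>K. \<forall>x. \<bar>a x - b x\<bar> \<le> K" by blast
    show "\<exists>S. finite S \<and> (\<forall>x. x \<notin> S \<longrightarrow> ((\<lambda>x. A x - B x) has_real_derivative a x - b x) (at x))"
      using * ** by (intro exI[of _ "S \<union> S'"]) (auto intro!: DERIV_diff)
    show "\<exists>l u. \<forall>x. x \<notin> {l..u} \<longrightarrow> A x - B x = 0 \<and> a x - b x = 0"
    proof (intro exI allI impI)
      fix x assume "x \<notin> {min l l'..max u u'}"
      then show "A x - B x = 0 \<and> a x - b x = 0" using *(4)[of x] **(4)[of x] by force
    qed
  qed (auto intro!: continuous_intros c c')
qed

lemma test_pair_integral:
  assumes "test_pair A a"
  shows "integrable lborel a" "(LBINT v:{..t}. a v) = A t" "(LBINT v. a v) = 0"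
proof -
  from assms obtain l u K S where *: "l < u" "finite S" "\<And>x. \<bar>a x\<bar> \<le> K"
    "\<And>x. x \<notin> {l<..<u} \<Longrightarrow> A x = 0" "\<And>x. x \<notin> {l<..<u} \<Longrightarrow> a x = 0"
    "\<And>x. x \<notin> S \<Longrightarrow> (A has_real_derivative a x) (at x)" "continuous_on UNIV A"
    and [measurable]: "a \<in> borel_measurable borel"
    by (metis test_pairE)
  show int: "integrable lborel a"
    by (rule bounded_support_integral(1)[of a l u K]) (use * in auto)
  have ftc: "(a has_integral (A t - A (min l t))) {min l t..t}" for t
    using * by (intro fundamental_theorem_of_calculus_interior_strong[OF *(2)])
      (auto simp: has_real_derivative_iff_has_vector_derivative intro: continuous_on_subset)
  have LB: "(LBINT v:{..t}. a v) = A t" for t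
  proof -
    have "((\<lambda>x. indicator {..t} x * a x) has_integral (LBINT x. indicator {..t} x * a x)) {min l t..t}"
    proof (rule bounded_support_integral(2)[of _ _ _ K])
      show "indicator {..t} x * a x = 0" if "x \<notin> {min l t..t}" for x
      proof (cases "x \<le> t")
        case True
        then have "x < l" using that by auto
        then show ?thesis using *(5)[of x] by auto
      qed auto
    qed (use *(3) order_trans[OF abs_ge_zero *(3)] in \<open>auto simp: indicator_def\<close>)
    then have "(a has_integral (LBINT x. indicator {..t} x * a x)) {min l t..t}"
      by (rule has_integral_eq[rotated]) auto
    with ftc[of t] have "(LBINT x. indicator {..t} x * a x) = A t - A (min l t)"
      by (rule has_integral_unique[symmetric])
    then show ?thesis using *(4)[of "min l t"] by (simp add: set_lebesgue_integral_def)
  qed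
  show "(LBINT v:{..t}. a v) = A t" by (rule LB)
  have "(LBINT v. a v) = (LBINT v:{..u}. a v)"
    unfolding set_lebesgue_integral_def
    by (intro Bochner_Integration.integral_cong) (auto simp: indicator_def *(5))
  then show "(LBINT v. a v) = 0" using LB[of u] *(4)[of u] by simp
qed

text \<open>\<open>W * A\<close> is continuous, has the sum of the two integrands as derivative off
  a finite set, and vanishes at both ends of the support.\<close>

lemma test_pair_by_parts:
  assumes "test_pair A a" and W: "\<And>x. (W has_real_derivative C x) (at x)" and C: "continuous_on UNIV C"
  shows "(LBINT x. W x * a x) + (LBINT x. C x * A x) = 0"
    "integrable lborel (\<lambda>x. W x * a x)" "integrable lborel (\<lambda>x. C x * A x)"
proof -
  from assms(1) obtain l u K S where *: "l < u" "K > 0" "finite S" "\<And>x. \<bar>a x\<bar> \<le> K" "\<And>x. \<bar>A x\<bar> \<le> K"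
    "\<And>x. x \<notin> {l<..<u} \<Longrightarrow> A x = 0" "\<And>x. x \<notin> {l<..<u} \<Longrightarrow> a x = 0"
    "\<And>x. x \<notin> S \<Longrightarrow> (A has_real_derivative a x) (at x)" "continuous_on UNIV A"
    and [measurable]: "a \<in> borel_measurable borel" "A \<in> borel_measurable borel"
    by (metis test_pairE)
  have cW: "continuous_on UNIV W" using W by (meson DERIV_isCont continuous_at_imp_continuous_on)
  have [measurable]: "W \<in> borel_measurable borel" "C \<in> borel_measurable borel"
    using cW C by (auto intro: borel_measurable_continuous_onI)
  obtain M M' where M: "\<And>x. x \<in> {l..u} \<Longrightarrow> \<bar>W x\<bar> \<le> M" "\<And>x. x \<in> {l..u} \<Longrightarrow> \<bar>C x\<bar> \<le> M'"
    using continuous_bounded_on_Icc[OF cW] continuous_bounded_on_Icc[OF C] by metis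
  have b1: "\<bar>W x * a x\<bar> \<le> M * K" "\<bar>C x * A x\<bar> \<le> M' * K" if "x \<in> {l..u}" for x
    unfolding abs_mult using M[OF that] *(2,4,5) by (auto intro!: mult_mono order_trans[OF abs_ge_zero])
  note i1 = bounded_support_integral[of "\<lambda>x. W x * a x" l u "M * K"]
  note i2 = bounded_support_integral[of "\<lambda>x. C x * A x" l u "M' * K"]
  show "integrable lborel (\<lambda>x. W x * a x)" "integrable lborel (\<lambda>x. C x * A x)"
    by (auto intro!: i1 i2 b1 simp: *(6,7))
  have h1: "((\<lambda>x. W x * a x) has_integral (LBINT x. W x * a x)) {l..u}"
    using b1 *(7) by (intro i1) auto
  have h2: "((\<lambda>x. C x * A x) has_integral (LBINT x. C x * A x)) {l..u}"
    using b1 *(6) by (intro i2) auto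
  have "((\<lambda>x. W x * a x + C x * A x) has_integral (W u * A u - W l * A l)) {l..u}"
    using *(1,8) W cW *(9)
    by (intro fundamental_theorem_of_calculus_interior_strong[OF *(3)])
      (auto simp: has_real_derivative_iff_has_vector_derivative[symmetric]
        intro!: derivative_eq_intros continuous_intros intro: continuous_on_subset)
  from has_integral_unique[OF has_integral_add[OF h1 h2] this]
  show "(LBINT x. W x * a x) + (LBINT x. C x * A x) = 0" using *(6)[of u] *(6)[of l] by simp
qed

text \<open>A ramp of height \<open>b - a\<close> stays constant to its right; subtracting
  \<open>b - a\<close> times the unit ramp on \<open>[0, 1]\<close> restores compact support. The
  reference interval will supply the constant of integration in the du Bois-Reymond lemma.\<close>

lemma test_pair_ramp:
  fixes a b :: real
  assumes "a \<le> b"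
  shows "test_pair (\<lambda>x. max 0 (min (b - a) (x - a)) - (b - a) * max 0 (min 1 x))
    (\<lambda>x. indicator {a<..b} x - (b - a) * indicator {0<..1} x)"
proof -
  have ramp: "((\<lambda>x. max 0 (min (d - c) (x - c))) has_real_derivative indicator {c<..d} x) (at x)"
    if "c \<le> d" "x \<notin> {c, d}" for c d x :: real
  proof -
    consider "x < c" | "c < x" "x < d" | "d < x" using \<open>x \<notin> {c, d}\<close> by fastforce
    then show ?thesis
    proof cases
      case 1
      then have "((\<lambda>x. 0) has_real_derivative 0) (at x)" by auto
      then show ?thesis
        using 1 \<open>c \<le> d\<close> by (subst DERIV_cong_ev[OF refl _ refl, where g = "\<lambda>x. 0"])
          (auto simp: indicator_def intro!: eventually_nhds_in_open[of "{..<c}", THEN eventually_mono])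
    next
      case 2
      then show ?thesis
        by (subst DERIV_cong_ev[OF refl _ refl, where g = "\<lambda>x. x - c"])
          (auto simp: indicator_def intro!: derivative_eq_intros eventually_nhds_in_open[of "{c<..<d}", THEN eventually_mono])
    next
      case 3
      then show ?thesis
        using \<open>c \<le> d\<close> by (subst DERIV_cong_ev[OF refl _ refl, where g = "\<lambda>x. d - c"])
          (auto simp: indicator_def intro!: derivative_eq_intros eventually_nhds_in_open[of "{d<..}", THEN eventually_mono])
    qed
  qed
  show ?thesis
    unfolding test_pair_def
  proof (intro conjI)
    have "\<bar>indicator {a<..b} x - (b - a) * indicator {0<..1} x\<bar> \<le> 1 + (b - a)" for x :: real
      using assms by (auto simp: indicator_def)
    then show "\<exists>K. \<forall>x::real. \<bar>indicator {a<..b} x - (b - a) * indicator {0<..1} x\<bar> \<le> K" by blast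
    show "\<exists>S. finite S \<and> (\<forall>x. x \<notin> S \<longrightarrow>
        ((\<lambda>x. max 0 (min (b - a) (x - a)) - (b - a) * max 0 (min 1 x)) has_real_derivative
         indicator {a<..b} x - (b - a) * indicator {0<..1} x) (at x))"
      using ramp[of a b] ramp[of 0 1] assms
      by (intro exI[of _ "{a, b, 0, 1}"]) (auto intro!: DERIV_diff DERIV_cmult)
    show "\<exists>l u. \<forall>x. x \<notin> {l..u} \<longrightarrow>
        max 0 (min (b - a) (x - a)) - (b - a) * max 0 (min 1 x) = 0 \<and>
        indicator {a<..b} x - (b - a) * indicator {0<..1} x = 0"
      using assms
      by (intro exI[of _ "min a 0"] exI[of _ "max b 1"]) (auto simp: indicator_def max_def min_def)
  qed (auto intro!: continuous_intros)
qed

text \<open>On each \<open>{-n<..n}\<close> the positive and negative parts of \<open>k\<close> are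
  densities of two measures that agree on all open rays and hence coincide. Uniqueness of densities
  finishes the argument.\<close>

lemma AE_zero_of_interval_integrals:
  fixes k :: "real \<Rightarrow> real"
  assumes int: "\<And>l u. set_integrable lborel {l..u} k"
    and zero: "\<And>a b. a \<le> b \<Longrightarrow> (LBINT x:{a<..b}. k x) = 0"
  shows "AE x in lborel. k x = 0"
proof -
  have int': "set_integrable lborel {a<..b} k" for a b
    by (rule set_integrable_subset[OF int[of a b]]) auto
  have "AE x in lborel. x \<in> {-real n<..real n} \<longrightarrow> k x = 0" for n
  proof -
    define g where "g = (\<lambda>x. indicator {-real n<..real n} x * k x)"
    have gi: "integrable lborel g"
      using int'[of "- real n" "real n"] by (simp add: g_def set_integrable_def)
    then have [measurable]: "g \<in> borel_measurable borel" by auto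
    have eq: "(\<integral>\<^sup>+y. ennreal (g y) * indicator {x<..} y \<partial>lborel) =
        (\<integral>\<^sup>+y. ennreal (- g y) * indicator {x<..} y \<partial>lborel)
        \<and> (\<integral>\<^sup>+y. ennreal (g y) * indicator {x<..} y \<partial>lborel) < \<infinity>
        \<and> (\<integral>\<^sup>+y. ennreal (- g y) * indicator {x<..} y \<partial>lborel) < \<infinity>" for x
    proof -
      let ?h = "\<lambda>y. g y * indicator {x<..} y"
      have hi: "integrable lborel ?h"
        using integrable_real_mult_indicator[OF _ gi, of "{x<..}"] by simp
      have h0: "(LBINT y. ?h y) = 0"
      proof (cases "max x (- real n) \<le> real n")
        case True
        have "(LBINT y. ?h y) = (LBINT y:{max x (- real n)<..real n}. k y)"
          unfolding set_lebesgue_integral_def g_def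
          by (intro Bochner_Integration.integral_cong) (auto simp: indicator_def)
        then show ?thesis using zero[OF True] by simp
      next
        case False
        then have "?h = (\<lambda>y. 0)" by (auto simp: g_def indicator_def)
        then show ?thesis by simp
      qed
      have a: "(\<integral>\<^sup>+y. ennreal (g y) * indicator {x<..} y \<partial>lborel) = (\<integral>\<^sup>+y. ennreal (?h y) \<partial>lborel)"
        "(\<integral>\<^sup>+y. ennreal (- g y) * indicator {x<..} y \<partial>lborel) = (\<integral>\<^sup>+y. ennreal (- ?h y) \<partial>lborel)"
        by (auto intro!: nn_integral_cong simp: indicator_def)
      have f: "(\<integral>\<^sup>+y. ennreal (?h y) \<partial>lborel) < \<infinity>" "(\<integral>\<^sup>+y. ennreal (- ?h y) \<partial>lborel) < \<infinity>"
        using hi by (auto simp: real_integrable_def less_top)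
      have "enn2real (\<integral>\<^sup>+y. ennreal (?h y) \<partial>lborel) = enn2real (\<integral>\<^sup>+y. ennreal (- ?h y) \<partial>lborel)"
        using h0 real_lebesgue_integral_def[OF hi] by simp
      with f show ?thesis unfolding a
        by (metis ennreal_enn2real infinity_ennreal_def)
    qed
    have "density lborel (\<lambda>y. ennreal (g y)) = density lborel (\<lambda>y. ennreal (- g y))"
      using eq by (intro measure_eqI_lessThan) (auto simp: emeasure_density)
    then have "AE x in lborel. ennreal (g x) = ennreal (- g x)"
      by (intro sigma_finite_measure.density_unique[OF sigma_finite_lborel]) auto
    then show ?thesis
    proof (rule AE_mp, intro AE_I2 impI)
      \<comment> \<open>\<open>ennreal\<close> truncates negative values to 0, so one side is 0 and
        the equation forces \<open>g x = 0\<close>.\<close>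
      fix x assume "ennreal (g x) = ennreal (- g x)" "x \<in> {-real n<..real n}"
      then show "k x = 0"
        by (cases "k x" "0::real" rule: linorder_cases) (auto simp: g_def ennreal_neg)
    qed
  qed
  then have "AE x in lborel. \<forall>n. x \<in> {-real n<..real n} \<longrightarrow> k x = 0"
    by (subst AE_all_countable) blast
  then show ?thesis
  proof (rule AE_mp, intro AE_I2 impI)
    fix x assume *: "\<forall>n. x \<in> {-real n<..real n} \<longrightarrow> k x = 0"
    obtain n where "\<bar>x\<bar> < real n" using reals_Archimedean2 by blast
    then have "x \<in> {-real n<..real n}" by auto
    with * show "k x = 0" by blast
  qed
qed

text \<open>Subtracting an antiderivative \<open>W0\<close> of \<open>C\<close> leaves a remainder
  \<open>R\<close> orthogonal to every \<open>a\<close>. Ramp pairs then say that the integral of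
  \<open>R\<close> over \<open>{a<..b}\<close> is \<open>b - a\<close> times its integral over
  \<open>{0<..1}\<close>, so \<open>R\<close> is almost everywhere constant.\<close>

lemma du_Bois_Reymond:
  fixes h C :: "real \<Rightarrow> real"
  assumes h: "\<And>l u. set_integrable lborel {l..u} h"
    and C: "continuous_on UNIV C"
    and weak: "\<And>A a. test_pair A a \<Longrightarrow> (LBINT x. h x * a x) + (LBINT x. C x * A x) = 0"
  obtains W where "\<And>x. (W has_real_derivative C x) (at x)" "AE x in lborel. h x = W x"
proof -
  obtain W0 where W0: "\<And>x. (W0 has_real_derivative C x) (at x)"
    using antiderivative_UNIV[OF C] by metis
  have cW: "continuous_on UNIV W0" using W0 by (meson DERIV_isCont continuous_at_imp_continuous_on)
  define R where "R = (\<lambda>x. h x - W0 x)"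
  have W0i: "set_integrable lborel {l..u} W0" for l u
    by (rule borel_integrable_atLeastAtMost') (rule continuous_on_subset[OF cW], simp)
  have Ri: "set_integrable lborel {l..u} R" for l u
    unfolding R_def by (intro set_integral_diff h W0i)
  have Ri': "set_integrable lborel {l<..u} R" for l u
    by (rule set_integrable_subset[OF Ri[of l u]]) auto
  have hi': "set_integrable lborel {l<..u} h" for l u
    by (rule set_integrable_subset[OF h[of l u]]) auto
  define c where "c = (LBINT x:{0<..1}. R x)"
  have key: "(LBINT x:{a<..b}. R x) = (b - a) * c" if "a \<le> b" for a b
  proof -
    note t = test_pair_ramp[OF that]
    let ?a = "\<lambda>x. indicator {a<..b} x - (b - a) * indicator {0<..1::real} x :: real"
    note p = test_pair_by_parts[OF t W0 C]
    have "integrable lborel (\<lambda>x. indicator {a<..b} x *\<^sub>R h x - (b - a) * (indicator {0<..1} x *\<^sub>R h x))"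
      using hi'[of a b] hi'[of 0 1] unfolding set_integrable_def by auto
    moreover have "(\<lambda>x. indicator {a<..b} x *\<^sub>R h x - (b - a) * (indicator {0<..1} x *\<^sub>R h x)) = (\<lambda>x. h x * ?a x)"
      by (auto simp: algebra_simps)
    ultimately have hi: "integrable lborel (\<lambda>x. h x * ?a x)" by simp
    have "0 = (LBINT x. h x * ?a x) - (LBINT x. W0 x * ?a x)"
      using weak[OF t] p(1) by simp
    also have "\<dots> = (LBINT x. h x * ?a x - W0 x * ?a x)"
      using hi p(2) by simp
    also have "\<dots> = (LBINT x. indicator {a<..b} x *\<^sub>R R x - (b - a) * (indicator {0<..1} x *\<^sub>R R x))"
      by (intro Bochner_Integration.integral_cong) (auto simp: R_def algebra_simps)
    also have "\<dots> = (LBINT x:{a<..b}. R x) - (b - a) * c"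
      using Ri'[of a b] Ri'[of 0 1] unfolding set_lebesgue_integral_def set_integrable_def c_def
      by (subst Bochner_Integration.integral_diff) auto
    finally show ?thesis by simp
  qed
  have ci: "set_integrable lborel {l..u} (\<lambda>_. c)" for l u :: real
    by (rule borel_integrable_atLeastAtMost'[OF continuous_on_const])
  have "AE x in lborel. R x - c = 0"
  proof (rule AE_zero_of_interval_integrals)
    show "set_integrable lborel {l..u} (\<lambda>x. R x - c)" for l u
      by (intro set_integral_diff Ri ci)
    fix a b :: real assume ab: "a \<le> b"
    have "set_integrable lborel {a<..b} (\<lambda>_. c)"
      by (rule set_integrable_subset[OF ci[of a b]]) auto
    then have "(LBINT x:{a<..b}. R x - c) = (LBINT x:{a<..b}. R x) - (LBINT x:{a<..b}. c)"
      by (intro set_integral_diff Ri')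
    also have "(LBINT x:{a<..b}. c) = (b - a) * c"
      using ab by (simp add: set_lebesgue_integral_def)
    finally show "(LBINT x:{a<..b}. R x - c) = 0" using key[OF ab] by simp
  qed
  then have "AE x in lborel. h x = W0 x + c" by (auto simp: R_def)
  moreover have "((\<lambda>x. W0 x + c) has_real_derivative C x) (at x)" for x
    using W0[of x] by (auto intro!: derivative_eq_intros)
  ultimately show ?thesis by (rule that[rotated])
qed

section \<open>One-dimensional transport\<close>

text \<open>Strict monotonicity pulls order neighbourhoods of \<open>\<Phi> z\<close> back to those
  of \<open>z\<close>. Transport maps are known only through an equation for
  \<open>\<Phi> (T x)\<close>; this turns convergence of its right-hand side into convergence of the
  map.\<close>

lemma strict_mono_tendsto_cancel:
  fixes \<Phi> :: "real \<Rightarrow> real"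
  assumes \<Phi>: "strict_mono \<Phi>" and lim: "((\<lambda>x. \<Phi> (T x)) \<longlongrightarrow> \<Phi> z) F"
  shows "(T \<longlongrightarrow> z) F"
proof (rule order_tendstoI)
  fix a assume "a < z"
  then have "\<Phi> a < \<Phi> z" using \<Phi> by (simp add: strict_monoD)
  then show "eventually (\<lambda>x. a < T x) F"
    using order_tendstoD(1)[OF lim, of "\<Phi> a"] \<Phi> by (simp add: strict_mono_less)
next
  fix a assume "z < a"
  then have "\<Phi> z < \<Phi> a" using \<Phi> by (simp add: strict_monoD)
  then show "eventually (\<lambda>x. T x < a) F"
    using order_tendstoD(2)[OF lim, of "\<Phi> a"] \<Phi> by (simp add: strict_mono_less)
qed

lemma strict_mono_deriv_cancel:
  fixes \<Phi> :: "real \<Rightarrow> real"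
  assumes \<Phi>: "strict_mono \<Phi>" "(\<Phi> has_real_derivative d) (at (T t))" "d \<noteq> 0"
    and Q: "((\<lambda>s. \<Phi> (T s)) has_real_derivative e) (at t)"
  shows "(T has_real_derivative e / d) (at t)"
proof -
  have inj: "\<Phi> a = \<Phi> b \<longleftrightarrow> a = b" for a b using \<Phi>(1) by (simp add: strict_mono_eq)
  have T: "(T \<longlongrightarrow> T t) (at t)"
    using DERIV_isCont[OF Q] by - (rule strict_mono_tendsto_cancel[OF \<Phi>(1)], simp add: isCont_def)
  \<comment> \<open>The slope of \<open>\<Phi>\<close> at \<open>T t\<close>, filled in by its limit
    \<open>d\<close>, so that the quotient below is also correct at points \<open>y\<close> with
    \<open>T y = T t\<close>.\<close>
  define s where "s = (\<lambda>y. if y = T t then d else (\<Phi> y - \<Phi> (T t)) / (y - T t))"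
  have "isCont s (T t)"
    using \<Phi>(2) unfolding isCont_def has_field_derivative_iff s_def
    by (auto intro: Lim_transform_eventually simp: eventually_at_filter)
  then have sT: "((\<lambda>y. s (T y)) \<longlongrightarrow> d) (at t)"
    using isCont_tendsto_compose[OF _ T] by (fastforce simp: s_def)
  have "((\<lambda>y. ((\<Phi> (T y) - \<Phi> (T t)) / (y - t)) / s (T y)) \<longlongrightarrow> e / d) (at t)"
    using Q \<Phi>(3) by (intro tendsto_divide sT) (auto simp: has_field_derivative_iff)
  moreover have "((\<Phi> (T y) - \<Phi> (T t)) / (y - t)) / s (T y) = (T y - T t) / (y - t)" for y
    by (auto simp: s_def inj)
  ultimately show ?thesis by (simp add: has_field_derivative_iff)
qed

section \<open>Distribution functions of densities on the line\<close>

lemma cdf_mono_strict: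
  fixes g :: "real \<Rightarrow> real"
  assumes g: "integrable lborel g" "\<And>x. g x > 0"
  shows "strict_mono (\<lambda>t. LBINT v:{..t}. g v)"
proof (rule strict_monoI)
  fix s t :: real assume "s < t"
  have i: "integrable lborel (\<lambda>x. indicator {..t} x *\<^sub>R g x)" for t
    using integrable_mult_indicator[OF _ g(1)] by simp
  let ?h = "\<lambda>x. indicator {..t} x *\<^sub>R g x - indicator {..s} x *\<^sub>R g x"
  have h: "?h x = indicator {s<..t} x * g x" for x
    using \<open>s < t\<close> by (auto simp: indicator_def)
  have hi: "integrable lborel ?h" using i by simp
  have h0: "0 \<le> ?h x" for x
    unfolding h using less_imp_le[OF g(2)] by simp
  then have nn: "0 \<le> (LBINT x. ?h x)"
    by (intro Bochner_Integration.integral_nonneg)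
  have "(LBINT x. ?h x) \<noteq> 0"
  proof
    assume "(LBINT x. ?h x) = 0"
    then have "AE x in lborel. ?h x = 0"
      by (subst (asm) integral_nonneg_eq_0_iff_AE[OF hi AE_I2[OF h0]])
    then have "AE x in lborel. x \<notin> {s<..t}"
      by eventually_elim (use less_imp_neq[OF g(2)] in \<open>auto simp: h indicator_def split: if_splits\<close>)
    then have "emeasure lborel {s<..t} = 0"
      by (subst (asm) AE_iff_measurable[of "{s<..t}"]) auto
    then show False using \<open>s < t\<close> by simp
  qed
  with nn have "0 < (LBINT x. ?h x)" by simp
  then show "(LBINT v:{..s}. g v) < (LBINT v:{..t}. g v)"
    unfolding set_lebesgue_integral_def using i by simp
qed

lemma cdf_tendsto:
  fixes g :: "real \<Rightarrow> real"
  assumes g: "integrable lborel g"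
  shows "((\<lambda>t. LBINT v:{..t}. g v) \<longlongrightarrow> 0) at_bot"
    "((\<lambda>t. LBINT v:{..t}. g v) \<longlongrightarrow> (LBINT v. g v)) at_top"
proof -
  have [measurable]: "g \<in> borel_measurable borel" using g by simp
  show "((\<lambda>t. LBINT v:{..t}. g v) \<longlongrightarrow> (LBINT v. g v)) at_top"
    unfolding set_lebesgue_integral_def
  proof (rule integral_dominated_convergence_at_top[where w = "\<lambda>x. \<bar>g x\<bar>"])
    show "AE x in lborel. ((\<lambda>i. indicat_real {..i} x *\<^sub>R g x) \<longlongrightarrow> g x) at_top"
      by (intro AE_I2 tendsto_eventually eventually_mono[OF eventually_ge_at_top]) (auto simp: indicator_def)
  qed (use g in \<open>auto simp: indicator_def\<close>)
  have "((\<lambda>t. LBINT v:{..-t}. g v) \<longlongrightarrow> (LBINT v::real. 0)) at_top"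
    unfolding set_lebesgue_integral_def
  proof (rule integral_dominated_convergence_at_top[where w = "\<lambda>x. \<bar>g x\<bar>"])
    have "eventually (\<lambda>i. indicat_real {..- i} x *\<^sub>R g x = 0) at_top" for x
      using eventually_gt_at_top[of "-x"] by eventually_elim (auto simp: indicator_def)
    then show "AE x in lborel. ((\<lambda>i. indicat_real {..- i} x *\<^sub>R g x) \<longlongrightarrow> 0) at_top"
      by (intro AE_I2 tendsto_eventually)
  qed (use g in \<open>auto simp: indicator_def\<close>)
  then show "((\<lambda>t. LBINT v:{..t}. g v) \<longlongrightarrow> 0) at_bot"
    by (simp add: at_bot_mirror filterlim_filtermap)
qed

lemma cdf_bounds:
  fixes g :: "real \<Rightarrow> real"
  assumes g: "integrable lborel g" "\<And>x. g x > 0"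
  shows "0 < (LBINT v:{..t}. g v)" "(LBINT v:{..t}. g v) < (LBINT v. g v)"
proof -
  note mono = cdf_mono_strict[OF g]
  have "0 \<le> (LBINT v:{..t-1}. g v)"
    using less_imp_le[OF g(2)] by (simp add: set_lebesgue_integral_def)
  then show "0 < (LBINT v:{..t}. g v)"
    using strict_monoD[OF mono, of "t-1" t] by simp
  have "eventually (\<lambda>s. (LBINT v:{..t+1}. g v) \<le> (LBINT v:{..s}. g v)) at_top"
    using eventually_ge_at_top[of "t+1"] by eventually_elim (rule strict_mono_leD[OF mono])
  then have "(LBINT v:{..t+1}. g v) \<le> (LBINT v. g v)"
    by (intro tendsto_lowerbound[OF cdf_tendsto(2)[OF g(1)]]) auto
  then show "(LBINT v:{..t}. g v) < (LBINT v. g v)"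
    using strict_monoD[OF mono, of t "t+1"] by simp
qed

lemma cdf_diff:
  fixes g :: "real \<Rightarrow> real"
  assumes g: "integrable lborel g" and c: "continuous_on UNIV g" and "s \<le> t"
  shows "(LBINT v:{..t}. g v) - (LBINT v:{..s}. g v) = integral {s..t} g"
proof -
  have si: "set_integrable lborel A g" if "A \<in> sets lborel" for A
    using integrable_mult_indicator[OF that g] by (simp add: set_integrable_def)
  have "{..t} = {..s} \<union> {s<..t}" using \<open>s \<le> t\<close> by auto
  then have "(LBINT v:{..t}. g v) = (LBINT v:{..s}. g v) + (LBINT v:{s<..t}. g v)"
    by (simp, subst set_integral_Un) (auto intro: si)
  moreover have "(LBINT v:{s<..t}. g v) = (LBINT v:{s..t}. g v)"
    unfolding set_lebesgue_integral_def
    by (rule integral_cong_AE) (use g in \<open>auto simp: indicator_def intro!: eventually_mono[OF AE_lborel_singleton[of s]]\<close>)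
  ultimately show ?thesis
    using set_borel_integral_eq_integral(2)[OF si[of "{s..t}"]] by simp
qed

lemma cdf_deriv:
  fixes g :: "real \<Rightarrow> real"
  assumes g: "integrable lborel g" and c: "continuous_on UNIV g"
  shows "((\<lambda>t. LBINT v:{..t}. g v) has_real_derivative g t) (at t)"
proof -
  have "((\<lambda>s. (LBINT v:{..t-1}. g v) + integral {t-1..s} g) has_real_derivative 0 + g t) (at t within {t-1..t+1})"
    by (intro derivative_intros integral_has_real_derivative) (auto intro: continuous_on_subset[OF c])
  then have "((\<lambda>s. (LBINT v:{..t-1}. g v) + integral {t-1..s} g) has_real_derivative g t) (at t)"
    by (subst (asm) at_within_interior) auto
  then show ?thesis
  proof (rule DERIV_cong_ev[THEN iffD1, rotated 3])
    have "eventually (\<lambda>s. s \<in> {t-1<..}) (nhds t)"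
      by (rule eventually_nhds_in_open) auto
    then show "eventually (\<lambda>s. (LBINT v:{..t-1}. g v) + integral {t-1..s} g = (LBINT v:{..s}. g v)) (nhds t)"
    proof eventually_elim
      case (elim s)
      then show ?case using cdf_diff[OF g c, of "t-1" s] by auto
    qed
  qed auto
qed

text \<open>With \<open>M\<close> and \<open>N\<close> primitives of \<open>z * \<phi> z\<close> and \<open>z^2 * \<phi> z\<close>, the difference of the two
  integrands is a total derivative plus \<open>2 * (M (T1 t) - M (T0 t)) - 2 * t * B t\<close>.\<close>

lemma transport_cost_perturbation:
  fixes \<phi> \<Phi> T0 T1 Q q B b :: "real \<Rightarrow> real"
  assumes \<phi>: "continuous_on UNIV \<phi>" "\<And>z. \<phi> z > 0" "\<And>z. (\<Phi> has_real_derivative \<phi> z) (at z)"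
    and mono: "strict_mono \<Phi>"
    and T: "\<And>t. \<Phi> (T0 t) = Q t" "\<And>t. \<Phi> (T1 t) = Q t + B t"
    and q: "\<And>t. (Q has_real_derivative q t) (at t)" "continuous_on UNIV q"
    and B: "test_pair B b"
  shows "integrable lborel (\<lambda>t. (t - T1 t)^2 * (q t + b t) - (t - T0 t)^2 * q t)"
    "(LBINT t. (t - T1 t)^2 * (q t + b t) - (t - T0 t)^2 * q t) \<le> -2 * (LBINT t. (t - T1 t) * B t)"
    "continuous_on UNIV T1"
proof -
  obtain l u K S where *: "l < u" "K > 0" "finite S" "\<And>x. \<bar>b x\<bar> \<le> K" "\<And>x. \<bar>B x\<bar> \<le> K"
    "\<And>x. x \<notin> {l<..<u} \<Longrightarrow> B x = 0" "\<And>x. x \<notin> {l<..<u} \<Longrightarrow> b x = 0"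
    "\<And>x. x \<notin> S \<Longrightarrow> (B has_real_derivative b x) (at x)"
    and [measurable]: "b \<in> borel_measurable borel" "B \<in> borel_measurable borel" and cB: "continuous_on UNIV B"
    by (rule test_pairE[OF B], rule that)
  have cQ: "continuous_on UNIV Q" using q by (meson DERIV_isCont continuous_at_imp_continuous_on)
  show cT1: "continuous_on UNIV T1"
    unfolding continuous_on_def
  proof
    fix x
    have "((\<lambda>t. Q t + B t) \<longlongrightarrow> Q x + B x) (at x within UNIV)"
      using cQ cB by (intro tendsto_add) (auto simp: continuous_on_def)
    then show "(T1 \<longlongrightarrow> T1 x) (at x within UNIV)"
      by - (rule strict_mono_tendsto_cancel[OF mono], simp add: T)
  qed
  have cT0: "continuous_on UNIV T0"
    unfolding continuous_on_def
  proof
    fix x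
    have "(Q \<longlongrightarrow> Q x) (at x within UNIV)"
      using cQ by (auto simp: continuous_on_def)
    then show "(T0 \<longlongrightarrow> T0 x) (at x within UNIV)"
      by - (rule strict_mono_tendsto_cancel[OF mono], simp add: T)
  qed
  have [measurable]: "T0 \<in> borel_measurable borel" "T1 \<in> borel_measurable borel" "q \<in> borel_measurable borel"
    using cT0 cT1 q(2) by (auto intro: borel_measurable_continuous_onI)
  have eqT: "T1 t = T0 t" if "t \<notin> {l<..<u}" for t
    using T[of t] *(6)[OF that] strict_mono_eq[OF mono, of "T1 t" "T0 t"] by simp
  have dT0: "(T0 has_real_derivative q t / \<phi> (T0 t)) (at t)" for t
    by (rule strict_mono_deriv_cancel[OF mono \<phi>(3)]) (use \<phi>(2)[of "T0 t"] q(1)[of t] T(1) in auto)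
  have dT1: "(T1 has_real_derivative (q t + b t) / \<phi> (T1 t)) (at t)" if "t \<notin> S" for t
    by (rule strict_mono_deriv_cancel[OF mono \<phi>(3)])
      (use \<phi>(2)[of "T1 t"] q(1)[of t] T(2) *(8)[OF that] in \<open>auto intro!: derivative_intros\<close>)
  obtain M where M: "\<And>z. (M has_real_derivative z * \<phi> z) (at z)"
    by (rule antiderivative_UNIV[of "\<lambda>z. z * \<phi> z"]) (intro continuous_intros \<phi>(1), rule that)
  obtain N where N: "\<And>z. (N has_real_derivative z^2 * \<phi> z) (at z)"
    by (rule antiderivative_UNIV[of "\<lambda>z. z^2 * \<phi> z"]) (intro continuous_intros \<phi>(1), rule that)
  have cM: "continuous_on UNIV M" using M by (meson DERIV_isCont continuous_at_imp_continuous_on)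
  have cN: "continuous_on UNIV N" using N by (meson DERIV_isCont continuous_at_imp_continuous_on)
  have cM': "continuous_on UNIV (\<lambda>t. M (T0 t))" "continuous_on UNIV (\<lambda>t. M (T1 t))"
    using cT0 cT1 by (auto intro!: continuous_on_compose2[OF cM])
  have cN': "continuous_on UNIV (\<lambda>t. N (T0 t))" "continuous_on UNIV (\<lambda>t. N (T1 t))"
    using cT0 cT1 by (auto intro!: continuous_on_compose2[OF cN])
  \<comment> \<open>Either cost integral alone may diverge. The difference has bounded support,
    because the two maps agree wherever \<open>B\<close> vanishes.\<close>
  define D where "D = (\<lambda>t. (t - T1 t)^2 * (q t + b t) - (t - T0 t)^2 * q t)"
  have [measurable]: "D \<in> borel_measurable borel" unfolding D_def by measurable
  have D0: "D t = 0" if "t \<notin> {l<..<u}" for t using eqT[OF that] *(7)[OF that] by (simp add: D_def)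
  have cont2: "continuous_on UNIV (\<lambda>t. (t - T1 t)^2)" "continuous_on UNIV (\<lambda>t. (t - T0 t)^2 * q t)"
    using cT0 cT1 q(2) by (auto intro!: continuous_intros)
  obtain K1 where K1: "K1 > 0" "\<And>t. t \<in> {l..u} \<Longrightarrow> \<bar>(t - T1 t)^2\<bar> \<le> K1"
    using continuous_bounded_on_Icc[OF cont2(1)] by blast
  obtain K2 where K2: "\<And>t. t \<in> {l..u} \<Longrightarrow> \<bar>(t - T0 t)^2 * q t\<bar> \<le> K2"
    using continuous_bounded_on_Icc[OF cont2(2)] by blast
  obtain K3 where K3: "\<And>t. t \<in> {l..u} \<Longrightarrow> \<bar>q t\<bar> \<le> K3"
    using continuous_bounded_on_Icc[OF q(2)] by blast
  have bD: "\<bar>D t\<bar> \<le> K1 * (K3 + K) + K2" if "t \<in> {l..u}" for t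
  proof -
    have "\<bar>(t - T1 t)^2 * (q t + b t)\<bar> \<le> K1 * (K3 + K)"
      unfolding abs_mult using K1(1) K1(2)[OF that] K3[OF that] *(4)[of t]
      by (intro mult_mono) (auto intro: order_trans[OF abs_triangle_ineq])
    then show ?thesis unfolding D_def using K2[OF that] by linarith
  qed
  have Dint: "integrable lborel D" "(D has_integral (LBINT t. D t)) {l..u}"
    by (rule bounded_support_integral[of D l u, OF _ bD]; use D0 in force)+
  then show "integrable lborel (\<lambda>t. (t - T1 t)^2 * (q t + b t) - (t - T0 t)^2 * q t)" by (simp add: D_def)
  define \<Psi> where "\<Psi> = (\<lambda>t. (N (T1 t) - N (T0 t)) - 2 * t * (M (T1 t) - M (T0 t)) + t^2 * B t)"
  define r where "r = (\<lambda>t. 2 * (M (T1 t) - M (T0 t)) - 2 * t * B t)"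
  have "((\<lambda>t. D t - r t) has_integral (\<Psi> u - \<Psi> l)) {l..u}"
  proof (rule fundamental_theorem_of_calculus_interior_strong[OF *(3)])
    show "l \<le> u" using *(1) by simp
    show "continuous_on {l..u} \<Psi>"
      unfolding \<Psi>_def
      by (rule continuous_on_subset[OF _ subset_UNIV]) (intro continuous_intros cM' cN' cB)
    fix t assume t: "t \<in> {l<..<u} - S"
    then have tS: "t \<notin> S" by simp
    have nz: "\<phi> z \<noteq> 0" for z using \<phi>(2)[of z] by simp
    have d: "((\<lambda>t. N (T1 t)) has_real_derivative (T1 t)^2 * (q t + b t)) (at t)"
      "((\<lambda>t. N (T0 t)) has_real_derivative (T0 t)^2 * q t) (at t)"
      "((\<lambda>t. M (T1 t)) has_real_derivative T1 t * (q t + b t)) (at t)"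
      "((\<lambda>t. M (T0 t)) has_real_derivative T0 t * q t) (at t)"
      using DERIV_chain2[OF N dT1[OF tS]] DERIV_chain2[OF N dT0]
        DERIV_chain2[OF M dT1[OF tS]] DERIV_chain2[OF M dT0] nz by simp_all
    have "(\<Psi> has_real_derivative D t - r t) (at t)"
      unfolding \<Psi>_def
      by (rule derivative_eq_intros d *(8)[OF tS] refl)+
        (simp add: D_def r_def algebra_simps power2_eq_square)
    then show "(\<Psi> has_vector_derivative D t - r t) (at t)"
      by (simp add: has_real_derivative_iff_has_vector_derivative)
  qed
  moreover have "\<Psi> u = 0" "\<Psi> l = 0" using eqT *(6) by (auto simp: \<Psi>_def)
  ultimately have "((\<lambda>t. D t - r t) has_integral 0) {l..u}" by simp
  from has_integral_diff[OF Dint(2) this]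
  have r_int: "(r has_integral (LBINT t. D t)) {l..u}" by simp
  \<comment> \<open>\<open>M z - T1 t * \<Phi> z\<close> has derivative
    \<open>(z - T1 t) * \<phi> z\<close>, so it is smallest at \<open>z = T1 t\<close>, on whichever
    side \<open>T0 t\<close> lies. This convexity is what puts the perturbed map into the
    bound.\<close>
  have Ma: "M (T1 t) - M (T0 t) \<le> T1 t * B t" for t
  proof -
    have d: "((\<lambda>z. M z - T1 t * \<Phi> z) has_real_derivative (z - T1 t) * \<phi> z) (at z)" for z
      by (rule derivative_eq_intros M \<phi>(3) refl)+ (simp add: algebra_simps)
    have "M (T1 t) - T1 t * \<Phi> (T1 t) \<le> M (T0 t) - T1 t * \<Phi> (T0 t)"
    proof (cases "T1 t \<le> T0 t")
      case True
      show ?thesis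
        by (rule DERIV_nonneg_imp_nondecreasing[OF True])
          (use d less_imp_le[OF \<phi>(2)] in \<open>metis mult_nonneg_nonneg diff_ge_0_iff_ge\<close>)
    next
      case False
      then have le: "T0 t \<le> T1 t" by simp
      show ?thesis
        by (rule DERIV_nonpos_imp_nonincreasing[OF le])
          (use d less_imp_le[OF \<phi>(2)] in \<open>metis mult_nonpos_nonneg diff_le_0_iff_le\<close>)
    qed
    then show ?thesis unfolding T by (simp add: algebra_simps)
  qed
  have cR: "continuous_on UNIV (\<lambda>t. (t - T1 t) * B t)"
    by (intro continuous_intros cT1 cB)
  obtain K4 where K4: "\<And>t. t \<in> {l..u} \<Longrightarrow> \<bar>(t - T1 t) * B t\<bar> \<le> K4"
    using continuous_bounded_on_Icc[OF cR] by blast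
  have "((\<lambda>t. (t - T1 t) * B t) has_integral (LBINT t. (t - T1 t) * B t)) {l..u}"
    by (rule bounded_support_integral(2)[OF _ K4]) (use *(6) cT1 in \<open>auto intro: borel_measurable_continuous_onI\<close>)
  from has_integral_mult_right[OF this, of "-2"]
  have R_int: "((\<lambda>t. -2 * ((t - T1 t) * B t)) has_integral -2 * (LBINT t. (t - T1 t) * B t)) {l..u}" .
  show "(LBINT t. (t - T1 t)^2 * (q t + b t) - (t - T0 t)^2 * q t) \<le> -2 * (LBINT t. (t - T1 t) * B t)"
    unfolding D_def[symmetric]
  proof (rule has_integral_le[OF r_int R_int])
    show "r t \<le> -2 * ((t - T1 t) * B t)" for t
      using Ma[of t] by (simp add: r_def algebra_simps)
  qed
qed

section \<open>Fibrewise transport maps\<close>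

lemma integral_abs_bound_Icc:
  fixes g :: "real \<Rightarrow> real"
  assumes "g \<in> borel_measurable borel" "l \<le> u"
    and bnd: "\<And>x. x \<in> {l..u} \<Longrightarrow> \<bar>g x\<bar> \<le> K"
    and supp: "\<And>x. x \<notin> {l..u} \<Longrightarrow> g x = 0"
  shows "\<bar>LBINT x. g x\<bar> \<le> K * (u - l)"
proof -
  have K: "0 \<le> K" using bnd[of l] \<open>l \<le> u\<close> by auto
  have "(g has_integral (LBINT x. g x)) (cbox l u)"
    using bounded_support_integral(2)[OF assms(1) bnd supp] by simp
  from has_integral_bound[OF K this] bnd \<open>l \<le> u\<close> show ?thesis by auto
qed

text \<open>Writing the half-line as a condition under the integral makes the integrand jointly
  measurable in base point, level and integration variable, as Tonelli and Fubini will
  require.\<close>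

lemma H_x_measurable [measurable (raw)]:
  assumes [measurable]: "q \<in> borel_measurable borel" "X \<in> borel_measurable M" "Y \<in> borel_measurable M"
  shows "(\<lambda>w. H_x q (X w) (Y w)) \<in> borel_measurable M"
proof -
  have "H_x q x y = (LBINT v. (if v \<le> y then q (x, v) else 0))" for x y
    unfolding H_x_def set_lebesgue_integral_def
    by (intro Bochner_Integration.integral_cong) (auto simp: indicator_def)
  then show ?thesis by simp
qed

definition transport_map :: "(real \<times> real \<Rightarrow> real) \<Rightarrow> (real \<times> real \<Rightarrow> real) \<Rightarrow> real \<Rightarrow> real \<Rightarrow> real" where
  "transport_map f q x t = G f x (H_x q x t / marg1 f x)"

definition fibre_cost :: "(real \<times> real \<Rightarrow> real) \<Rightarrow> (real \<times> real \<Rightarrow> real) \<Rightarrow> ennreal" where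
  "fibre_cost f q = (\<integral>\<^sup>+x. \<integral>\<^sup>+t. ennreal ((t - transport_map f q x t)\<^sup>2 * q (x, t)) \<partial>lborel \<partial>lborel)"

text \<open>Only measurability is asked, because perturbing by discontinuous \<open>a\<close> and
  \<open>b\<close> leaves the continuous densities. Normalisation is encoded by the fibre integrals;
  the total mass is recovered from them by Tonelli.\<close>

definition fibre_density :: "(real \<times> real \<Rightarrow> real) \<Rightarrow> (real \<times> real \<Rightarrow> real) \<Rightarrow> bool" where
  "fibre_density f q \<longleftrightarrow> q \<in> borel_measurable borel \<and> (\<forall>z. q z > 0) \<and>
     (\<forall>x. has_bochner_integral lborel (\<lambda>t. q (x, t)) (marg1 f x))"

locale fibre_transport =
  fixes f p :: "real \<times> real \<Rightarrow> real"
  assumes f_cont: "continuous_on UNIV f" and f_pos: "f z > 0"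
    and p_cont: "continuous_on UNIV p" and p_dens: "fibre_density f p"
begin

abbreviation T :: "(real \<times> real \<Rightarrow> real) \<Rightarrow> real \<Rightarrow> real \<Rightarrow> real" where
  "T \<equiv> transport_map f"

lemma p_pos: "p z > 0"
  using p_dens unfolding fibre_density_def by blast

lemma f_measurable [measurable]: "f \<in> borel_measurable borel"
  and p_measurable [measurable]: "p \<in> borel_measurable borel"
  using f_cont p_cont by (auto intro: borel_measurable_continuous_onI)

lemma f_section_cont: "continuous_on UNIV (\<lambda>t. f (x, t))"
  and p_section_cont: "continuous_on UNIV (\<lambda>t. p (x, t))"
  using f_cont p_cont by (auto intro!: continuous_on_compose2[OF f_cont] continuous_on_compose2[OF p_cont] continuous_intros)

lemma fibre_densityD:
  assumes "fibre_density f q"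
  shows "q \<in> borel_measurable borel" "q z > 0" "integrable lborel (\<lambda>t. q (x, t))"
    "(LBINT t. q (x, t)) = marg1 f x"
  using assms unfolding fibre_density_def has_bochner_integral_iff by blast+

lemma H_x_mono: "fibre_density f q \<Longrightarrow> strict_mono (H_x q x)"
  unfolding H_x_def by (intro cdf_mono_strict fibre_densityD)

lemma H_x_bounds:
  assumes "fibre_density f q"
  shows "0 < H_x q x t" "H_x q x t < marg1 f x"
  using cdf_bounds[of "\<lambda>t. q (x, t)"] fibre_densityD[OF assms] by (auto simp: H_x_def)

text \<open>A non-integrable section would give \<open>marg1 f x\<close> the default value 0,
  whereas the section of \<open>p\<close> over \<open>x\<close> has this number as its integral and
  is positive.\<close>

lemma f_section_integrable: "integrable lborel (\<lambda>t. f (x, t))"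
proof (rule ccontr)
  assume "\<not> ?thesis"
  then have "marg1 f x = 0" by (simp add: marg1_def not_integrable_integral_eq)
  with H_x_bounds[OF p_dens, of x 0] show False by simp
qed

lemma f_dens: "fibre_density f f"
  using f_section_integrable f_pos by (auto simp: fibre_density_def has_bochner_integral_iff marg1_def)

lemma marg1_pos: "marg1 f x > 0"
  using H_x_bounds[OF p_dens, of x 0] by simp

lemma H_x_f_deriv: "((H_x f x) has_real_derivative f (x, z)) (at z)"
  and H_x_p_deriv: "((H_x p x) has_real_derivative p (x, z)) (at z)"
  unfolding H_x_def using cdf_deriv[OF f_section_integrable f_section_cont]
    cdf_deriv[OF fibre_densityD(3)[OF p_dens] p_section_cont] by simp_all

text \<open>Since \<open>G\<close> is an \<open>inv\<close>, a preimage has to exist: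
  \<open>H_x f x\<close> is continuous with limits 0 and \<open>marg1 f x\<close>, and
  \<open>H_x q x t\<close> lies strictly between them. Later arguments about the map rest on this
  equation rather than on \<open>inv\<close>.\<close>

lemma transport_map_eq:
  assumes "fibre_density f q"
  shows "H_x f x (T q x t) = H_x q x t"
proof -
  note b = H_x_bounds[OF assms, of x t]
  have ev: "eventually (\<lambda>z. H_x f x z < H_x q x t) at_bot" "eventually (\<lambda>z. H_x q x t < H_x f x z) at_top"
    using order_tendstoD(2)[OF cdf_tendsto(1)[OF f_section_integrable, of x] b(1)]
      order_tendstoD(1)[OF cdf_tendsto(2)[OF f_section_integrable, of x], of "H_x q x t"] b(2)
    by (auto simp: H_x_def marg1_def)
  obtain z1 where z1: "H_x f x z1 < H_x q x t"
    using eventually_happens[OF ev(1)] by auto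
  obtain z2 where z2: "H_x q x t < H_x f x z2"
    using eventually_happens[OF ev(2)] by auto
  have "z1 \<le> z2"
    using z1 z2 strict_mono_less[OF H_x_mono[OF f_dens, of x], of z1 z2] by linarith
  moreover have "continuous_on {z1..z2} (H_x f x)"
    using H_x_f_deriv by (meson DERIV_isCont continuous_at_imp_continuous_on)
  ultimately obtain z where z: "H_x f x z = H_x q x t"
    using IVT'[of "H_x f x" z1 "H_x q x t" z2] z1 z2 by auto
  have c: "cond_cdf21 f x y = H_x f x y / marg1 f x" for y
    by (simp add: cond_cdf21_def H_x_def)
  have "cond_cdf21 f x z = H_x q x t / marg1 f x"
    by (simp add: c z)
  then have "cond_cdf21 f x (T q x t) = H_x q x t / marg1 f x"
    unfolding transport_map_def G_def by (metis f_inv_into_f rangeI)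
  then show ?thesis using marg1_pos[of x] by (simp add: c)
qed

lemma transport_map_less_eq_iff:
  assumes "fibre_density f q"
  shows "z \<le> T q x t \<longleftrightarrow> H_x f x z \<le> H_x q x t"
  using strict_mono_less_eq[OF H_x_mono[OF f_dens, of x], of z "T q x t"] transport_map_eq[OF assms]
  by simp

lemma transport_map_mono: "fibre_density f q \<Longrightarrow> strict_mono (T q x)"
  by (intro strict_monoI)
    (metis H_x_mono f_dens strict_mono_less transport_map_eq)

lemma transport_map_le: "fibre_density f q \<Longrightarrow> s \<le> t \<Longrightarrow> T q x s \<le> T q x t"
  using strict_mono_leD[OF transport_map_mono] by blast

lemma transport_map_cong: "H_x q x t = H_x q' x t \<Longrightarrow> T q x t = T q' x t"
  by (simp add: transport_map_def)

lemma transport_map_cont: "continuous_on UNIV (T p x)"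
  unfolding continuous_on_def
proof
  fix t
  have "((H_x p x) \<longlongrightarrow> H_x p x t) (at t within UNIV)"
    using DERIV_isCont[OF H_x_p_deriv] by (simp add: isCont_def)
  then show "(T p x \<longlongrightarrow> T p x t) (at t within UNIV)"
    by - (rule strict_mono_tendsto_cancel[OF H_x_mono[OF f_dens, of x]], simp only: transport_map_eq[OF p_dens])
qed

text \<open>Superlevel sets of the map are given by comparing two jointly measurable distribution
  functions, so measurability of an inverse in its parameter never has to be discussed.\<close>

lemma transport_map_measurable [measurable (raw)]:
  assumes q: "fibre_density f q"
    and [measurable]: "X \<in> borel_measurable M" "Y \<in> borel_measurable M"
  shows "(\<lambda>w. T q (X w) (Y w)) \<in> borel_measurable M"
proof -
  have [measurable]: "q \<in> borel_measurable borel" using q by (rule fibre_densityD)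
  show ?thesis
    unfolding borel_measurable_iff_ge transport_map_less_eq_iff[OF q]
    by measurable
qed

text \<open>Large displacements are expensive. If \<open>\<bar>T p x t\<bar>\<close> exceeds
  \<open>\<bar>t\<bar> + 2\<close>, the displacement is at least \<open>d\<close> on a unit interval
  beside \<open>t\<close>, where \<open>p\<close> is at least \<open>m\<close>; so the fibre cost
  \<open>J x\<close> is at least \<open>d * m\<close>, and \<open>J\<close> has finite
  integral.\<close>

lemma transport_map_locally_integrable:
  assumes fin: "fibre_cost f p < \<infinity>"
  shows "set_integrable lborel {l..u} (\<lambda>x. T p x t)"
proof -
  have m0: "compact ({l..u} \<times> {t-1..t+1})" by (intro compact_Times) auto
  have "\<exists>m>0. \<forall>z\<in>{l..u} \<times> {t-1..t+1}. m \<le> p z"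
  proof (cases "{l..u} \<times> {t-1..t+1} = {}")
    case False
    from continuous_attains_inf[OF m0 False continuous_on_subset[OF p_cont]]
    obtain z where "z \<in> {l..u} \<times> {t-1..t+1}" "\<forall>y\<in>{l..u} \<times> {t-1..t+1}. p z \<le> p y"
      by blast
    then show ?thesis using p_pos[of z] by blast
  qed (auto intro: exI[of _ 1])
  then obtain m where m: "m > 0" "\<And>x s. x \<in> {l..u} \<Longrightarrow> s \<in> {t-1..t+1} \<Longrightarrow> m \<le> p (x, s)" by auto
  define J where "J = (\<lambda>x. \<integral>\<^sup>+s. ennreal ((s - T p x s)\<^sup>2 * p (x, s)) \<partial>lborel)"
  have [measurable]: "J \<in> borel_measurable borel"
    unfolding J_def using p_dens by measurable
  have bound: "ennreal \<bar>T p x t\<bar> \<le> ennreal (\<bar>t\<bar> + 2) + J x * ennreal (1 / m)" if x: "x \<in> {l..u}" for x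
  proof (cases "\<bar>T p x t\<bar> \<le> \<bar>t\<bar> + 2")
    case True
    then show ?thesis by (intro order_trans[OF ennreal_leI[OF True]]) auto
  next
    case False
    \<comment> \<open>The interval lies on the side of \<open>t\<close> towards which monotonicity
      carries the map further from the origin. Moving \<open>s\<close> by at most 1 costs the
      \<open>- 1\<close> in \<open>d\<close>, and \<open>d \<ge> 1\<close> allows
      \<open>d\<^sup>2\<close> to be replaced by \<open>d\<close>.\<close>
    define I where "I = (if T p x t \<ge> 0 then {t..t+1} else {t-1..t})"
    define d where "d = \<bar>T p x t\<bar> - \<bar>t\<bar> - 1"
    have d: "d \<ge> 1" using False by (simp add: d_def)
    have "d \<le> \<bar>s - T p x s\<bar>" if "s \<in> I" for s
    proof (cases "T p x t \<ge> 0")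
      case True
      then have "T p x t \<le> T p x s" "s \<le> t + 1"
        using that transport_map_le[OF p_dens] by (auto simp: I_def)
      then show ?thesis using True by (simp add: d_def)
    next
      case F: False
      then have "T p x s \<le> T p x t" "t - 1 \<le> s"
        using that transport_map_le[OF p_dens] by (auto simp: I_def)
      then show ?thesis using F by (simp add: d_def)
    qed
    then have "d\<^sup>2 \<le> (s - T p x s)\<^sup>2" if "s \<in> I" for s
      using that d by (metis abs_ge_self abs_le_square_iff abs_of_nonneg order_trans zero_le_one)
    moreover have "d \<le> d\<^sup>2" using d by (simp add: power2_eq_square)
    ultimately have "d * m \<le> (s - T p x s)\<^sup>2 * p (x, s)" if "s \<in> I" for s
    proof -
      have "m \<le> p (x, s)" using that by (intro m(2)[OF x]) (auto simp: I_def split: if_splits)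
      with that show ?thesis
        using \<open>d \<le> d\<^sup>2\<close> \<open>s \<in> I \<Longrightarrow> d\<^sup>2 \<le> (s - T p x s)\<^sup>2\<close> m(1) d by (intro mult_mono) auto
    qed
    then have "(\<integral>\<^sup>+s. ennreal (d * m) * indicator I s \<partial>lborel) \<le> J x"
      unfolding J_def by (intro nn_integral_mono) (auto simp: indicator_def ennreal_leI)
    moreover have "(\<integral>\<^sup>+s. ennreal (d * m) * indicator I s \<partial>lborel) = ennreal (d * m)"
      by (subst nn_integral_cmult_indicator) (auto simp: I_def)
    ultimately have "ennreal (d * m) * ennreal (1 / m) \<le> J x * ennreal (1 / m)"
      by (simp add: mult_right_mono)
    moreover have "ennreal (d * m) * ennreal (1 / m) = ennreal d"
      using m(1) d by (simp add: ennreal_mult[symmetric])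
    ultimately have "ennreal (\<bar>t\<bar> + 1) + ennreal d \<le> ennreal (\<bar>t\<bar> + 2) + J x * ennreal (1 / m)"
      by (intro add_mono) (auto intro: ennreal_leI)
    moreover have "ennreal (\<bar>t\<bar> + 1) + ennreal d = ennreal \<bar>T p x t\<bar>"
      using d by (subst ennreal_plus[symmetric]) (auto simp: d_def)
    ultimately show ?thesis by argo
  qed
  have "(\<integral>\<^sup>+x. ennreal (norm (indicator {l..u} x *\<^sub>R T p x t)) \<partial>lborel)
      \<le> (\<integral>\<^sup>+x. ennreal (\<bar>t\<bar> + 2) * indicator {l..u} x + J x * ennreal (1 / m) \<partial>lborel)"
    using bound by (intro nn_integral_mono) (auto simp: indicator_def)
  also have "\<dots> = (\<integral>\<^sup>+x. ennreal (\<bar>t\<bar> + 2) * indicator {l..u} x \<partial>lborel) + fibre_cost f p * ennreal (1 / m)"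
    by (simp add: nn_integral_add nn_integral_multc fibre_cost_def J_def[symmetric])
  also have "\<dots> < \<infinity>"
  proof -
    have "emeasure lborel {l..u} < \<infinity>" by (cases "l \<le> u") auto
    then have "(\<integral>\<^sup>+x. ennreal (\<bar>t\<bar> + 2) * indicator {l..u} x \<partial>lborel) < \<infinity>"
      by (subst nn_integral_cmult_indicator) (auto simp: ennreal_mult_less_top)
    then show ?thesis using fin by (auto simp: ennreal_mult_less_top)
  qed
  finally show ?thesis
    unfolding set_integrable_def using p_dens by (intro integrableI_bounded) auto
qed

end

section \<open>First variation of the fibre cost\<close>

context fibre_transport
begin

definition perturb :: "real \<Rightarrow> (real \<Rightarrow> real) \<Rightarrow> (real \<Rightarrow> real) \<Rightarrow> real \<times> real \<Rightarrow> real" where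
  "perturb c a b = (\<lambda>z. p z + c * a (fst z) * b (snd z))"

lemma perturb_measurable:
  assumes [measurable]: "a \<in> borel_measurable borel" "b \<in> borel_measurable borel"
  shows "perturb c a b \<in> borel_measurable borel"
proof -
  have [measurable]: "fst \<in> borel_measurable (borel :: (real \<times> real) measure)"
    "snd \<in> borel_measurable (borel :: (real \<times> real) measure)"
    by (auto intro!: borel_measurable_continuous_onI continuous_intros)
  show ?thesis unfolding perturb_def by measurable
qed

lemma perturb_section:
  assumes "test_pair B b"
  shows "has_bochner_integral lborel (\<lambda>t. perturb c a b (x, t)) (marg1 f x)"
    "H_x (perturb c a b) x t = H_x p x t + c * a x * B t"
proof -
  note B = test_pair_integral[OF assms]
  note P = fibre_densityD[OF p_dens]
  show "has_bochner_integral lborel (\<lambda>t. perturb c a b (x, t)) (marg1 f x)"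
    unfolding has_bochner_integral_iff perturb_def using P(3,4) B(1,3) by simp
  have si: "set_integrable lborel {..t} g" if "integrable lborel g" for g :: "real \<Rightarrow> real"
    using integrable_mult_indicator[OF _ that, of "{..t}"] by (simp add: set_integrable_def)
  have "H_x (perturb c a b) x t = (LBINT v:{..t}. p (x, v) + (c * a x) * b v)"
    by (simp add: H_x_def perturb_def)
  also have "\<dots> = H_x p x t + (LBINT v:{..t}. (c * a x) * b v)"
    unfolding H_x_def using B(1) by (intro set_integral_add si P) auto
  also have "(LBINT v:{..t}. (c * a x) * b v) = c * a x * B t"
    using B(2) by simp
  finally show "H_x (perturb c a b) x t = H_x p x t + c * a x * B t" .
qed

lemma perturb_dens:
  assumes "a \<in> borel_measurable borel" "test_pair B b" "\<And>z. perturb c a b z > 0"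
  shows "fibre_density f (perturb c a b)"
  unfolding fibre_density_def
proof (intro conjI allI)
  show "perturb c a b \<in> borel_measurable borel"
    using assms(1,2) by (intro perturb_measurable) (auto simp: test_pair_def)
qed (use assms(3) perturb_section(1)[OF assms(2)] in auto)

lemma perturb_pos:
  assumes A: "test_pair A a" and B: "test_pair B b"
  obtains e where "e > 0" "\<And>c z. \<bar>c\<bar> \<le> e \<Longrightarrow> perturb c a b z > 0"
proof -
  obtain l u K S where a: "l < u" "K > 0" "finite S" "\<And>x. \<bar>a x\<bar> \<le> K" "\<And>x. \<bar>A x\<bar> \<le> K"
    "\<And>x. x \<notin> {l<..<u} \<Longrightarrow> A x = 0" "\<And>x. x \<notin> {l<..<u} \<Longrightarrow> a x = 0"
    "\<And>x. x \<notin> S \<Longrightarrow> (A has_real_derivative a x) (at x)"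
    "a \<in> borel_measurable borel" "A \<in> borel_measurable borel" "continuous_on UNIV A"
    by (rule test_pairE[OF A], rule that)
  obtain l' u' K' S' where b: "l' < u'" "K' > 0" "finite S'" "\<And>x. \<bar>b x\<bar> \<le> K'" "\<And>x. \<bar>B x\<bar> \<le> K'"
    "\<And>x. x \<notin> {l'<..<u'} \<Longrightarrow> B x = 0" "\<And>x. x \<notin> {l'<..<u'} \<Longrightarrow> b x = 0"
    "\<And>x. x \<notin> S' \<Longrightarrow> (B has_real_derivative b x) (at x)"
    "b \<in> borel_measurable borel" "B \<in> borel_measurable borel" "continuous_on UNIV B"
    by (rule test_pairE[OF B], rule that)
  have "compact ({l..u} \<times> {l'..u'})" "{l..u} \<times> {l'..u'} \<noteq> {}"
    using a(1) b(1) by (auto intro: compact_Times)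
  from continuous_attains_inf[OF this continuous_on_subset[OF p_cont]]
  obtain z0 where "\<And>z. z \<in> {l..u} \<times> {l'..u'} \<Longrightarrow> p z0 \<le> p z" by blast
  then obtain m where m: "m > 0" "\<And>z. z \<in> {l..u} \<times> {l'..u'} \<Longrightarrow> m \<le> p z"
    using p_pos[of z0] by blast
  \<comment> \<open>For such \<open>c\<close> the perturbation is at most \<open>m / 2\<close> on
    the rectangle carrying it, where \<open>p\<close> is at least \<open>m\<close>.\<close>
  show ?thesis
  proof (rule that[of "m / (2 * K * K')"])
    show "m / (2 * K * K') > 0" using m a b by simp
    fix c z assume c: "\<bar>c\<bar> \<le> m / (2 * K * K')"
    show "perturb c a b z > 0"
    proof (cases "z \<in> {l..u} \<times> {l'..u'}")
      case True
      have "\<bar>c * a (fst z) * b (snd z)\<bar> \<le> (m / (2 * K * K')) * K * K'"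
        unfolding abs_mult using c a(4) b(4) a(2) b(2) m(1) by (intro mult_mono) auto
      also have "\<dots> = m / 2" using a(2) b(2) by simp
      finally show ?thesis using m(2)[OF True] m(1) by (simp add: perturb_def)
    next
      case False
      then have "a (fst z) = 0 \<or> b (snd z) = 0" using a(7)[of "fst z"] b(7)[of "snd z"] by (cases z) force
      then show ?thesis using p_pos[of z] by (auto simp: perturb_def)
    qed
  qed
qed

section \<open>The first-order functional and its majorants\<close>

lemma transport_map_perturb_outside:
  assumes "test_pair B b" "B t = 0"
  shows "T (perturb c a b) x t = T p x t"
  by (rule transport_map_cong) (simp add: perturb_section(2)[OF assms(1)] assms(2))

text \<open>Multiplied by \<open>-2 * c * a x\<close>, this bounds the change of the cost in the
  fibre over \<open>x\<close> when \<open>q\<close> is the perturbed density.\<close>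

definition variation :: "(real \<times> real \<Rightarrow> real) \<Rightarrow> (real \<Rightarrow> real) \<Rightarrow> real \<Rightarrow> real" where
  "variation q B x = (LBINT t. (t - T q x t) * B t)"

lemma variation_measurable [measurable (raw)]:
  assumes "fibre_density f q" and [measurable]: "B \<in> borel_measurable borel" "X \<in> borel_measurable M"
  shows "(\<lambda>w. variation q B (X w)) \<in> borel_measurable M"
  unfolding variation_def using assms(1) by measurable

text \<open>Where \<open>B\<close> vanishes the two transport maps agree, so between two such points
  monotonicity squeezes the perturbed map between values of the unperturbed one.\<close>

lemma variation_bound:
  assumes B: "test_pair B b" and supp: "l < u" "\<And>t. t \<notin> {l<..<u} \<Longrightarrow> B t = 0" and K: "\<And>t. \<bar>B t\<bar> \<le> K"
    and q: "fibre_density f (perturb c a b)"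
  shows "t \<in> {l..u} \<Longrightarrow> \<bar>(t - T (perturb c a b) x t) * B t\<bar> \<le> (\<bar>l\<bar> + \<bar>u\<bar> + \<bar>T p x l\<bar> + \<bar>T p x u\<bar>) * K"
    "\<bar>variation (perturb c a b) B x\<bar> \<le> (\<bar>l\<bar> + \<bar>u\<bar> + \<bar>T p x l\<bar> + \<bar>T p x u\<bar>) * K * (u - l)"
proof -
  have Kp: "0 \<le> K" using K[of 0] by linarith
  have T: "T (perturb c a b) x l = T p x l" "T (perturb c a b) x u = T p x u"
    using supp by (auto intro!: transport_map_perturb_outside[OF B])
  have *: "\<bar>(t - T (perturb c a b) x t) * B t\<bar> \<le> (\<bar>l\<bar> + \<bar>u\<bar> + \<bar>T p x l\<bar> + \<bar>T p x u\<bar>) * K" if "t \<in> {l..u}" for t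
  proof -
    have "T p x l \<le> T (perturb c a b) x t" "T (perturb c a b) x t \<le> T p x u"
      using that transport_map_le[OF q, of l t x] transport_map_le[OF q, of t u x] T by auto
    then have "\<bar>t - T (perturb c a b) x t\<bar> \<le> \<bar>l\<bar> + \<bar>u\<bar> + \<bar>T p x l\<bar> + \<bar>T p x u\<bar>"
      using that by auto
    then show ?thesis unfolding abs_mult using K Kp by (intro mult_mono) auto
  qed
  then show "t \<in> {l..u} \<Longrightarrow> \<bar>(t - T (perturb c a b) x t) * B t\<bar> \<le> (\<bar>l\<bar> + \<bar>u\<bar> + \<bar>T p x l\<bar> + \<bar>T p x u\<bar>) * K" .
  have [measurable]: "B \<in> borel_measurable borel"
    using B by (auto simp: test_pair_def intro: borel_measurable_continuous_onI)
  have "(\<lambda>t. (t - T (perturb c a b) x t) * B t) \<in> borel_measurable borel"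
    using q by measurable
  then show "\<bar>variation (perturb c a b) B x\<bar> \<le> (\<bar>l\<bar> + \<bar>u\<bar> + \<bar>T p x l\<bar> + \<bar>T p x u\<bar>) * K * (u - l)"
    unfolding variation_def using supp
    by (intro integral_abs_bound_Icc *) (auto intro: less_imp_le)
qed

text \<open>The majorant involves the unperturbed map at two fixed levels only. Being independent of
  \<open>c\<close>, it serves both for integrability and for the limit \<open>c\<close> to
  0.\<close>

lemma variation_majorant_integrable:
  assumes fin: "fibre_cost f p < \<infinity>"
  shows "integrable lborel (\<lambda>x. indicator {l'..u'} x * ((\<bar>l\<bar> + \<bar>u\<bar> + \<bar>T p x l\<bar> + \<bar>T p x u\<bar>) * K))"
proof -
  have "set_integrable lborel {l'..u'} (\<lambda>x. \<bar>l\<bar> + \<bar>u\<bar> + \<bar>T p x l\<bar> + \<bar>T p x u\<bar>)"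
    by (intro set_integral_add set_integrable_abs transport_map_locally_integrable[OF fin]
        borel_integrable_atLeastAtMost'[OF continuous_on_const])
  then have "integrable lborel (\<lambda>x. (indicator {l'..u'} x *\<^sub>R (\<bar>l\<bar> + \<bar>u\<bar> + \<bar>T p x l\<bar> + \<bar>T p x u\<bar>)) * K)"
    unfolding set_integrable_def by simp
  then show ?thesis by (simp only: real_scaleR_def mult.assoc)
qed

lemma weighted_variation_integrable:
  assumes fin: "fibre_cost f p < \<infinity>" and A: "test_pair A a" and B: "test_pair B b"
    and q: "fibre_density f (perturb c a b)"
  shows "integrable lborel (\<lambda>x. a x * variation (perturb c a b) B x)"
proof -
  obtain l u K S where a: "l < u" "K > 0" "finite S" "\<And>x. \<bar>a x\<bar> \<le> K" "\<And>x. \<bar>A x\<bar> \<le> K"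
    "\<And>x. x \<notin> {l<..<u} \<Longrightarrow> A x = 0" "\<And>x. x \<notin> {l<..<u} \<Longrightarrow> a x = 0"
    "\<And>x. x \<notin> S \<Longrightarrow> (A has_real_derivative a x) (at x)"
    and [measurable]: "a \<in> borel_measurable borel" "A \<in> borel_measurable borel" and "continuous_on UNIV A"
    by (rule test_pairE[OF A], rule that)
  obtain l' u' K' S' where b: "l' < u'" "K' > 0" "finite S'" "\<And>x. \<bar>b x\<bar> \<le> K'" "\<And>x. \<bar>B x\<bar> \<le> K'"
    "\<And>x. x \<notin> {l'<..<u'} \<Longrightarrow> B x = 0" "\<And>x. x \<notin> {l'<..<u'} \<Longrightarrow> b x = 0"
    "\<And>x. x \<notin> S' \<Longrightarrow> (B has_real_derivative b x) (at x)"
    and [measurable]: "b \<in> borel_measurable borel" "B \<in> borel_measurable borel" and "continuous_on UNIV B"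
    by (rule test_pairE[OF B], rule that)
  show ?thesis
  proof (rule Bochner_Integration.integrable_bound[OF
        variation_majorant_integrable[OF fin, of l u l' u' "K' * (u' - l') * K"]])
    show "(\<lambda>x. a x * variation (perturb c a b) B x) \<in> borel_measurable lborel"
      using q by measurable
    show "AE x in lborel. norm (a x * variation (perturb c a b) B x) \<le>
       norm (indicat_real {l..u} x * ((\<bar>l'\<bar> + \<bar>u'\<bar> + \<bar>T p x l'\<bar> + \<bar>T p x u'\<bar>) * (K' * (u' - l') * K)))"
    proof (rule AE_I2)
      fix x
      let ?M = "\<bar>l'\<bar> + \<bar>u'\<bar> + \<bar>T p x l'\<bar> + \<bar>T p x u'\<bar>"
      show "norm (a x * variation (perturb c a b) B x) \<le> norm (indicat_real {l..u} x * (?M * (K' * (u' - l') * K)))"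
      proof (cases "x \<in> {l<..<u}")
        case True
        have "\<bar>variation (perturb c a b) B x\<bar> * \<bar>a x\<bar> \<le> ?M * K' * (u' - l') * K"
          using b(2) \<open>l' < u'\<close> a(4) by (intro mult_mono variation_bound(2)[OF B b(1) b(6) b(5) q]) auto
        then show ?thesis using True b(1,2) a(2) by (simp add: abs_mult mult.commute mult.assoc mult.left_commute)
      qed (use a(7) in auto)
    qed
  qed
qed

text \<open>The fibrewise estimate is integrated over \<open>x\<close>. Single fibre costs may be
  infinite, so it is kept in \<open>ennreal\<close>, with the positive and negative parts of
  \<open>V\<close> on opposite sides; real numbers enter only after all four integrals are known to
  be finite.\<close>

lemma fibre_cost_perturb:
  assumes fin: "fibre_cost f p < \<infinity>" and A: "test_pair A a" and B: "test_pair B b"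
    and q: "fibre_density f (perturb c a b)"
  shows "fibre_cost f (perturb c a b) < \<infinity>"
    "enn2real (fibre_cost f (perturb c a b)) \<le>
      enn2real (fibre_cost f p) - 2 * c * (LBINT x. a x * variation (perturb c a b) B x)"
proof -
  let ?q = "perturb c a b"
  define V where "V = (\<lambda>x. - 2 * c * (a x * variation ?q B x))"
  define jp where "jp = (\<lambda>x t. (t - T p x t)\<^sup>2 * p (x, t))"
  define jq where "jq = (\<lambda>x t. (t - T ?q x t)\<^sup>2 * ?q (x, t))"
  have [measurable]: "?q \<in> borel_measurable borel" using q by (rule fibre_densityD)
  have jpm [measurable (raw)]: "(\<lambda>w. jp (X w) (Y w)) \<in> borel_measurable M"
    if [measurable]: "X \<in> borel_measurable M" "Y \<in> borel_measurable M" for X Y and M :: "'z measure"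
    unfolding jp_def using p_dens by measurable
  have jqm [measurable (raw)]: "(\<lambda>w. jq (X w) (Y w)) \<in> borel_measurable M"
    if [measurable]: "X \<in> borel_measurable M" "Y \<in> borel_measurable M" for X Y and M :: "'z measure"
    unfolding jq_def using q by measurable
  have jp0: "0 \<le> jp x t" and jq0: "0 \<le> jq x t" for x t
    using less_imp_le[OF p_pos] less_imp_le[OF fibre_densityD(2)[OF q]] by (auto simp: jp_def jq_def)
  have Vint: "integrable lborel V"
    unfolding V_def using weighted_variation_integrable[OF fin A B q] by simp
  then have [measurable]: "V \<in> borel_measurable borel" by auto
  have diff: "integrable lborel (\<lambda>t. jq x t - jp x t)" "(LBINT t. jq x t - jp x t) \<le> V x" for x
  proof -
    have t: "test_pair (\<lambda>t. c * a x * B t) (\<lambda>t. c * a x * b t)" by (rule test_pair_cmult[OF B])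
    have eq: "H_x f x (T ?q x t) = H_x p x t + c * a x * B t" for t
      using transport_map_eq[OF q] perturb_section(2)[OF B] by simp
    note pert = transport_cost_perturbation[OF f_section_cont f_pos H_x_f_deriv H_x_mono[OF f_dens]
        transport_map_eq[OF p_dens] eq H_x_p_deriv p_section_cont t]
    have j: "(\<lambda>t. (t - T ?q x t)^2 * (p (x, t) + c * a x * b t) - (t - T p x t)^2 * p (x, t)) = (\<lambda>t. jq x t - jp x t)"
      by (auto simp: jq_def jp_def perturb_def)
    show "integrable lborel (\<lambda>t. jq x t - jp x t)" using pert(1) unfolding j .
    have "(\<lambda>t. (t - T ?q x t) * (c * a x * B t)) = (\<lambda>t. (c * a x) * ((t - T ?q x t) * B t))" by auto
    then have "(LBINT t. (t - T ?q x t) * (c * a x * B t)) = c * a x * variation ?q B x"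
      by (simp add: variation_def)
    with pert(2) show "(LBINT t. jq x t - jp x t) \<le> V x" unfolding j by (simp add: V_def)
  qed
  \<comment> \<open>Where the fibre cost of \<open>p\<close> is infinite there is nothing to prove.
    Elsewhere finiteness passes to the perturbed density, since the difference of the integrands is
    integrable.\<close>
  have ptw: "(\<integral>\<^sup>+t. ennreal (jq x t) \<partial>lborel) + ennreal (- V x) \<le> (\<integral>\<^sup>+t. ennreal (jp x t) \<partial>lborel) + ennreal (V x)" for x
  proof (cases "(\<integral>\<^sup>+t. ennreal (jp x t) \<partial>lborel) = \<infinity>")
    case False
    then have ip: "integrable lborel (jp x)"
      using jp0 by (intro integrableI_nonneg) (auto simp: less_top)
    have iq: "integrable lborel (jq x)"
      using Bochner_Integration.integrable_add[OF ip diff(1)[of x]] by simp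
    have le: "(LBINT t. jq x t) \<le> (LBINT t. jp x t) + V x"
      using diff(2)[of x] Bochner_Integration.integral_diff[OF iq ip] by simp
    have "(\<integral>\<^sup>+t. ennreal (jq x t) \<partial>lborel) = ennreal (LBINT t. jq x t)"
      "(\<integral>\<^sup>+t. ennreal (jp x t) \<partial>lborel) = ennreal (LBINT t. jp x t)"
      using ip iq jp0 jq0 by (auto intro!: nn_integral_eq_integral)
    moreover have "0 \<le> (LBINT t. jq x t)" "0 \<le> (LBINT t. jp x t)" using jp0 jq0 by auto
    ultimately show ?thesis
      using le by (cases "V x \<ge> 0") (auto simp: ennreal_neg ennreal_plus[symmetric] simp del: ennreal_plus intro!: ennreal_leI)
  qed auto
  have cq: "fibre_cost f ?q = (\<integral>\<^sup>+x. \<integral>\<^sup>+t. ennreal (jq x t) \<partial>lborel \<partial>lborel)"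
    and cp: "fibre_cost f p = (\<integral>\<^sup>+x. \<integral>\<^sup>+t. ennreal (jp x t) \<partial>lborel \<partial>lborel)"
    by (auto simp: fibre_cost_def jq_def jp_def)
  have "fibre_cost f ?q + (\<integral>\<^sup>+x. ennreal (- V x) \<partial>lborel) = (\<integral>\<^sup>+x. (\<integral>\<^sup>+t. ennreal (jq x t) \<partial>lborel) + ennreal (- V x) \<partial>lborel)"
    unfolding cq by (rule nn_integral_add[symmetric]) measurable
  also have "\<dots> \<le> (\<integral>\<^sup>+x. (\<integral>\<^sup>+t. ennreal (jp x t) \<partial>lborel) + ennreal (V x) \<partial>lborel)"
    by (intro nn_integral_mono ptw)
  also have "\<dots> = fibre_cost f p + (\<integral>\<^sup>+x. ennreal (V x) \<partial>lborel)"
    unfolding cp by (rule nn_integral_add) measurable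
  finally have main: "fibre_cost f ?q + (\<integral>\<^sup>+x. ennreal (- V x) \<partial>lborel) \<le> fibre_cost f p + (\<integral>\<^sup>+x. ennreal (V x) \<partial>lborel)" .
  have Vfin: "(\<integral>\<^sup>+x. ennreal (V x) \<partial>lborel) < \<infinity>" "(\<integral>\<^sup>+x. ennreal (- V x) \<partial>lborel) < \<infinity>"
    using Vint by (auto simp: real_integrable_def less_top)
  have "fibre_cost f p + (\<integral>\<^sup>+x. ennreal (V x) \<partial>lborel) < \<infinity>" using fin Vfin by simp
  with main have s: "fibre_cost f ?q + (\<integral>\<^sup>+x. ennreal (- V x) \<partial>lborel) < \<infinity>" by (rule le_less_trans)
  then show fq: "fibre_cost f ?q < \<infinity>" by simp
  have "enn2real (fibre_cost f ?q + (\<integral>\<^sup>+x. ennreal (- V x) \<partial>lborel)) \<le> enn2real (fibre_cost f p + (\<integral>\<^sup>+x. ennreal (V x) \<partial>lborel))"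
    using main fin Vfin by (intro enn2real_mono) auto
  then have "enn2real (fibre_cost f ?q) \<le> enn2real (fibre_cost f p) + (LBINT x. V x)"
    using fin Vfin fq by (simp add: enn2real_plus real_lebesgue_integral_def[OF Vint])
  also have "(LBINT x. V x) = - 2 * c * (LBINT x. a x * variation ?q B x)"
    unfolding V_def by simp
  finally show "enn2real (fibre_cost f ?q) \<le> enn2real (fibre_cost f p) - 2 * c * (LBINT x. a x * variation ?q B x)"
    by simp
qed

text \<open>Dominated convergence is applied twice, inside each fibre and over the base. The maps
  converge because \<open>H_x f x\<close> takes them to
  \<open>H_x p x t + c n * a x * B t\<close>.\<close>

lemma weighted_variation_tendsto:
  assumes fin: "fibre_cost f p < \<infinity>" and A: "test_pair A a" and B: "test_pair B b"
    and q: "\<And>n. fibre_density f (perturb (c n) a b)" and c: "c \<longlonglongrightarrow> 0"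
  shows "(\<lambda>n. LBINT x. a x * variation (perturb (c n) a b) B x) \<longlonglongrightarrow> (LBINT x. a x * variation p B x)"
proof -
  obtain l u K S where a: "l < u" "K > 0" "finite S" "\<And>x. \<bar>a x\<bar> \<le> K" "\<And>x. \<bar>A x\<bar> \<le> K"
    "\<And>x. x \<notin> {l<..<u} \<Longrightarrow> A x = 0" "\<And>x. x \<notin> {l<..<u} \<Longrightarrow> a x = 0"
    "\<And>x. x \<notin> S \<Longrightarrow> (A has_real_derivative a x) (at x)"
    and [measurable]: "a \<in> borel_measurable borel" "A \<in> borel_measurable borel" and "continuous_on UNIV A"
    by (rule test_pairE[OF A], rule that)
  obtain l' u' K' S' where b: "l' < u'" "K' > 0" "finite S'" "\<And>x. \<bar>b x\<bar> \<le> K'" "\<And>x. \<bar>B x\<bar> \<le> K'"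
    "\<And>x. x \<notin> {l'<..<u'} \<Longrightarrow> B x = 0" "\<And>x. x \<notin> {l'<..<u'} \<Longrightarrow> b x = 0"
    "\<And>x. x \<notin> S' \<Longrightarrow> (B has_real_derivative b x) (at x)"
    and [measurable]: "b \<in> borel_measurable borel" "B \<in> borel_measurable borel" and "continuous_on UNIV B"
    by (rule test_pairE[OF B], rule that)
  have conv: "(\<lambda>n. T (perturb (c n) a b) x t) \<longlonglongrightarrow> T p x t" for x t
  proof (rule strict_mono_tendsto_cancel[OF H_x_mono[OF f_dens, of x]])
    have "(\<lambda>n. H_x p x t + c n * a x * B t) \<longlonglongrightarrow> H_x p x t + 0 * a x * B t"
      by (intro tendsto_intros c)
    then show "(\<lambda>n. H_x f x (T (perturb (c n) a b) x t)) \<longlonglongrightarrow> H_x f x (T p x t)"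
      by (simp add: transport_map_eq[OF q] transport_map_eq[OF p_dens] perturb_section(2)[OF B])
  qed
  have vconv: "(\<lambda>n. variation (perturb (c n) a b) B x) \<longlonglongrightarrow> variation p B x" for x
    unfolding variation_def
  proof (rule integral_dominated_convergence[where
        w = "\<lambda>t. indicator {l'..u'} t *\<^sub>R ((\<bar>l'\<bar> + \<bar>u'\<bar> + \<bar>T p x l'\<bar> + \<bar>T p x u'\<bar>) * K')"])
    show "integrable lborel (\<lambda>t. indicator {l'..u'} t *\<^sub>R ((\<bar>l'\<bar> + \<bar>u'\<bar> + \<bar>T p x l'\<bar> + \<bar>T p x u'\<bar>) * K'))"
      using borel_integrable_atLeastAtMost'[OF continuous_on_const, of l' u'] by (simp only: set_integrable_def)
    show "(\<lambda>t. (t - T (perturb (c n) a b) x t) * B t) \<in> borel_measurable lborel" for n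
      using q[of n] by measurable
    show "(\<lambda>t. (t - T p x t) * B t) \<in> borel_measurable lborel"
      using p_dens by measurable
    show "AE t in lborel. (\<lambda>n. (t - T (perturb (c n) a b) x t) * B t) \<longlonglongrightarrow> (t - T p x t) * B t"
      by (intro AE_I2 tendsto_intros conv)
    show "AE t in lborel. norm ((t - T (perturb (c n) a b) x t) * B t) \<le>
      indicator {l'..u'} t *\<^sub>R ((\<bar>l'\<bar> + \<bar>u'\<bar> + \<bar>T p x l'\<bar> + \<bar>T p x u'\<bar>) * K')" for n
    proof (rule AE_I2)
      fix t
      show "norm ((t - T (perturb (c n) a b) x t) * B t) \<le>
        indicator {l'..u'} t *\<^sub>R ((\<bar>l'\<bar> + \<bar>u'\<bar> + \<bar>T p x l'\<bar> + \<bar>T p x u'\<bar>) * K')"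
        using variation_bound(1)[OF B b(1) b(6) b(5) q[of n], of t x] b(6)[of t]
        by (cases "t \<in> {l'..u'}") auto
    qed
  qed
  show ?thesis
  proof (rule integral_dominated_convergence[OF _ _
        variation_majorant_integrable[OF fin, of l u l' u' "K' * (u' - l') * K"]])
    show "(\<lambda>x. a x * variation (perturb (c n) a b) B x) \<in> borel_measurable lborel" for n
      using q[of n] by measurable
    show "(\<lambda>x. a x * variation p B x) \<in> borel_measurable lborel"
      using p_dens by measurable
    show "AE x in lborel. (\<lambda>n. a x * variation (perturb (c n) a b) B x) \<longlonglongrightarrow> a x * variation p B x"
      by (intro AE_I2 tendsto_intros vconv)
    show "AE x in lborel. norm (a x * variation (perturb (c n) a b) B x) \<le>
       indicat_real {l..u} x * ((\<bar>l'\<bar> + \<bar>u'\<bar> + \<bar>T p x l'\<bar> + \<bar>T p x u'\<bar>) * (K' * (u' - l') * K))" for n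
    proof (rule AE_I2)
      fix x
      let ?M = "\<bar>l'\<bar> + \<bar>u'\<bar> + \<bar>T p x l'\<bar> + \<bar>T p x u'\<bar>"
      show "norm (a x * variation (perturb (c n) a b) B x) \<le> indicat_real {l..u} x * (?M * (K' * (u' - l') * K))"
      proof (cases "x \<in> {l<..<u}")
        case True
        have "\<bar>variation (perturb (c n) a b) B x\<bar> * \<bar>a x\<bar> \<le> ?M * K' * (u' - l') * K"
          using b(2) \<open>l' < u'\<close> a(4) by (intro mult_mono variation_bound(2)[OF B b(1) b(6) b(5) q]) auto
        then show ?thesis using True b(1,2) a(2) by (simp add: abs_mult mult.commute mult.assoc mult.left_commute)
      qed (use a(2,7) b(1,2) in \<open>auto simp: indicator_def\<close>)
    qed
  qed
qed

end

section \<open>Continuity of essentially bounded transport maps\<close>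

lemma AE_lborel_witness:
  fixes a b :: real
  assumes "AE x in lborel. x \<in> {a<..<b} \<longrightarrow> P x" "a < b"
  obtains x where "x \<in> {a<..<b}" "P x"
proof (rule ccontr)
  assume "\<not> thesis"
  then have "AE x in lborel. x \<notin> {a<..<b}"
    using assms(1) that by (auto elim!: eventually_mono)
  then have "emeasure lborel {a<..<b} = 0"
    by (subst (asm) AE_iff_measurable[of "{a<..<b}"]) auto
  then show False using \<open>a < b\<close> by simp
qed

lemma AE_eq_continuous_imp_eq:
  fixes g h :: "real \<Rightarrow> real"
  assumes ae: "AE x in lborel. g x = h x" and g: "continuous_on UNIV g" and h: "continuous_on UNIV h"
  shows "g x = h x"
proof (rule ccontr)
  assume ne: "g x \<noteq> h x"
  have "open {x. g x \<noteq> h x}" using g h by (intro open_Collect_neq)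
  then obtain e where e: "e > 0" "\<And>y. dist y x < e \<Longrightarrow> g y \<noteq> h y"
    using ne by (auto simp: open_dist)
  have "AE y in lborel. y \<in> {x - e<..<x + e} \<longrightarrow> g y = h y" using ae by (auto elim!: eventually_mono)
  then obtain y where "y \<in> {x - e<..<x + e}" "g y = h y"
    by (rule AE_lborel_witness) (use e in auto)
  then have "dist y x < e" by (simp add: dist_real_def abs_less_iff)
  with e(2) \<open>g y = h y\<close> show False by blast
qed

lemma continuous_eventually_pos:
  fixes g :: "real \<Rightarrow> real"
  assumes "continuous_on UNIV g" "0 < g x0"
  shows "eventually (\<lambda>x. 0 < g x) (nhds x0)"
proof -
  have "open {x. 0 < g x}" using assms(1) by (intro open_Collect_less) auto
  from eventually_nhds_in_open[OF this, of x0] show ?thesis using assms(2) by simp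
qed

text \<open>Over a compact range of \<open>t\<close> no mass can escape. This is the source of
  continuity in \<open>x\<close> for increments of distribution functions.\<close>

lemma fibre_integral_continuous:
  fixes k :: "real \<times> real \<Rightarrow> real"
  assumes "continuous_on UNIV k"
  shows "continuous_on UNIV (\<lambda>x. integral {a..b} (\<lambda>t. k (x, t)))"
  using integral_continuous_on_param[of UNIV a b "\<lambda>x t. k (x, t)"] assms
  by (simp add: case_prod_unfold continuous_on_subset)

lemma tent_test_pair:
  fixes a :: real
  obtains B b where "test_pair B b" "\<And>x. B x \<ge> 0" "\<And>x. x \<notin> {a<..<a + 2} \<Longrightarrow> B x = 0"
    "integrable lborel B" "(LBINT x. B x) > 0"
proof -
  define B where "B = (\<lambda>x. max 0 (min 1 (x - a)) - max 0 (min 1 (x - (a + 1))))"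
  \<comment> \<open>The reference ramps on the unit interval cancel in the difference of the two
    pairs, leaving a tent of width 2.\<close>
  have "\<exists>b. test_pair B b"
    using test_pair_minus[OF test_pair_ramp[of a "a + 1"] test_pair_ramp[of "a + 1" "a + 2"]]
    unfolding B_def by (auto simp: algebra_simps)
  then obtain b where b: "test_pair B b" by blast
  have B: "B x \<ge> 0" "\<bar>B x\<bar> \<le> 1" for x by (auto simp: B_def)
  have B0: "B x = 0" if "x \<notin> {a<..<a + 2}" for x using that by (auto simp: B_def)
  have [measurable]: "B \<in> borel_measurable borel" unfolding B_def by measurable
  have int: "integrable lborel B"
    by (rule bounded_support_integral(1)[of _ a "a + 2" 1]) (use B B0 in auto)
  have int2: "integrable lborel (\<lambda>x. 1 / 2 * indicator {a + 1/2..a + 3/2} x :: real)" by auto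
  have "(1/2 :: real) = (LBINT x. 1 / 2 * indicator {a + 1/2..a + 3/2} x)"
    by simp
  also have "\<dots> \<le> (LBINT x. B x)"
    by (rule integral_mono[OF int2 int]) (auto simp: B_def indicator_def min_def max_def)
  finally have "(LBINT x. B x) > 0" by simp
  with b B B0 int show ?thesis by (intro that) auto
qed

context fibre_transport
begin

lemma H_x_p_diff: "s \<le> t \<Longrightarrow> H_x p x t - H_x p x s = integral {s..t} (\<lambda>v. p (x, v))"
  and H_x_f_diff: "s \<le> t \<Longrightarrow> H_x f x t - H_x f x s = integral {s..t} (\<lambda>v. f (x, v))"
  unfolding H_x_def using fibre_densityD(3)[OF p_dens] f_section_integrable p_section_cont f_section_cont
  by (auto intro!: cdf_diff)

text \<open>If the map jumped upwards at \<open>x0\<close>, more mass of \<open>p\<close> would have to be placed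
  above \<open>\<sigma>\<close> than \<open>f\<close> has there, and the excess would be sent to infinity.\<close>

lemma transport_map_escape_up:
  assumes \<sigma>: "T p x0 t < \<sigma>"
  obtains t0 where "\<And>M. eventually (\<lambda>x. \<sigma> \<le> T p x t \<longrightarrow> M < T p x t0) (nhds x0)"
proof -
  \<comment> \<open>Over \<open>x0\<close>, the mass of \<open>p\<close> above \<open>t\<close>
    equals that of \<open>f\<close> above \<open>T p x0 t\<close>, which exceeds that of
    \<open>f\<close> above \<open>\<sigma>\<close>. A bounded piece \<open>[t, t0]\<close> already
    carries more than the latter.\<close>
  have "((\<lambda>s. H_x p x0 s - H_x p x0 t) \<longlongrightarrow> marg1 f x0 - H_x p x0 t) at_top"
    using cdf_tendsto(2)[OF fibre_densityD(3)[OF p_dens], of x0] fibre_densityD(4)[OF p_dens, of x0]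
    by (intro tendsto_intros) (simp add: H_x_def)
  moreover have "marg1 f x0 - H_x f x0 \<sigma> < marg1 f x0 - H_x p x0 t"
    using strict_monoD[OF H_x_mono[OF f_dens] \<sigma>, of x0] transport_map_eq[OF p_dens, of x0 t] by simp
  ultimately have "eventually (\<lambda>s. marg1 f x0 - H_x f x0 \<sigma> < H_x p x0 s - H_x p x0 t) at_top"
    by (rule order_tendstoD)
  with eventually_ge_at_top[of t] have "eventually (\<lambda>s. t \<le> s \<and> marg1 f x0 - H_x f x0 \<sigma> < H_x p x0 s - H_x p x0 t) at_top"
    by eventually_elim auto
  then obtain t0 where t0: "t \<le> t0" "marg1 f x0 - H_x f x0 \<sigma> < H_x p x0 t0 - H_x p x0 t"
    using eventually_happens'[OF trivial_limit_at_top_linorder] by blast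
  show ?thesis
  proof (rule that[of t0])
    fix M0
    \<comment> \<open>\<open>t0\<close> is fixed before \<open>M0\<close>. For finite
      \<open>M\<close> the strict comparison of \<open>p\<close> on \<open>[t, t0]\<close> with
      \<open>f\<close> on \<open>[\<sigma>, M]\<close> concerns compact ranges, so it persists for
      \<open>x\<close> near \<open>x0\<close> and leaves no room below \<open>M\<close>.\<close>
    define M where "M = max M0 \<sigma>"
    have c: "continuous_on UNIV (\<lambda>x. integral {t..t0} (\<lambda>v. p (x, v)) - integral {\<sigma>..M} (\<lambda>v. f (x, v)))"
      by (intro continuous_on_diff fibre_integral_continuous p_cont f_cont)
    have "H_x f x0 M < marg1 f x0" by (rule H_x_bounds[OF f_dens])
    then have "0 < integral {t..t0} (\<lambda>v. p (x0, v)) - integral {\<sigma>..M} (\<lambda>v. f (x0, v))"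
      using t0 H_x_p_diff[OF t0(1), of x0] H_x_f_diff[of \<sigma> M x0] by (simp add: M_def)
    with c have "eventually (\<lambda>x. 0 < integral {t..t0} (\<lambda>v. p (x, v)) - integral {\<sigma>..M} (\<lambda>v. f (x, v))) (nhds x0)"
      by (rule continuous_eventually_pos)
    then show "eventually (\<lambda>x. \<sigma> \<le> T p x t \<longrightarrow> M0 < T p x t0) (nhds x0)"
    proof eventually_elim
      case (elim x)
      show ?case
      proof (intro impI, rule ccontr)
        assume a: "\<sigma> \<le> T p x t" "\<not> M0 < T p x t0"
        then have b: "T p x t0 \<le> M" by (simp add: M_def)
        have "H_x f x (T p x t0) - H_x f x (T p x t) \<le> H_x f x M - H_x f x \<sigma>"
          using strict_mono_leD[OF H_x_mono[OF f_dens] a(1), of x] strict_mono_leD[OF H_x_mono[OF f_dens] b, of x]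
          by simp
        then show False
          using elim H_x_p_diff[OF t0(1), of x] H_x_f_diff[of \<sigma> M x]
          by (simp add: transport_map_eq[OF p_dens] M_def)
      qed
    qed
  qed
qed

text \<open>Mirror image: over \<open>x0\<close>, some bounded piece \<open>[t0, t]\<close> carries
  more mass of \<open>p\<close> than \<open>f\<close> has below \<open>\<sigma>\<close>, so for
  nearby \<open>x\<close> a value at most \<open>\<sigma>\<close> at \<open>t\<close> drives the
  value at \<open>t0\<close> to minus infinity.\<close>

lemma transport_map_escape_down:
  assumes \<sigma>: "\<sigma> < T p x0 t"
  obtains t0 where "\<And>M. eventually (\<lambda>x. T p x t \<le> \<sigma> \<longrightarrow> T p x t0 < M) (nhds x0)"
proof -
  have "((\<lambda>s. H_x p x0 t - H_x p x0 s) \<longlongrightarrow> H_x p x0 t - 0) at_bot"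
    using cdf_tendsto(1)[OF fibre_densityD(3)[OF p_dens], of x0]
    by (intro tendsto_intros) (simp add: H_x_def)
  moreover have "H_x f x0 \<sigma> < H_x p x0 t - 0"
    using strict_monoD[OF H_x_mono[OF f_dens] \<sigma>, of x0] transport_map_eq[OF p_dens, of x0 t] by simp
  ultimately have "eventually (\<lambda>s. H_x f x0 \<sigma> < H_x p x0 t - H_x p x0 s) at_bot"
    by (rule order_tendstoD)
  with eventually_le_at_bot[of t] have "eventually (\<lambda>s. s \<le> t \<and> H_x f x0 \<sigma> < H_x p x0 t - H_x p x0 s) at_bot"
    by eventually_elim auto
  then obtain t0 where t0: "t0 \<le> t" "H_x f x0 \<sigma> < H_x p x0 t - H_x p x0 t0"
    using eventually_happens'[OF trivial_limit_at_bot_linorder] by blast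
  show ?thesis
  proof (rule that[of t0])
    fix M0
    define M where "M = min M0 \<sigma>"
    have c: "continuous_on UNIV (\<lambda>x. integral {t0..t} (\<lambda>v. p (x, v)) - integral {M..\<sigma>} (\<lambda>v. f (x, v)))"
      by (intro continuous_on_diff fibre_integral_continuous p_cont f_cont)
    have "0 < H_x f x0 M" by (rule H_x_bounds[OF f_dens])
    then have "0 < integral {t0..t} (\<lambda>v. p (x0, v)) - integral {M..\<sigma>} (\<lambda>v. f (x0, v))"
      using t0 H_x_p_diff[OF t0(1), of x0] H_x_f_diff[of M \<sigma> x0] by (simp add: M_def)
    with c have "eventually (\<lambda>x. 0 < integral {t0..t} (\<lambda>v. p (x, v)) - integral {M..\<sigma>} (\<lambda>v. f (x, v))) (nhds x0)"
      by (rule continuous_eventually_pos)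
    then show "eventually (\<lambda>x. T p x t \<le> \<sigma> \<longrightarrow> T p x t0 < M0) (nhds x0)"
    proof eventually_elim
      case (elim x)
      show ?case
      proof (intro impI, rule ccontr)
        assume a: "T p x t \<le> \<sigma>" "\<not> T p x t0 < M0"
        then have b: "M \<le> T p x t0" by (simp add: M_def)
        have "H_x f x (T p x t) - H_x f x (T p x t0) \<le> H_x f x \<sigma> - H_x f x M"
          using strict_mono_leD[OF H_x_mono[OF f_dens] a(1), of x] strict_mono_leD[OF H_x_mono[OF f_dens] b, of x]
          by simp
        then show False
          using elim H_x_p_diff[OF t0(1), of x] H_x_f_diff[of M \<sigma> x]
          by (simp add: transport_map_eq[OF p_dens] M_def)
      qed
    qed
  qed
qed

text \<open>Near \<open>x0\<close>, a deviation of \<open>e\<close> or more at level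
  \<open>t\<close> would break the essential bound at level \<open>t1\<close> or \<open>t2\<close>,
  so it occurs on a null set only. This holds around every centre; hence \<open>x0\<close> and a
  nearby \<open>x1\<close> share a witness \<open>x\<close> whose value is close to both of
  theirs.\<close>

lemma transport_map_cont_fst:
  assumes bdd: "\<And>t l u. \<exists>K. AE x in lborel. x \<in> {l..u} \<longrightarrow> \<bar>T p x t\<bar> \<le> K"
  shows "isCont (\<lambda>x. T p x t) x0"
proof -
  have near: "\<exists>d>0. AE x in lborel. \<bar>x - x0\<bar> < d \<longrightarrow> \<bar>T p x t - T p x0 t\<bar> < e" if "e > 0" for e x0
  proof -
    obtain t1 where t1: "\<And>M. eventually (\<lambda>x. T p x0 t + e \<le> T p x t \<longrightarrow> M < T p x t1) (nhds x0)"
      using transport_map_escape_up[of x0 t "T p x0 t + e"] \<open>e > 0\<close> by auto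
    obtain t2 where t2: "\<And>M. eventually (\<lambda>x. T p x t \<le> T p x0 t - e \<longrightarrow> T p x t2 < M) (nhds x0)"
      using transport_map_escape_down[of "T p x0 t - e" x0 t] \<open>e > 0\<close> by auto
    obtain K1 where K1: "AE x in lborel. x \<in> {x0 - 1..x0 + 1} \<longrightarrow> \<bar>T p x t1\<bar> \<le> K1" using bdd by blast
    obtain K2 where K2: "AE x in lborel. x \<in> {x0 - 1..x0 + 1} \<longrightarrow> \<bar>T p x t2\<bar> \<le> K2" using bdd by blast
    have "eventually (\<lambda>x. (T p x0 t + e \<le> T p x t \<longrightarrow> K1 < T p x t1) \<and> (T p x t \<le> T p x0 t - e \<longrightarrow> T p x t2 < - K2)) (nhds x0)"
      using t1 t2 by (rule eventually_conj)
    then obtain d where d: "d > 0" "\<And>x. dist x x0 < d \<Longrightarrow>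
        (T p x0 t + e \<le> T p x t \<longrightarrow> K1 < T p x t1) \<and> (T p x t \<le> T p x0 t - e \<longrightarrow> T p x t2 < - K2)"
      by (auto simp: eventually_nhds_metric)
    have "AE x in lborel. \<bar>x - x0\<bar> < min d 1 \<longrightarrow> \<bar>T p x t - T p x0 t\<bar> < e"
      using K1 K2
    proof eventually_elim
      case (elim x)
      show ?case
      proof
        assume x: "\<bar>x - x0\<bar> < min d 1"
        then have "\<bar>T p x t1\<bar> \<le> K1" "\<bar>T p x t2\<bar> \<le> K2" using elim by auto
        with d(2)[of x] x show "\<bar>T p x t - T p x0 t\<bar> < e" by (auto simp: dist_real_def)
      qed
    qed
    then show ?thesis using d(1) by (intro exI[of _ "min d 1"]) auto
  qed
  show ?thesis
    unfolding continuous_at_eps_delta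
  proof (intro allI impI)
    fix e :: real assume "e > 0"
    then obtain d where d: "d > 0" "AE x in lborel. \<bar>x - x0\<bar> < d \<longrightarrow> \<bar>T p x t - T p x0 t\<bar> < e / 2"
      using near[of "e/2" x0] by auto
    show "\<exists>d>0. \<forall>x'. dist x' x0 < d \<longrightarrow> dist (T p x' t) (T p x0 t) < e"
    proof (intro exI[of _ d] conjI allI impI)
      fix x1 assume x1: "dist x1 x0 < d"
      obtain d1 where d1: "d1 > 0" "AE x in lborel. \<bar>x - x1\<bar> < d1 \<longrightarrow> \<bar>T p x t - T p x1 t\<bar> < e / 2"
        using near[of "e/2" x1] \<open>e > 0\<close> by auto
      define r where "r = min d1 (d - dist x1 x0)"
      have r: "r > 0" using d1 x1 by (simp add: r_def)
      have "AE x in lborel. x \<in> {x1 - r<..<x1 + r} \<longrightarrow> \<bar>T p x t - T p x0 t\<bar> < e / 2 \<and> \<bar>T p x t - T p x1 t\<bar> < e / 2"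
        using d(2) d1(2)
      proof eventually_elim
        case (elim x)
        show ?case
        proof
          assume "x \<in> {x1 - r<..<x1 + r}"
          then have "\<bar>x - x1\<bar> < d1" "\<bar>x - x0\<bar> < d" by (auto simp: r_def dist_real_def)
          with elim show "\<bar>T p x t - T p x0 t\<bar> < e / 2 \<and> \<bar>T p x t - T p x1 t\<bar> < e / 2" by auto
        qed
      qed
      then obtain x where "\<bar>T p x t - T p x0 t\<bar> < e / 2" "\<bar>T p x t - T p x1 t\<bar> < e / 2"
        by (rule AE_lborel_witness) (use r in auto)
      then show "dist (T p x1 t) (T p x0 t) < e" unfolding dist_real_def by linarith
    qed (use d in auto)
  qed
qed

text \<open>Monotonicity in the second variable makes separate continuity joint: a strict inequality
  that still holds at a slightly shifted level \<open>s\<close> controls all levels on the other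
  side of \<open>s\<close>.\<close>

lemma transport_map_cont_joint:
  assumes "\<And>x t. isCont (\<lambda>x. T p x t) x"
  shows "continuous_on UNIV (\<lambda>z. T p (fst z) (snd z))"
  unfolding continuous_on_def
proof
  fix z :: "real \<times> real"
  have fst: "(fst \<longlongrightarrow> fst z) (at z within UNIV)" and snd: "(snd \<longlongrightarrow> snd z) (at z within UNIV)"
    by (auto intro!: tendsto_intros)
  have first: "((\<lambda>w. T p (fst w) s) \<longlongrightarrow> T p (fst z) s) (at z within UNIV)" for s
    using isCont_tendsto_compose[OF assms fst] by simp
  have tT: "(T p (fst z) \<longlongrightarrow> T p (fst z) (snd z)) (at (snd z))"
    using transport_map_cont[of "fst z"] by (simp add: continuous_on_def)
  show "((\<lambda>w. T p (fst w) (snd w)) \<longlongrightarrow> T p (fst z) (snd z)) (at z within UNIV)"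
  proof (rule order_tendstoI)
    fix a assume "a < T p (fst z) (snd z)"
    then have "eventually (\<lambda>s. a < T p (fst z) s) (at_left (snd z))"
      using order_tendstoD(1)[OF tT] by (simp add: eventually_at_split)
    with eventually_at_left_real[of "snd z - 1" "snd z"]
    have "eventually (\<lambda>s. s < snd z \<and> a < T p (fst z) s) (at_left (snd z))"
      by (auto elim: eventually_elim2)
    then obtain s where s: "s < snd z" "a < T p (fst z) s"
      using eventually_happens'[OF trivial_limit_at_left_real] by blast
    from order_tendstoD(1)[OF first s(2)] order_tendstoD(1)[OF snd s(1)]
    show "eventually (\<lambda>w. a < T p (fst w) (snd w)) (at z within UNIV)"
      by eventually_elim (meson transport_map_le[OF p_dens] less_imp_le less_le_trans)
  next
    fix a assume "T p (fst z) (snd z) < a"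
    then have "eventually (\<lambda>s. T p (fst z) s < a) (at_right (snd z))"
      using order_tendstoD(2)[OF tT] by (simp add: eventually_at_split)
    with eventually_at_right_real[of "snd z" "snd z + 1"]
    have "eventually (\<lambda>s. snd z < s \<and> T p (fst z) s < a) (at_right (snd z))"
      by (auto elim: eventually_elim2)
    then obtain s where s: "snd z < s" "T p (fst z) s < a"
      using eventually_happens'[OF trivial_limit_at_right_real] by blast
    from order_tendstoD(2)[OF first s(2)] order_tendstoD(2)[OF snd s(1)]
    show "eventually (\<lambda>w. T p (fst w) (snd w) < a) (at z within UNIV)"
      by eventually_elim (meson transport_map_le[OF p_dens] less_imp_le le_less_trans)
  qed
qed

end

section \<open>The weak Euler-Lagrange equation\<close>

context fibre_transport
begin

definition fibre_average :: "(real \<Rightarrow> real) \<Rightarrow> real \<Rightarrow> real" where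
  "fibre_average B x = (LBINT t. T p x t * B t)"

text \<open>The average runs over the base point at a fixed level \<open>s\<close>. In the exchanged
  problem \<open>s\<close> is the first coordinate, and the function turns out to be the derivative
  of the \<open>fibre_average\<close> of the original problem.\<close>

definition cross_average :: "(real \<Rightarrow> real) \<Rightarrow> real \<Rightarrow> real" where
  "cross_average b s = (LBINT y. T p y s * b y)"

lemma fibre_average_measurable [measurable]:
  assumes [measurable]: "B \<in> borel_measurable borel"
  shows "fibre_average B \<in> borel_measurable borel"
  unfolding fibre_average_def using p_dens by measurable

lemma transport_map_weighted_bound:
  assumes K: "\<And>t. \<bar>B t\<bar> \<le> K" and t: "t \<in> {l..u}"
  shows "\<bar>T p x t * B t\<bar> \<le> (\<bar>T p x l\<bar> + \<bar>T p x u\<bar>) * K"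
proof -
  have "T p x l \<le> T p x t" "T p x t \<le> T p x u"
    using t transport_map_le[OF p_dens] by auto
  then have "\<bar>T p x t\<bar> \<le> \<bar>T p x l\<bar> + \<bar>T p x u\<bar>" by linarith
  then show ?thesis
    unfolding abs_mult using K[of t] by (intro mult_mono) auto
qed

lemma fibre_average_integrable:
  assumes [measurable]: "B \<in> borel_measurable borel" and K: "\<And>t. \<bar>B t\<bar> \<le> K" and supp: "\<And>t. t \<notin> {l..u} \<Longrightarrow> B t = 0"
  shows "integrable lborel (\<lambda>t. T p x t * B t)"
    "((\<lambda>t. T p x t * B t) has_integral fibre_average B x) {l..u}"
proof -
  have m: "(\<lambda>t. T p x t * B t) \<in> borel_measurable borel" using p_dens by measurable
  have s: "T p x t * B t = 0" if "t \<notin> {l..u}" for t using supp[OF that] by simp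
  have bd: "\<bar>T p x t * B t\<bar> \<le> (\<bar>T p x l\<bar> + \<bar>T p x u\<bar>) * K" if "t \<in> {l..u}" for t
    by (rule transport_map_weighted_bound[OF K that])
  note i = bounded_support_integral[OF m bd s]
  show "integrable lborel (\<lambda>t. T p x t * B t)" by (rule i(1))
  show "((\<lambda>t. T p x t * B t) has_integral fibre_average B x) {l..u}"
    unfolding fibre_average_def by (rule i(2))
qed

lemma fibre_average_locally_integrable:
  assumes fin: "fibre_cost f p < \<infinity>" and B: "test_pair B b"
  shows "set_integrable lborel {l'..u'} (fibre_average B)"
proof -
  obtain l u K S where b: "l < u" "K > 0" "finite S" "\<And>x. \<bar>b x\<bar> \<le> K" "\<And>x. \<bar>B x\<bar> \<le> K"
    "\<And>x. x \<notin> {l<..<u} \<Longrightarrow> B x = 0" "\<And>x. x \<notin> {l<..<u} \<Longrightarrow> b x = 0"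
    "\<And>x. x \<notin> S \<Longrightarrow> (B has_real_derivative b x) (at x)"
    and [measurable]: "b \<in> borel_measurable borel" "B \<in> borel_measurable borel" and "continuous_on UNIV B"
    by (rule test_pairE[OF B], rule that)
  have bound: "\<bar>fibre_average B x\<bar> \<le> (\<bar>T p x l\<bar> + \<bar>T p x u\<bar>) * K * (u - l)" for x
    unfolding fibre_average_def using b(1) b(6) p_dens
    by (intro integral_abs_bound_Icc transport_map_weighted_bound b(5)) auto
  have "set_integrable lborel {l'..u'} (\<lambda>x. (\<bar>T p x l\<bar> + \<bar>T p x u\<bar>) * K * (u - l))"
    by (intro set_integrable_mult_left set_integral_add set_integrable_abs transport_map_locally_integrable[OF fin])
  then show ?thesis
    unfolding set_integrable_def
  proof (rule Bochner_Integration.integrable_bound)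
    show "AE x in lborel. norm (indicat_real {l'..u'} x *\<^sub>R fibre_average B x)
           \<le> norm (indicat_real {l'..u'} x *\<^sub>R ((\<bar>T p x l\<bar> + \<bar>T p x u\<bar>) * K * (u - l)))"
      using order_trans[OF bound abs_ge_self] by (intro AE_I2) (auto simp: indicator_def)
  qed measurable
qed

text \<open>Each map is continuous and increasing in \<open>s\<close>, so on a window of radius 1
  about \<open>s0\<close> it is dominated by its values at the two ends, which are locally
  integrable in \<open>y\<close>. No continuity in the base point enters, which is what starts the
  regularity argument.\<close>

lemma cross_average_cont:
  assumes fin: "fibre_cost f p < \<infinity>" and [measurable]: "b \<in> borel_measurable borel"
    and K: "\<And>y. \<bar>b y\<bar> \<le> K" and supp: "\<And>y. y \<notin> {l..u} \<Longrightarrow> b y = 0"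
  shows "continuous_on UNIV (cross_average b)"
proof -
  have c: "continuous_on {s0 - 1..s0 + 1} (cross_average b)" for s0
  proof (rule continuous_on_sequentiallyI)
    fix v :: "nat \<Rightarrow> real" and s
    assume v: "\<forall>n. v n \<in> {s0 - 1..s0 + 1}" "s \<in> {s0 - 1..s0 + 1}" "v \<longlonglongrightarrow> s"
    let ?w = "\<lambda>y. indicator {l..u} y *\<^sub>R ((\<bar>T p y (s0 - 1)\<bar> + \<bar>T p y (s0 + 1)\<bar>) * K)"
    show "(\<lambda>n. cross_average b (v n)) \<longlonglongrightarrow> cross_average b s"
      unfolding cross_average_def
    proof (rule integral_dominated_convergence[where w = ?w])
      have "set_integrable lborel {l..u} (\<lambda>y. (\<bar>T p y (s0 - 1)\<bar> + \<bar>T p y (s0 + 1)\<bar>) * K)"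
        by (intro set_integrable_mult_left set_integral_add set_integrable_abs transport_map_locally_integrable[OF fin])
      then show "integrable lborel ?w" by (simp add: set_integrable_def)
      have iC: "isCont (T p y) s" for y
        using transport_map_cont by (simp add: continuous_on_eq_continuous_at)
      show "AE y in lborel. (\<lambda>n. T p y (v n) * b y) \<longlonglongrightarrow> T p y s * b y"
        by (intro AE_I2 tendsto_mult tendsto_const) (rule isCont_tendsto_compose[OF iC v(3)])
      show "AE y in lborel. norm (T p y (v n) * b y) \<le> ?w y" for n
      proof (rule AE_I2)
        fix y
        show "norm (T p y (v n) * b y) \<le> ?w y"
        proof (cases "y \<in> {l..u}")
          case True
          have "\<bar>T p y (v n) * b y\<bar> \<le> (\<bar>T p y (s0 - 1)\<bar> + \<bar>T p y (s0 + 1)\<bar>) * K"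
            using transport_map_weighted_bound[of "\<lambda>_. b y" K "v n" "s0 - 1" "s0 + 1" y] K[of y] v(1) by auto
          then show ?thesis using True by simp
        qed (use supp in simp)
      qed
      show "(\<lambda>y. T p y s * b y) \<in> borel_measurable lborel" using p_dens by measurable
      show "(\<lambda>y. T p y (v n) * b y) \<in> borel_measurable lborel" for n using p_dens by measurable
    qed
  qed
  have "isCont (cross_average b) s0" for s0
    using continuous_on_interior[OF c, of s0 s0] by simp
  then show ?thesis by (simp add: continuous_at_imp_continuous_on)
qed

text \<open>Fubini, with absolute integrability coming from monotonicity: on the support of
  \<open>A\<close> the map is bounded by its values at the two end levels.\<close>

lemma average_swap:
  assumes fin: "fibre_cost f p < \<infinity>" and A: "test_pair A a" and B: "test_pair B b"
  shows "(LBINT y. b y * fibre_average A y) = (LBINT s. cross_average b s * A s)"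
proof -
  obtain l u K S where a: "l < u" "K > 0" "finite S" "\<And>x. \<bar>a x\<bar> \<le> K" "\<And>x. \<bar>A x\<bar> \<le> K"
    "\<And>x. x \<notin> {l<..<u} \<Longrightarrow> A x = 0" "\<And>x. x \<notin> {l<..<u} \<Longrightarrow> a x = 0"
    "\<And>x. x \<notin> S \<Longrightarrow> (A has_real_derivative a x) (at x)"
    and [measurable]: "a \<in> borel_measurable borel" "A \<in> borel_measurable borel" and "continuous_on UNIV A"
    by (rule test_pairE[OF A], rule that)
  obtain l' u' K' S' where b: "l' < u'" "K' > 0" "finite S'" "\<And>x. \<bar>b x\<bar> \<le> K'" "\<And>x. \<bar>B x\<bar> \<le> K'"
    "\<And>x. x \<notin> {l'<..<u'} \<Longrightarrow> B x = 0" "\<And>x. x \<notin> {l'<..<u'} \<Longrightarrow> b x = 0"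
    "\<And>x. x \<notin> S' \<Longrightarrow> (B has_real_derivative b x) (at x)"
    and [measurable]: "b \<in> borel_measurable borel" "B \<in> borel_measurable borel" and "continuous_on UNIV B"
    by (rule test_pairE[OF B], rule that)
  let ?F = "\<lambda>y s. b y * (T p y s * A s)"
  have Fm: "case_prod ?F \<in> borel_measurable (lborel \<Otimes>\<^sub>M lborel)"
    using p_dens by measurable
  have "integrable (lborel \<Otimes>\<^sub>M lborel) (case_prod ?F)"
  proof (rule lborel_pair.Fubini_integrable[OF Fm])
    have "integrable lborel (\<lambda>s. T p y s * A s)" for y
      by (rule fibre_average_integrable(1)[of A K l u]) (use a(5,6) in auto)
    then show "AE y in lborel. integrable lborel (\<lambda>s. case (y, s) of (y, s) \<Rightarrow> ?F y s)"
      by simp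
    have bound: "\<bar>LBINT s. norm (?F y s)\<bar> \<le> \<bar>b y\<bar> * ((\<bar>T p y l\<bar> + \<bar>T p y u\<bar>) * K) * (u - l)" for y
    proof (rule integral_abs_bound_Icc)
      show "(\<lambda>s. norm (?F y s)) \<in> borel_measurable borel" using p_dens by measurable
      show "\<bar>norm (?F y s)\<bar> \<le> \<bar>b y\<bar> * ((\<bar>T p y l\<bar> + \<bar>T p y u\<bar>) * K)" if "s \<in> {l..u}" for s
        using mult_left_mono[OF transport_map_weighted_bound[OF a(5) that, of y], of "\<bar>b y\<bar>"]
        by (simp add: abs_mult mult.assoc)
    qed (use a in auto)
    have "set_integrable lborel {l'..u'} (\<lambda>y. (\<bar>T p y l\<bar> + \<bar>T p y u\<bar>) * (K' * K * (u - l)))"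
      by (intro set_integrable_mult_left set_integral_add set_integrable_abs transport_map_locally_integrable[OF fin])
    then show "integrable lborel (\<lambda>y. LBINT s. norm (case (y, s) of (y, s) \<Rightarrow> ?F y s))"
      unfolding set_integrable_def
    proof (rule Bochner_Integration.integrable_bound)
      show "(\<lambda>y. LBINT s. norm (case (y, s) of (y, s) \<Rightarrow> ?F y s)) \<in> borel_measurable lborel"
        using p_dens by measurable
      show "AE y in lborel. norm (LBINT s. norm (case (y, s) of (y, s) \<Rightarrow> ?F y s)) \<le>
        norm (indicat_real {l'..u'} y *\<^sub>R ((\<bar>T p y l\<bar> + \<bar>T p y u\<bar>) * (K' * K * (u - l))))"
      proof (rule AE_I2)
        fix y
        show "norm (LBINT s. norm (case (y, s) of (y, s) \<Rightarrow> ?F y s)) \<le>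
          norm (indicat_real {l'..u'} y *\<^sub>R ((\<bar>T p y l\<bar> + \<bar>T p y u\<bar>) * (K' * K * (u - l))))"
        proof (cases "y \<in> {l'..u'}")
          case True
          have "\<bar>b y\<bar> * ((\<bar>T p y l\<bar> + \<bar>T p y u\<bar>) * K) * (u - l) \<le> K' * ((\<bar>T p y l\<bar> + \<bar>T p y u\<bar>) * K) * (u - l)"
            using a(1,2) b(4) by (intro mult_right_mono) auto
          with bound[of y] have "\<bar>LBINT s. norm (?F y s)\<bar> \<le> K' * ((\<bar>T p y l\<bar> + \<bar>T p y u\<bar>) * K) * (u - l)"
            by (rule order_trans)
          also have "\<dots> = norm (indicat_real {l'..u'} y *\<^sub>R ((\<bar>T p y l\<bar> + \<bar>T p y u\<bar>) * (K' * K * (u - l))))"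
            using True a(1,2) b(2) by (simp add: abs_mult)
          finally show ?thesis by simp
        next
          case False
          then have "b y = 0" using b(7)[of y] by auto
          then show ?thesis by simp
        qed
      qed
    qed
  qed
  from lborel_pair.Fubini_integral[OF this]
  have "(LBINT s. LBINT y. ?F y s) = (LBINT y. LBINT s. ?F y s)" .
  moreover have "(LBINT y. ?F y s) = cross_average b s * A s" for s
  proof -
    have "(\<lambda>y. ?F y s) = (\<lambda>y. (T p y s * b y) * A s)" by auto
    then show ?thesis by (simp add: cross_average_def)
  qed
  ultimately show ?thesis by (simp add: fibre_average_def)
qed

text \<open>The part \<open>t\<close> of \<open>t - T p x t\<close> contributes the constant
  \<open>k\<close> times the integral of \<open>a\<close>, which is zero.\<close>

lemma weighted_variation_eq:
  assumes fin: "fibre_cost f p < \<infinity>" and A: "test_pair A a" and B: "test_pair B b"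
  shows "(LBINT x. a x * variation p B x) = - (LBINT x. fibre_average B x * a x)"
proof -
  obtain l u K S where b: "l < u" "K > 0" "finite S" "\<And>x. \<bar>b x\<bar> \<le> K" "\<And>x. \<bar>B x\<bar> \<le> K"
    "\<And>x. x \<notin> {l<..<u} \<Longrightarrow> B x = 0" "\<And>x. x \<notin> {l<..<u} \<Longrightarrow> b x = 0"
    "\<And>x. x \<notin> S \<Longrightarrow> (B has_real_derivative b x) (at x)"
    and [measurable]: "b \<in> borel_measurable borel" "B \<in> borel_measurable borel" and "continuous_on UNIV B"
    by (rule test_pairE[OF B], rule that)
  have i1: "integrable lborel (\<lambda>t. t * B t)"
  proof (rule bounded_support_integral(1)[of _ l u "(\<bar>l\<bar> + \<bar>u\<bar>) * K"])
    show "\<bar>t * B t\<bar> \<le> (\<bar>l\<bar> + \<bar>u\<bar>) * K" if "t \<in> {l..u}" for t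
      unfolding abs_mult using that b(5)[of t] by (intro mult_mono) auto
  qed (use b(6) in auto)
  have i2: "integrable lborel (\<lambda>t. T p x t * B t)" for x
    by (rule fibre_average_integrable(1)[of B K l u]) (use b(5,6) in auto)
  define k where "k = (LBINT t. t * B t)"
  have v: "variation p B x = k - fibre_average B x" for x
    unfolding variation_def fibre_average_def k_def left_diff_distrib using i1 i2 by simp
  \<comment> \<open>The zero perturbation makes the integrability result for perturbed densities
    available for \<open>p\<close>.\<close>
  have "perturb 0 a b = p" by (auto simp: perturb_def)
  then have i3: "integrable lborel (\<lambda>x. a x * variation p B x)"
    using weighted_variation_integrable[OF fin A B, of 0] p_dens by simp
  note ai = test_pair_integral[OF A]
  have "fibre_average B x * a x = k * a x - a x * variation p B x" for x
    by (simp add: v algebra_simps)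
  then have "(LBINT x. fibre_average B x * a x) = (LBINT x. k * a x - a x * variation p B x)" by simp
  also have "\<dots> = k * (LBINT x. a x) - (LBINT x. a x * variation p B x)"
    using ai(1) i3 by simp
  finally show ?thesis using ai(3) by simp
qed

end

text \<open>The two fibre problems are linked through \<open>stationary\<close> alone. That relation
  is symmetric, so every consequence also holds with the roles exchanged.\<close>

locale coupled_transport = X: fibre_transport f p + Y: fibre_transport g r for f p g r +
  assumes finX: "fibre_cost f p < \<infinity>" and finY: "fibre_cost g r < \<infinity>"
    and stationary: "test_pair A a \<Longrightarrow> test_pair B b \<Longrightarrow>
      (LBINT x. a x * X.variation p B x) + (LBINT y. b y * Y.variation r A y) = 0"
begin

lemma swapped: "coupled_transport g r f p"
proof unfold_locales
  show "fibre_cost g r < \<infinity>" "fibre_cost f p < \<infinity>" by (rule finY finX)+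
  show "(LBINT x. a x * Y.variation r B x) + (LBINT y. b y * X.variation p A y) = 0"
    if "test_pair A a" "test_pair B b" for A a B b
    using stationary[OF that(2,1)] by (simp only: add.commute)
qed

text \<open>By Fubini the second term of \<open>stationary\<close> pairs
  \<open>Y.cross_average b\<close> with \<open>A\<close>. The relation thus says that
  \<open>X.fibre_average B\<close> has the continuous weak derivative
  \<open>Y.cross_average b\<close>.\<close>

lemma fibre_average_weak_derivative:
  assumes B: "test_pair B b"
  obtains W where "\<And>x. (W has_real_derivative Y.cross_average b x) (at x)"
    "AE x in lborel. X.fibre_average B x = W x"
proof (rule du_Bois_Reymond)
  show "set_integrable lborel {l..u} (X.fibre_average B)" for l u
    by (rule X.fibre_average_locally_integrable[OF finX B])
  show "continuous_on UNIV (Y.cross_average b)"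
  proof (rule test_pairE[OF B])
    fix l u K :: real
    assume b: "\<And>x. \<bar>b x\<bar> \<le> K" "\<And>x. x \<notin> {l<..<u} \<Longrightarrow> b x = 0" "b \<in> borel_measurable borel"
    show ?thesis
      by (rule Y.cross_average_cont[OF finY b(3) b(1), of l u]) (use b(2) in auto)
  qed
  show "(LBINT x. X.fibre_average B x * a x) + (LBINT x. Y.cross_average b x * A x) = 0"
    if A: "test_pair A a" for A a
    using stationary[OF A B] X.weighted_variation_eq[OF finX A B] Y.weighted_variation_eq[OF finY B A]
      Y.average_swap[OF finY A B] by (simp add: mult.commute)
qed (rule that)

text \<open>By monotonicity the value at \<open>t\<close> is at most the normalised average against
  a tent to the right of \<open>t\<close>, and at least the one against a tent to the left; both
  averages are almost everywhere equal to continuous functions.\<close>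

lemma transport_map_essentially_bounded:
  "\<exists>K. AE x in lborel. x \<in> {l..u} \<longrightarrow> \<bar>X.T p x t\<bar> \<le> K"
proof -
  have avg: "\<exists>K. AE x in lborel. x \<in> {l..u} \<longrightarrow> \<bar>X.fibre_average B x\<bar> \<le> K" if B: "test_pair B b" for B b
  proof -
    obtain W where W: "\<And>x. (W has_real_derivative Y.cross_average b x) (at x)"
      "AE x in lborel. X.fibre_average B x = W x"
      using fibre_average_weak_derivative[OF B] by blast
    have "continuous_on UNIV W" using W(1) by (meson DERIV_isCont continuous_at_imp_continuous_on)
    then obtain K where "\<And>x. x \<in> {l..u} \<Longrightarrow> \<bar>W x\<bar> \<le> K" by (metis continuous_bounded_on_Icc)
    with W(2) have "AE x in lborel. x \<in> {l..u} \<longrightarrow> \<bar>X.fibre_average B x\<bar> \<le> K"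
      by (auto elim!: eventually_mono)
    then show ?thesis by blast
  qed
  obtain B b where B: "test_pair B b" "\<And>x. B x \<ge> 0" "\<And>x. x \<notin> {t<..<t + 2} \<Longrightarrow> B x = 0"
    "integrable lborel B" "(LBINT x. B x) > 0"
    by (rule tent_test_pair[of t], rule that)
  obtain D d where D: "test_pair D d" "\<And>x. D x \<ge> 0" "\<And>x. x \<notin> {t - 2<..<t - 2 + 2} \<Longrightarrow> D x = 0"
    "integrable lborel D" "(LBINT x. D x) > 0"
    by (rule tent_test_pair[of "t - 2"], rule that)
  have int: "integrable lborel (\<lambda>s. X.T p x s * B s)" if B: "test_pair B b" for B b x
  proof (rule test_pairE[OF B])
    fix l u K :: real
    assume b: "\<And>x. \<bar>B x\<bar> \<le> K" "\<And>x. x \<notin> {l<..<u} \<Longrightarrow> B x = 0" "B \<in> borel_measurable borel"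
    show ?thesis
      by (rule X.fibre_average_integrable(1)[OF b(3) b(1), of l u]) (use b(2) in auto)
  qed
  have up: "X.T p x t * (LBINT s. B s) \<le> X.fibre_average B x" for x
  proof -
    have "(LBINT s. X.T p x t * B s) \<le> (LBINT s. X.T p x s * B s)"
    proof (intro integral_mono int[OF B(1)] integrable_mult_right B(4))
      show "X.T p x t * B s \<le> X.T p x s * B s" for s
        using B(2)[of s] B(3)[of s] X.transport_map_le[OF X.p_dens, of t s x]
        by (cases "t \<le> s") (auto intro: mult_right_mono)
    qed
    then show ?thesis by (simp add: X.fibre_average_def)
  qed
  have down: "X.fibre_average D x \<le> X.T p x t * (LBINT s. D s)" for x
  proof -
    have "(LBINT s. X.T p x s * D s) \<le> (LBINT s. X.T p x t * D s)"
    proof (intro integral_mono int[OF D(1)] integrable_mult_right D(4))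
      show "X.T p x s * D s \<le> X.T p x t * D s" for s
        using D(2)[of s] D(3)[of s] X.transport_map_le[OF X.p_dens, of s t x]
        by (cases "s \<le> t") (auto intro: mult_right_mono)
    qed
    then show ?thesis by (simp add: X.fibre_average_def)
  qed
  obtain K1 where K1: "AE x in lborel. x \<in> {l..u} \<longrightarrow> \<bar>X.fibre_average B x\<bar> \<le> K1" using avg[OF B(1)] by blast
  obtain K2 where K2: "AE x in lborel. x \<in> {l..u} \<longrightarrow> \<bar>X.fibre_average D x\<bar> \<le> K2" using avg[OF D(1)] by blast
  have "AE x in lborel. x \<in> {l..u} \<longrightarrow> \<bar>X.T p x t\<bar> \<le> max (K1 / (LBINT s. B s)) (K2 / (LBINT s. D s))"
    using K1 K2
  proof eventually_elim
    case (elim x)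
    show ?case
    proof
      assume "x \<in> {l..u}"
      with elim have "X.T p x t * (LBINT s. B s) \<le> K1" "- K2 \<le> X.T p x t * (LBINT s. D s)"
        using up[of x] down[of x] by auto
      then have "X.T p x t \<le> K1 / (LBINT s. B s)" "- (K2 / (LBINT s. D s)) \<le> X.T p x t"
        using B(5) D(5) by (auto simp: field_simps)
      then show "\<bar>X.T p x t\<bar> \<le> max (K1 / (LBINT s. B s)) (K2 / (LBINT s. D s))" by linarith
    qed
  qed
  then show ?thesis by blast
qed

lemma transport_map_joint_cont: "continuous_on UNIV (\<lambda>z. X.T p (fst z) (snd z))"
  by (intro X.transport_map_cont_joint X.transport_map_cont_fst transport_map_essentially_bounded)

lemma transport_map_fst_cont: "continuous_on UNIV (\<lambda>x. X.T p x t)"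
  by (intro continuous_at_imp_continuous_on ballI X.transport_map_cont_fst transport_map_essentially_bounded)

text \<open>Joint continuity of the map makes the average itself continuous, so it coincides
  everywhere with its differentiable representative.\<close>

lemma fibre_average_deriv:
  assumes B: "test_pair B b"
  shows "(X.fibre_average B has_real_derivative Y.cross_average b x) (at x)"
proof -
  obtain W where W: "\<And>x. (W has_real_derivative Y.cross_average b x) (at x)"
      "AE x in lborel. X.fibre_average B x = W x"
    using fibre_average_weak_derivative[OF B] by blast
  have "continuous_on UNIV (X.fibre_average B)"
  proof (rule test_pairE[OF B])
    fix l u K :: real
    assume b: "\<And>x. \<bar>B x\<bar> \<le> K" "\<And>x. x \<notin> {l<..<u} \<Longrightarrow> B x = 0" "B \<in> borel_measurable borel" "continuous_on UNIV B"
    have "X.fibre_average B x = integral {l..u} (\<lambda>t. X.T p x t * B t)" for x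
      by (rule integral_unique[symmetric], rule X.fibre_average_integrable(2)[OF b(3) b(1)]) (use b(2) in auto)
    moreover have "continuous_on UNIV (\<lambda>x. integral {l..u} (\<lambda>t. (\<lambda>z. X.T p (fst z) (snd z) * B (snd z)) (x, t)))"
      by (intro fibre_integral_continuous continuous_on_mult transport_map_joint_cont
          continuous_on_compose2[OF b(4)] continuous_on_snd continuous_on_id) auto
    ultimately show ?thesis by simp
  qed
  moreover have "continuous_on UNIV W" using W(1) by (meson DERIV_isCont continuous_at_imp_continuous_on)
  ultimately have "X.fibre_average B = W" using AE_eq_continuous_imp_eq[OF W(2)] by blast
  then show ?thesis using W(1) by simp
qed

end

section \<open>Differentiability of the transport maps\<close>

lemma unit_integral_continuous:
  fixes k :: "real \<times> real \<Rightarrow> real" and X Y :: "(real \<times> real) \<times> real \<Rightarrow> real"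
  assumes "continuous_on UNIV k" "continuous_on UNIV X" "continuous_on UNIV Y"
  shows "continuous_on UNIV (\<lambda>w. integral {0..1} (\<lambda>\<theta>. k (X (w, \<theta>), Y (w, \<theta>))))"
proof -
  have "continuous_on UNIV (\<lambda>z. k (X z, Y z))"
    by (rule continuous_on_compose2[OF assms(1)]) (auto intro!: continuous_on_Pair assms)
  then have "continuous_on (UNIV \<times> cbox 0 1) (\<lambda>(w, \<theta>). k (X (w, \<theta>), Y (w, \<theta>)))"
    by (auto simp: case_prod_unfold intro: continuous_on_subset)
  from integral_continuous_on_param[OF this] show ?thesis by simp
qed

lemma integral_along_segment:
  fixes \<Phi> \<phi> :: "real \<Rightarrow> real"
  assumes "\<And>z. (\<Phi> has_real_derivative \<phi> z) (at z)"
  shows "\<Phi> z - \<Phi> y = (z - y) * integral {0..1} (\<lambda>\<theta>. \<phi> (y + \<theta> * (z - y)))"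
proof -
  have "((\<lambda>\<theta>. (z - y) * \<phi> (y + \<theta> * (z - y))) has_integral (\<Phi> (y + 1 * (z - y)) - \<Phi> (y + 0 * (z - y)))) {0..1}"
  proof (rule fundamental_theorem_of_calculus)
    show "((\<lambda>\<theta>. \<Phi> (y + \<theta> * (z - y))) has_vector_derivative (z - y) * \<phi> (y + \<theta> * (z - y))) (at \<theta> within {0..1})" for \<theta>
      unfolding has_real_derivative_iff_has_vector_derivative[symmetric]
      by (rule has_field_derivative_at_within, rule DERIV_cong, rule DERIV_chain2[OF assms])
        (auto intro!: derivative_eq_intros)
  qed simp
  from integral_unique[OF this] show ?thesis by simp
qed

text \<open>Hadamard's lemma: \<open>m\<close> averages \<open>k'\<close> along the segment from
  \<open>x0\<close> to \<open>x\<close>. Its continuity across \<open>x = x0\<close> is what gives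
  difference quotients a limit.\<close>

lemma hadamard_fst:
  fixes k k' :: "real \<times> real \<Rightarrow> real"
  assumes k': "\<And>x s. ((\<lambda>x. k (x, s)) has_real_derivative k' (x, s)) (at x)" "continuous_on UNIV k'"
  obtains m where "continuous_on UNIV m" "\<And>x s. k (x, s) - k (x0, s) = (x - x0) * m (x, s)"
proof
  let ?m = "\<lambda>z. integral {0..1} (\<lambda>\<theta>. k' (x0 + \<theta> * (fst z - x0), snd z))"
  show "continuous_on UNIV ?m"
    using unit_integral_continuous[OF k'(2), of "\<lambda>w. x0 + snd w * (fst (fst w) - x0)" "\<lambda>w. snd (fst w)"]
    by (simp add: continuous_intros)
  show "k (x, s) - k (x0, s) = (x - x0) * ?m (x, s)" for x s
    using integral_along_segment[OF k'(1), of x s x0] by simp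
qed

context coupled_transport
begin

text \<open>At a fixed \<open>x0\<close> the transport equation reads
  \<open>(T x t - T x0 t) * \<alpha> (x, t) = (d x - d x0) + (x - x0) * N (x, t)\<close> with continuous \<open>\<alpha> > 0\<close> and
  \<open>N\<close>, where \<open>d x = H_x p x 0 - H_x f x 0\<close> need not be smooth a priori. Averaging against a bump
  in \<open>t\<close>, the left side becomes differentiable, and hence so does \<open>d\<close>.\<close>

lemma transport_map_deriv:
  assumes f': "\<And>x s. ((\<lambda>x. f (x, s)) has_real_derivative fx (x, s)) (at x)" "continuous_on UNIV fx"
    and p': "\<And>x s. ((\<lambda>x. p (x, s)) has_real_derivative px (x, s)) (at x)" "continuous_on UNIV px"
  obtains \<tau> where "continuous_on UNIV \<tau>" "\<And>t. ((\<lambda>x. X.T p x t) has_real_derivative \<tau> t) (at x0)"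
    "\<And>B b. test_pair B b \<Longrightarrow> Y.cross_average b x0 = (LBINT t. \<tau> t * B t)"
proof -
  obtain mf where mf: "continuous_on UNIV mf" "\<And>x s. f (x, s) - f (x0, s) = (x - x0) * mf (x, s)"
    using hadamard_fst[OF f'] by blast
  obtain mp where mp: "continuous_on UNIV mp" "\<And>x s. p (x, s) - p (x0, s) = (x - x0) * mp (x, s)"
    using hadamard_fst[OF p'] by blast
  define T where "T = X.T p"
  have cT: "continuous_on UNIV (\<lambda>z. T (fst z) (snd z))"
    using transport_map_joint_cont by (simp add: T_def)
  have cT0: "continuous_on UNIV (T x0)" using X.transport_map_cont by (simp add: T_def)
  \<comment> \<open>The mean of \<open>k (x, _)\<close> between 0 and \<open>z\<close>; multiplied
    by \<open>z\<close> it is the increment of the distribution function from level 0, which is well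
    behaved in \<open>x\<close>.\<close>
  define I where "I = (\<lambda>(k :: real \<times> real \<Rightarrow> real) x z. integral {0..1} (\<lambda>\<theta>. k (x, \<theta> * z)))"
  have Hf: "H_x f x z - H_x f x 0 = z * I f x z" for x z
    using integral_along_segment[OF X.H_x_f_deriv, of x z 0] by (simp add: I_def)
  have Hp: "H_x p x z - H_x p x 0 = z * I p x z" for x z
    using integral_along_segment[OF X.H_x_p_deriv, of x z 0] by (simp add: I_def)
  have I_diff: "I k x z - I k x0 z = (x - x0) * I m x z"
    if "continuous_on UNIV k" "continuous_on UNIV m" "\<And>x s. k (x, s) - k (x0, s) = (x - x0) * m (x, s)"
    for k m :: "real \<times> real \<Rightarrow> real" and x z
  proof -
    have i: "(\<lambda>\<theta>. k (x, \<theta> * z)) integrable_on {0..1}" if "continuous_on UNIV k" for k :: "real \<times> real \<Rightarrow> real" and x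
      by (rule integrable_continuous_real, rule continuous_on_compose2[OF that]) (auto intro!: continuous_intros)
    have "I k x z - I k x0 z = integral {0..1} (\<lambda>\<theta>. k (x, \<theta> * z) - k (x0, \<theta> * z))"
      unfolding I_def using i[OF that(1)] by (intro Henstock_Kurzweil_Integration.integral_diff[symmetric])
    then show ?thesis unfolding that(3) I_def by simp
  qed
  \<comment> \<open>\<open>\<alpha> (x, t)\<close> is the mean of \<open>f (x, _)\<close> between
    \<open>T x0 t\<close> and \<open>T x t\<close>. \<open>N\<close> collects the change of both
    increments from level 0 as \<open>x\<close> moves while the levels \<open>t\<close> and
    \<open>T x0 t\<close> stay fixed.\<close>
  define \<alpha> where "\<alpha> = (\<lambda>z. integral {0..1} (\<lambda>\<theta>. f (fst z, T x0 (snd z) + \<theta> * (T (fst z) (snd z) - T x0 (snd z)))))"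
  define N where "N = (\<lambda>z. snd z * I mp (fst z) (snd z) - T x0 (snd z) * I mf (fst z) (T x0 (snd z)))"
  have cT0': "continuous_on UNIV (\<lambda>z::real \<times> real. T x0 (snd z))"
    by (rule continuous_on_compose2[OF cT0]) (auto intro: continuous_intros)
  have c\<alpha>: "continuous_on UNIV \<alpha>"
    unfolding \<alpha>_def
  proof (rule unit_integral_continuous[OF X.f_cont, of "\<lambda>w. fst (fst w)"
        "\<lambda>w. T x0 (snd (fst w)) + snd w * (T (fst (fst w)) (snd (fst w)) - T x0 (snd (fst w)))", simplified])
    show "continuous_on UNIV (\<lambda>w::(real \<times> real) \<times> real. fst (fst w))" by (intro continuous_intros)
    show "continuous_on UNIV (\<lambda>w::(real \<times> real) \<times> real. T x0 (snd (fst w)) + snd w * (T (fst (fst w)) (snd (fst w)) - T x0 (snd (fst w))))"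
      by (intro continuous_intros continuous_on_compose2[OF cT0] continuous_on_compose2[OF cT, of _ fst]) auto
  qed
  have cN: "continuous_on UNIV N"
    unfolding N_def I_def
  proof (intro continuous_on_diff continuous_on_mult continuous_on_snd continuous_on_id)
    show "continuous_on UNIV (\<lambda>z. integral {0..1} (\<lambda>\<theta>. mp (fst z, \<theta> * snd z)))"
      using unit_integral_continuous[OF mp(1), of "\<lambda>w. fst (fst w)" "\<lambda>w. snd w * snd (fst w)"]
      by (simp add: continuous_intros)
    show "continuous_on UNIV (\<lambda>z::real \<times> real. T x0 (snd z))" by (rule cT0')
    have "continuous_on UNIV (\<lambda>w::(real \<times> real) \<times> real. snd w * T x0 (snd (fst w)))"
      by (intro continuous_intros continuous_on_compose2[OF cT0]) auto
    then show "continuous_on UNIV (\<lambda>z. integral {0..1} (\<lambda>\<theta>. mf (fst z, \<theta> * T x0 (snd z))))"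
      using unit_integral_continuous[OF mf(1), of "\<lambda>w. fst (fst w)" "\<lambda>w. snd w * T x0 (snd (fst w))"]
      by (simp add: continuous_intros)
  qed
  have \<alpha>_pos: "\<alpha> z > 0" for z
  proof -
    let ?g = "\<lambda>\<theta>. f (fst z, T x0 (snd z) + \<theta> * (T (fst z) (snd z) - T x0 (snd z)))"
    have cg: "continuous_on {0..1} ?g"
      by (rule continuous_on_compose2[OF X.f_cont]) (auto intro!: continuous_intros)
    have g_int: "(?g has_integral \<alpha> z) {0..1}"
      unfolding \<alpha>_def by (rule integrable_integral[OF integrable_continuous_real[OF cg]])
    have "\<exists>\<theta>0\<in>{0..1::real}. \<forall>\<theta>\<in>{0..1}. ?g \<theta>0 \<le> ?g \<theta>"
      by (rule continuous_attains_inf[OF _ _ cg]) auto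
    then obtain \<theta>0 where \<theta>0: "\<forall>\<theta>\<in>{0..1}. ?g \<theta>0 \<le> ?g \<theta>" by blast
    have "((\<lambda>_. ?g \<theta>0) has_integral ?g \<theta>0) {0..1::real}"
      using has_integral_const_real[of "?g \<theta>0" 0 1] by simp
    from has_integral_le[OF this g_int] \<theta>0 have "?g \<theta>0 \<le> \<alpha> z" by blast
    with X.f_pos show ?thesis by (rule less_le_trans)
  qed
  \<comment> \<open>Level 0 is an arbitrary anchor. Both distribution functions are an increment
    plus their value there, and only the difference of these two values enters the transport
    equation.\<close>
  define d where "d = (\<lambda>x. H_x p x 0 - H_x f x 0)"
  have eq: "(T x t - T x0 t) * \<alpha> (x, t) = (d x - d x0) + (x - x0) * N (x, t)" for x t
  proof -
    have 1: "T x t * I f x (T x t) = d x + t * I p x t" for x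
      using Hf[of x "T x t"] Hp[of x t] X.transport_map_eq[OF X.p_dens, of x t]
      by (simp add: T_def d_def)
    have "(T x t - T x0 t) * \<alpha> (x, t) = H_x f x (T x t) - H_x f x (T x0 t)"
      using integral_along_segment[OF X.H_x_f_deriv, of x "T x t" "T x0 t"] by (simp add: \<alpha>_def)
    also have "\<dots> = T x t * I f x (T x t) - T x0 t * I f x (T x0 t)"
      using Hf[of x "T x t"] Hf[of x "T x0 t"] by simp
    also have "\<dots> = (d x - d x0) + (t * (I p x t - I p x0 t) - T x0 t * (I f x (T x0 t) - I f x0 (T x0 t)))"
      using 1[of x] 1[of x0] by (simp add: algebra_simps)
    also have "t * (I p x t - I p x0 t) - T x0 t * (I f x (T x0 t) - I f x0 (T x0 t)) = (x - x0) * N (x, t)"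
      unfolding I_diff[OF X.p_cont mp] I_diff[OF X.f_cont mf] by (simp add: N_def algebra_simps)
    finally show ?thesis .
  qed
  have slope: "(T x t - T x0 t) / (x - x0) = ((d x - d x0) / (x - x0) + N (x, t)) / \<alpha> (x, t)" if "x \<noteq> x0" for x t
  proof -
    have "(T x t - T x0 t) / (x - x0) = ((d x - d x0) + (x - x0) * N (x, t)) / (x - x0) / \<alpha> (x, t)"
      using eq[of x t, symmetric] \<alpha>_pos[of "(x, t)"] by simp
    then show ?thesis using that by (simp add: add_divide_distrib)
  qed

  \<comment> \<open>Coefficients of the averaged equation: \<open>P\<close> multiplies the increment
    of \<open>d\<close>, and \<open>Q\<close> multiplies \<open>x - x0\<close>.\<close>
  define P where "P = (\<lambda>B l u x. integral {l..u} (\<lambda>t. B t / \<alpha> (x, t)))"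
  define Q where "Q = (\<lambda>B l u x. integral {l..u} (\<lambda>t. N (x, t) * B t / \<alpha> (x, t)))"
  have \<alpha>0: "\<alpha> z \<noteq> 0" for z using \<alpha>_pos[of z] by simp
  have c2: "continuous_on UNIV (\<lambda>z. B (snd z) / \<alpha> z)" "continuous_on UNIV (\<lambda>z. N z * B (snd z) / \<alpha> z)"
    if "continuous_on UNIV B" for B :: "real \<Rightarrow> real"
    using c\<alpha> cN \<alpha>0 by (auto intro!: continuous_intros continuous_on_compose2[OF that])
  have cP: "continuous_on UNIV (P B l u)" "continuous_on UNIV (Q B l u)"
    if "continuous_on UNIV B" for B :: "real \<Rightarrow> real" and l u
    using fibre_integral_continuous[OF c2(1)[OF that]] fibre_integral_continuous[OF c2(2)[OF that]]
    by (simp_all add: P_def Q_def)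
  have cpair: "continuous_on UNIV (\<lambda>t. k (x, t))" "continuous_on UNIV (\<lambda>x. k (x, t))"
    if "continuous_on UNIV k" for k :: "real \<times> real \<Rightarrow> real" and x t
    by (rule continuous_on_compose2[OF that]; auto intro!: continuous_intros)+
  have c1: "continuous_on {l..u} (\<lambda>t. B t / \<alpha> (x, t))" "continuous_on {l..u} (\<lambda>t. N (x, t) * B t / \<alpha> (x, t))"
    if "continuous_on UNIV B" for B :: "real \<Rightarrow> real" and l u x
    using continuous_on_subset[OF cpair(1)[OF c2(1)[OF that], of x] subset_UNIV[of "{l..u}"]]
      continuous_on_subset[OF cpair(1)[OF c2(2)[OF that], of x] subset_UNIV[of "{l..u}"]]
    by simp_all
  have avg: "X.fibre_average B x - X.fibre_average B x0 = (d x - d x0) * P B l u x + (x - x0) * Q B l u x"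
    if B: "B \<in> borel_measurable borel" "\<And>t. \<bar>B t\<bar> \<le> K" "\<And>t. t \<notin> {l..u} \<Longrightarrow> B t = 0" "continuous_on UNIV B"
    for B :: "real \<Rightarrow> real" and l u K x
  proof -
    note i = X.fibre_average_integrable(2)[OF B(1-3)]
    have "((\<lambda>t. T x t * B t - T x0 t * B t) has_integral X.fibre_average B x - X.fibre_average B x0) {l..u}"
      unfolding T_def by (intro has_integral_diff i)
    moreover have "T x t * B t - T x0 t * B t = (d x - d x0) * (B t / \<alpha> (x, t)) + (x - x0) * (N (x, t) * B t / \<alpha> (x, t))" for t
    proof -
      have "T x t - T x0 t = ((d x - d x0) + (x - x0) * N (x, t)) / \<alpha> (x, t)"
        using eq[of x t] \<alpha>0[of "(x, t)"] by (simp add: field_simps)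
      then have "(T x t - T x0 t) * B t = ((d x - d x0) + (x - x0) * N (x, t)) / \<alpha> (x, t) * B t" by simp
      then show ?thesis by (simp add: algebra_simps add_divide_distrib diff_divide_distrib)
    qed
    moreover have "((\<lambda>t. (d x - d x0) * (B t / \<alpha> (x, t)) + (x - x0) * (N (x, t) * B t / \<alpha> (x, t))) has_integral
        (d x - d x0) * P B l u x + (x - x0) * Q B l u x) {l..u}"
      unfolding P_def Q_def
      by (intro has_integral_add has_integral_mult_right integrable_integral integrable_continuous_real c1 B(4))
    ultimately show ?thesis by (simp add: has_integral_unique)
  qed
  have lim: "(k \<longlongrightarrow> k x0) (at x0)" if "continuous_on UNIV k" for k :: "real \<Rightarrow> real"
    using that by (simp add: continuous_on_def)

  \<comment> \<open>A nonnegative bump with positive integral makes \<open>P\<close> positive, so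
    the averaged equation can be solved for the difference quotient of \<open>d\<close>; its limit
    is \<open>\<mu>\<close>.\<close>
  obtain B0 b0 where B0: "test_pair B0 b0" "\<And>x. B0 x \<ge> 0" "\<And>x. x \<notin> {0<..<0 + 2} \<Longrightarrow> B0 x = 0"
    "integrable lborel B0" "(LBINT x. B0 x) > 0"
    by (rule tent_test_pair[of 0], rule that)
  have B0': "continuous_on UNIV B0" "B0 \<in> borel_measurable borel"
    using B0(1) by (auto simp: test_pair_def intro: borel_measurable_continuous_onI)
  obtain K0 where K0: "\<And>t. \<bar>B0 t\<bar> \<le> K0"
    by (rule test_pairE[OF B0(1)]) blast
  have P0: "P B0 0 2 x > 0" for x
  proof -
    obtain M where M: "M > 0" "\<And>t. t \<in> {0..2} \<Longrightarrow> \<bar>\<alpha> (x, t)\<bar> \<le> M"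
      by (rule continuous_bounded_on_Icc[OF cpair(1)[OF c\<alpha>, of x], of 0 2], rule that)
    have "(B0 has_integral (LBINT x. B0 x)) {0..2}"
      by (rule bounded_support_integral(2)[OF B0'(2) K0]) (use B0(3) in auto)
    from has_integral_mult_right[OF this, of "1 / M"]
    have "((\<lambda>t. 1 / M * B0 t) has_integral 1 / M * (LBINT x. B0 x)) {0..2}" .
    moreover have "((\<lambda>t. B0 t / \<alpha> (x, t)) has_integral P B0 0 2 x) {0..2}"
      unfolding P_def by (intro integrable_integral integrable_continuous_real c1 B0')
    moreover have "1 / M * B0 t \<le> B0 t / \<alpha> (x, t)" if "t \<in> {0..2}" for t
      using M(1) M(2)[OF that] \<alpha>_pos[of "(x, t)"] B0(2)[of t] by (auto intro!: divide_left_mono)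
    ultimately have "1 / M * (LBINT x. B0 x) \<le> P B0 0 2 x" by (rule has_integral_le)
    then show ?thesis using B0(5) M(1) by (smt (verit) divide_pos_pos mult_pos_pos)
  qed
  define \<mu> where "\<mu> = (Y.cross_average b0 x0 - Q B0 0 2 x0) / P B0 0 2 x0"
  have "((\<lambda>x. ((X.fibre_average B0 x - X.fibre_average B0 x0) / (x - x0) - Q B0 0 2 x) / P B0 0 2 x) \<longlongrightarrow> \<mu>) (at x0)"
    unfolding \<mu>_def using fibre_average_deriv[OF B0(1), of x0] P0[of x0]
    by (intro tendsto_divide tendsto_diff lim cP B0') (auto simp: has_field_derivative_iff)
  moreover have "eventually (\<lambda>x. ((X.fibre_average B0 x - X.fibre_average B0 x0) / (x - x0) - Q B0 0 2 x) / P B0 0 2 x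
      = (d x - d x0) / (x - x0)) (at x0)"
    unfolding eventually_at_filter
  proof (intro always_eventually allI impI)
    fix x :: real assume ne: "x \<noteq> x0"
    have "X.fibre_average B0 x - X.fibre_average B0 x0 = (d x - d x0) * P B0 0 2 x + (x - x0) * Q B0 0 2 x"
      by (rule avg[OF B0'(2) K0 _ B0'(1)]) (use B0(3) in auto)
    then have "(X.fibre_average B0 x - X.fibre_average B0 x0) / (x - x0) = (d x - d x0) / (x - x0) * P B0 0 2 x + Q B0 0 2 x"
      using ne by (simp add: add_divide_distrib)
    then show "((X.fibre_average B0 x - X.fibre_average B0 x0) / (x - x0) - Q B0 0 2 x) / P B0 0 2 x = (d x - d x0) / (x - x0)"
      using P0[of x] by simp
  qed
  ultimately have d': "((\<lambda>x. (d x - d x0) / (x - x0)) \<longlongrightarrow> \<mu>) (at x0)"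
    by (rule Lim_transform_eventually)

  define \<tau> where "\<tau> = (\<lambda>t. (\<mu> + N (x0, t)) / \<alpha> (x0, t))"
  show ?thesis
  proof (rule that[of \<tau>])
    show c\<tau>: "continuous_on UNIV \<tau>"
      unfolding \<tau>_def using \<alpha>0 by (intro continuous_intros cpair cN c\<alpha>) auto
    show "((\<lambda>x. X.T p x t) has_real_derivative \<tau> t) (at x0)" for t
      unfolding has_field_derivative_iff T_def[symmetric]
    proof (rule Lim_transform_eventually)
      show "((\<lambda>x. ((d x - d x0) / (x - x0) + N (x, t)) / \<alpha> (x, t)) \<longlongrightarrow> \<tau> t) (at x0)"
        unfolding \<tau>_def using \<alpha>0
        by (intro tendsto_divide tendsto_add d' lim[of "\<lambda>x. N (x, t)"] lim[of "\<lambda>x. \<alpha> (x, t)"] cpair cN c\<alpha>)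
      show "eventually (\<lambda>x. ((d x - d x0) / (x - x0) + N (x, t)) / \<alpha> (x, t) = (T x t - T x0 t) / (x - x0)) (at x0)"
        using slope by (auto simp: eventually_at_filter)
    qed
    show "Y.cross_average b x0 = (LBINT t. \<tau> t * B t)" if B: "test_pair B b" for B b
    proof -
      obtain l u K S where b: "l < u" "K > 0" "finite S" "\<And>x. \<bar>b x\<bar> \<le> K" "\<And>x. \<bar>B x\<bar> \<le> K"
        "\<And>x. x \<notin> {l<..<u} \<Longrightarrow> B x = 0" "\<And>x. x \<notin> {l<..<u} \<Longrightarrow> b x = 0"
        "\<And>x. x \<notin> S \<Longrightarrow> (B has_real_derivative b x) (at x)"
        "b \<in> borel_measurable borel" "B \<in> borel_measurable borel" "continuous_on UNIV B"
        by (rule test_pairE[OF B], rule that)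
      have b0: "\<And>t. t \<notin> {l..u} \<Longrightarrow> B t = 0" using b(6) by auto
      \<comment> \<open>For arbitrary \<open>B\<close> the derivative of the average is computed a
        second time, now from the derivative \<open>\<mu>\<close> of \<open>d\<close>; comparison
        with \<open>fibre_average_deriv\<close> yields the integral of \<open>\<tau>\<close> against
        \<open>B\<close>.\<close>
      have "((\<lambda>x. (d x - d x0) / (x - x0) * P B l u x + Q B l u x) \<longlongrightarrow> \<mu> * P B l u x0 + Q B l u x0) (at x0)"
        by (intro tendsto_intros d' lim cP b(11))
      moreover have "eventually (\<lambda>x. (d x - d x0) / (x - x0) * P B l u x + Q B l u x
          = (X.fibre_average B x - X.fibre_average B x0) / (x - x0)) (at x0)"
        unfolding eventually_at_filter
        by (intro always_eventually allI impI, subst avg[OF b(10,5) b0 b(11)]) (auto simp: field_simps)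
      ultimately have "((\<lambda>x. (X.fibre_average B x - X.fibre_average B x0) / (x - x0)) \<longlongrightarrow> \<mu> * P B l u x0 + Q B l u x0) (at x0)"
        by (rule Lim_transform_eventually)
      moreover have "((\<lambda>x. (X.fibre_average B x - X.fibre_average B x0) / (x - x0)) \<longlongrightarrow> Y.cross_average b x0) (at x0)"
        using fibre_average_deriv[OF B, of x0] by (simp add: has_field_derivative_iff)
      ultimately have e: "Y.cross_average b x0 = \<mu> * P B l u x0 + Q B l u x0"
        by (intro tendsto_unique[OF trivial_limit_at])
      have "((\<lambda>t. \<mu> * (B t / \<alpha> (x0, t)) + N (x0, t) * B t / \<alpha> (x0, t)) has_integral \<mu> * P B l u x0 + Q B l u x0) {l..u}"
        unfolding P_def Q_def
        by (intro has_integral_add has_integral_mult_right integrable_integral integrable_continuous_real c1 b(11))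
      moreover have "(\<lambda>t. \<mu> * (B t / \<alpha> (x0, t)) + N (x0, t) * B t / \<alpha> (x0, t)) = (\<lambda>t. \<tau> t * B t)"
        by (auto simp: \<tau>_def add_divide_distrib distrib_right)
      ultimately have i1: "((\<lambda>t. \<tau> t * B t) has_integral \<mu> * P B l u x0 + Q B l u x0) {l..u}" by simp
      have c\<tau>B: "continuous_on UNIV (\<lambda>t. \<tau> t * B t)" by (intro continuous_intros c\<tau> b(11))
      obtain M where "\<And>t. t \<in> {l..u} \<Longrightarrow> \<bar>\<tau> t * B t\<bar> \<le> M"
        using continuous_bounded_on_Icc[OF c\<tau>B] by metis
      then have "((\<lambda>t. \<tau> t * B t) has_integral (LBINT t. \<tau> t * B t)) {l..u}"
        by (rule bounded_support_integral(2)[OF borel_measurable_continuous_onI[OF c\<tau>B]]) (use b0 in auto)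
      with i1 e show ?thesis by (simp add: has_integral_unique)
    qed
  qed
qed

lemma euler_lagrange:
  assumes f': "\<And>x s. ((\<lambda>x. f (x, s)) has_real_derivative fx (x, s)) (at x)" "continuous_on UNIV fx"
    and p': "\<And>x s. ((\<lambda>x. p (x, s)) has_real_derivative px (x, s)) (at x)" "continuous_on UNIV px"
  shows "\<exists>c. ((\<lambda>s. X.T p s y) has_real_derivative c) (at x) \<and> ((\<lambda>t. Y.T r t x) has_real_derivative - c) (at y)"
proof -
  obtain \<tau> where \<tau>: "continuous_on UNIV \<tau>" "\<And>t. ((\<lambda>x. X.T p x t) has_real_derivative \<tau> t) (at x)"
    "\<And>B b. test_pair B b \<Longrightarrow> Y.cross_average b x = (LBINT t. \<tau> t * B t)"
    using transport_map_deriv[OF f' p'] by blast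
  \<comment> \<open>Continuity of \<open>Y.T r t x\<close> in \<open>t\<close> is continuity in the
    base point for the exchanged problem; it upgrades the almost everywhere equality with
    \<open>W\<close>.\<close>
  interpret S: coupled_transport g r f p by (rule swapped)
  obtain W where W: "\<And>t. (W has_real_derivative - \<tau> t) (at t)" "AE t in lborel. Y.T r t x = W t"
  proof (rule du_Bois_Reymond)
    show "set_integrable lborel {l..u} (\<lambda>t. Y.T r t x)" for l u
      by (rule Y.transport_map_locally_integrable[OF finY])
    show "continuous_on UNIV (\<lambda>t. - \<tau> t)" by (intro continuous_intros \<tau>(1))
    show "(LBINT t. Y.T r t x * b t) + (LBINT t. - \<tau> t * B t) = 0" if "test_pair B b" for B b
      using \<tau>(3)[OF that] by (simp add: Y.cross_average_def)
  qed (rule that)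
  have "continuous_on UNIV W" using W(1) by (meson DERIV_isCont continuous_at_imp_continuous_on)
  then have "(\<lambda>t. Y.T r t x) = W"
    using AE_eq_continuous_imp_eq[OF W(2) S.transport_map_fst_cont] by blast
  then show ?thesis using \<tau>(2) W(1) by auto
qed

end

section \<open>The minimization problem\<close>

lemma smooth_continuous: "smooth g \<Longrightarrow> continuous_on UNIV g"
  using C_k.simps(1)[of g] by (simp add: smooth_def del: C_k.simps)

lemma smooth_partial_fst:
  assumes "smooth g"
  obtains g' where "continuous_on UNIV g'"
    "\<And>x s. ((\<lambda>x. g (x, s)) has_real_derivative g' (x, s)) (at x)"
proof
  have "C_k (Suc 0) g" using assms unfolding smooth_def by blast
  then have g: "g differentiable (at z)" "continuous_on UNIV (\<lambda>z. frechet_derivative g (at z) h)" for z h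
    unfolding C_k.simps by blast+
  let ?D = "\<lambda>z. frechet_derivative g (at z)"
  show "continuous_on UNIV (\<lambda>z. ?D z (1, 0))" by (rule g(2))
  show "((\<lambda>x. g (x, s)) has_real_derivative ?D (x, s) (1, 0)) (at x)" for x s
  proof -
    have D: "(g has_derivative ?D (x, s)) (at (x, s))"
      by (rule frechet_derivative_works[THEN iffD1, OF g(1)])
    have P: "((\<lambda>x. (x, s)) has_derivative (\<lambda>h. (h, 0))) (at x)"
      by (rule has_derivative_Pair[OF has_derivative_ident has_derivative_const])
    have "((\<lambda>x. g (x, s)) has_derivative (\<lambda>h. ?D (x, s) (h, 0))) (at x)"
      by (rule has_derivative_compose[OF P D])
    moreover have "(\<lambda>h. ?D (x, s) (h, 0)) = (*) (?D (x, s) (1, 0))"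
    proof
      show "?D (x, s) (h, 0) = ?D (x, s) (1, 0) * h" for h
        using linear_cmul[OF has_derivative_linear[OF D], of h "(1, 0)"] by (simp add: mult.commute)
    qed
    ultimately show ?thesis by (simp only: has_field_derivative_def)
  qed
qed

text \<open>Exchanging arguments turns conditioning on the second coordinate into conditioning on
  the first, so the second half of the cost becomes an instance of
  \<open>fibre_cost\<close>.\<close>

definition flip :: "(real \<times> real \<Rightarrow> real) \<Rightarrow> real \<times> real \<Rightarrow> real" where
  "flip g = (\<lambda>z. g (snd z, fst z))"

lemma flip_apply [simp]: "flip g (x, y) = g (y, x)"
  by (simp add: flip_def)

lemma marg1_flip: "marg1 (flip g) y = marg2 g y"
  by (simp add: marg1_def marg2_def)

lemma H_x_flip: "H_x (flip g) y x = H_y g x y"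
  by (simp add: H_x_def H_y_def)

lemma G_flip: "G (flip g) y w = G_tilde g w y"
  by (simp add: G_def G_tilde_def cond_cdf21_def cond_cdf12_def marg1_flip)

lemma flip_continuous: "continuous_on UNIV g \<Longrightarrow> continuous_on UNIV (flip g)"
  unfolding flip_def by (rule continuous_on_compose2) (auto intro!: continuous_intros)

lemma cost_eq_fibre_costs: "cost f f' q = fibre_cost f q + fibre_cost (flip f') (flip q)"
  by (simp add: cost_def fibre_cost_def transport_map_def G_flip H_x_def marg1_flip)

lemma fibre_transportI:
  assumes "continuous_on UNIV f" "\<And>z. f z > 0" "continuous_on UNIV p" "\<And>z. p z > 0"
    "\<And>x. has_bochner_integral lborel (\<lambda>t. p (x, t)) (marg1 f x)"
  shows "fibre_transport f p"
  using assms by unfold_locales (auto simp: fibre_density_def intro: borel_measurable_continuous_onI)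

section \<open>Total mass and limits at infinity\<close>

context fibre_transport
begin

text \<open>By Tonelli the total mass is fixed by the prescribed fibre masses, so every perturbed
  density inherits mass 1 from \<open>p\<close>.\<close>

lemma fibre_density_nn_integral:
  assumes q: "fibre_density f q"
  shows "(\<integral>\<^sup>+z. ennreal (q z) \<partial>lborel) = (\<integral>\<^sup>+x. ennreal (marg1 f x) \<partial>lborel)"
proof -
  have [measurable]: "q \<in> borel_measurable borel" using q by (rule fibre_densityD)
  have "(\<integral>\<^sup>+z. ennreal (q z) \<partial>lborel) = (\<integral>\<^sup>+z. ennreal (q z) \<partial>(lborel \<Otimes>\<^sub>M lborel))"
    by (simp add: lborel_prod)
  also have "\<dots> = (\<integral>\<^sup>+x. \<integral>\<^sup>+t. ennreal (q (x, t)) \<partial>lborel \<partial>lborel)"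
    by (rule lborel.nn_integral_fst[symmetric]) (simp add: lborel_prod)
  also have "\<dots> = (\<integral>\<^sup>+x. ennreal (marg1 f x) \<partial>lborel)"
    using fibre_densityD[OF q] less_imp_le[OF fibre_densityD(2)[OF q]]
    by (intro nn_integral_cong) (simp add: nn_integral_eq_integral)
  finally show ?thesis .
qed

lemma prob_density_if_fibre_density:
  assumes p: "prob_density p" and q: "fibre_density f q"
  shows "prob_density q"
  unfolding prob_density_def
proof (intro conjI allI)
  show q0: "0 \<le> q z" for z using fibre_densityD(2)[OF q] less_imp_le by blast
  have "(\<integral>\<^sup>+z. ennreal (q z) \<partial>lborel) = (\<integral>\<^sup>+z. ennreal (p z) \<partial>lborel)"
    using fibre_density_nn_integral[OF q] fibre_density_nn_integral[OF p_dens] by simp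
  also have "\<dots> = ennreal 1"
    using p by (subst nn_integral_eq_integral) (auto simp: prob_density_def has_bochner_integral_iff)
  finally show "has_bochner_integral lborel q 1"
    using fibre_densityD(1)[OF q] q0 by (intro has_bochner_integral_nn_integral) auto
qed

lemma marg1_integrable:
  assumes "integrable lborel p"
  shows "integrable lborel (marg1 f)"
proof (rule integrableI_nonneg)
  have "marg1 f = (\<lambda>x. LBINT t. f (x, t))" by (auto simp: marg1_def)
  then show "marg1 f \<in> borel_measurable lborel" by simp
  show "AE x in lborel. 0 \<le> marg1 f x" using less_imp_le[OF marg1_pos] by simp
  have "(\<integral>\<^sup>+x. ennreal (marg1 f x) \<partial>lborel) = (\<integral>\<^sup>+z. ennreal (p z) \<partial>lborel)"
    by (rule fibre_density_nn_integral[OF p_dens, symmetric])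
  also have "\<dots> < \<infinity>" using assms by (auto simp: real_integrable_def less_top)
  finally show "(\<integral>\<^sup>+x. ennreal (marg1 f x) \<partial>lborel) < \<infinity>" .
qed

text \<open>\<open>H_x p u y\<close> lies between 0 and the integrable \<open>marg1 f u\<close>, so
  limits in \<open>y\<close> pass under the outer integral.\<close>

lemma H_tendsto:
  assumes p: "integrable lborel p"
  shows "((\<lambda>y. H p x y) \<longlongrightarrow> 0) at_bot"
    "((\<lambda>y. H p x y) \<longlongrightarrow> (LBINT u:{..x}. marg1 f u)) at_top"
proof -
  have Hx: "H p x y = (LBINT u. indicator {..x} u *\<^sub>R H_x p u y)" for y
    by (simp add: H_def H_x_def set_lebesgue_integral_def)
  have m: "(\<lambda>u. indicator {..x} u *\<^sub>R H_x p u y) \<in> borel_measurable lborel" for y by measurable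
  have mm: "(\<lambda>u. indicator {..x} u *\<^sub>R marg1 f u) \<in> borel_measurable lborel"
    using marg1_integrable[OF p] by measurable
  have b: "AE u in lborel. norm (indicator {..x} u *\<^sub>R H_x p u y) \<le> marg1 f u" for y
    using less_imp_le[OF H_x_bounds(1)[OF p_dens]] less_imp_le[OF H_x_bounds(2)[OF p_dens]]
      less_imp_le[OF marg1_pos]
    by (intro AE_I2) (auto simp: indicator_def)
  have l1: "((\<lambda>y. H_x p u y) \<longlongrightarrow> marg1 f u) at_top" "((\<lambda>y. H_x p u y) \<longlongrightarrow> 0) at_bot" for u
    using cdf_tendsto[OF fibre_densityD(3)[OF p_dens, of u]] fibre_densityD(4)[OF p_dens, of u]
    by (simp_all add: H_x_def)
  show "((\<lambda>y. H p x y) \<longlongrightarrow> (LBINT u:{..x}. marg1 f u)) at_top"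
    unfolding Hx set_lebesgue_integral_def
  proof (rule integral_dominated_convergence_at_top[OF mm m marg1_integrable[OF p]])
    show "AE u in lborel. ((\<lambda>y. indicator {..x} u *\<^sub>R H_x p u y) \<longlongrightarrow> indicator {..x} u *\<^sub>R marg1 f u) at_top"
      by (intro AE_I2 tendsto_intros l1)
  qed (use b in auto)
  have "((\<lambda>y. LBINT u. indicator {..x} u *\<^sub>R H_x p u (-y)) \<longlongrightarrow> (LBINT u::real. 0)) at_top"
  proof (rule integral_dominated_convergence_at_top[OF _ m marg1_integrable[OF p]])
    have "((\<lambda>y. H_x p u (-y)) \<longlongrightarrow> 0) at_top" for u
      using l1(2)[of u] by (simp add: at_bot_mirror filterlim_filtermap)
    then have "((\<lambda>y. indicator {..x} u *\<^sub>R H_x p u (-y)) \<longlongrightarrow> indicator {..x} u *\<^sub>R 0) at_top" for u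
      by (intro tendsto_intros)
    then show "AE u in lborel. ((\<lambda>y. indicator {..x} u *\<^sub>R H_x p u (-y)) \<longlongrightarrow> 0) at_top"
      by simp
  qed (use b in auto)
  then show "((\<lambda>y. H p x y) \<longlongrightarrow> 0) at_bot"
    by (simp add: at_bot_mirror filterlim_filtermap Hx)
qed

end

text \<open>Fubini on a quadrant; it converts limits in \<open>x\<close> into limits in
  \<open>y\<close> of the exchanged problem.\<close>

lemma H_flip:
  assumes p: "integrable lborel p"
  shows "H (flip p) y x = H p x y"
proof -
  let ?F = "\<lambda>u v. indicator {..x} u *\<^sub>R (indicator {..y} v *\<^sub>R p (u, v))"
  have "integrable lborel (\<lambda>z. indicator ({..x} \<times> {..y}) z *\<^sub>R p z)"
    by (rule integrable_mult_indicator[OF _ p]) (simp add: closed_Times borel_closed)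
  moreover have "(\<lambda>z. indicator ({..x} \<times> {..y}) z *\<^sub>R p z) = case_prod ?F"
    by (auto simp: indicator_def fun_eq_iff)
  ultimately have "integrable (lborel \<Otimes>\<^sub>M lborel) (case_prod ?F)"
    by (simp add: lborel_prod)
  from lborel_pair.Fubini_integral[OF this]
  have *: "(LBINT v. LBINT u. ?F u v) = (LBINT u. LBINT v. ?F u v)" .
  have "(LBINT v. ?F u v) = indicator {..x} u *\<^sub>R (LBINT v. indicator {..y} v *\<^sub>R p (u, v))" for u
    by simp
  moreover have "(LBINT u. ?F u v) = indicator {..y} v *\<^sub>R (LBINT u. indicator {..x} u *\<^sub>R p (u, v))" for v
  proof -
    have "(\<lambda>u. ?F u v) = (\<lambda>u. indicator {..y} v *\<^sub>R (indicator {..x} u *\<^sub>R p (u, v)))"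
      by auto
    then show ?thesis by simp
  qed
  ultimately show ?thesis
    using * by (simp add: H_def set_lebesgue_integral_def)
qed

theorem theorem3p3:
  fixes f f' p :: "real \<times> real \<Rightarrow> real"
  assumes f: "prob_density f" "smooth f" "\<forall>z. f z > 0"
    and f': "prob_density f'" "smooth f'" "\<forall>z. f' z > 0"
    and p: "p \<in> admissible f f'" "smooth p" "\<forall>z. p z > 0"
    and finite_cost: "cost f f' p < \<infinity>"
    and minimal: "\<forall>q \<in> admissible f f'. cost f f' p \<le> cost f f' q"
  shows "(\<forall>x y. \<exists>a b.
            ((\<lambda>s. G f s (1 / marg1 f s * H_x p s y)) has_real_derivative a) (at x) \<and>
            ((\<lambda>t. G_tilde f' (1 / marg2 f' t * H_y p x t) t) has_real_derivative b) (at y) \<and>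
            a + b = 0) \<and>
         (\<forall>x. ((\<lambda>y. H p x y) \<longlongrightarrow> 0) at_bot) \<and>
         (\<forall>y. ((\<lambda>x. H p x y) \<longlongrightarrow> 0) at_bot) \<and>
         (\<forall>x. ((\<lambda>y. H p x y) \<longlongrightarrow> (LBINT u:{..x}. marg1 f u)) at_top) \<and>
         (\<forall>y. ((\<lambda>x. H p x y) \<longlongrightarrow> (LBINT v:{..y}. marg2 f' v)) at_top)"
proof -
  have p_int: "integrable lborel p" and p_prob: "prob_density p"
    using p(1) by (auto simp: admissible_def prob_density_def has_bochner_integral_iff)
  interpret X: fibre_transport f p
    by (rule fibre_transportI)
      (use f p in \<open>auto simp: admissible_def intro: smooth_continuous\<close>)
  interpret Y: fibre_transport "flip f'" "flip p"
  proof (rule fibre_transportI)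
    show "continuous_on UNIV (flip f')" "continuous_on UNIV (flip p)"
      by (intro flip_continuous smooth_continuous f' p)+
    show "flip f' z > 0" "flip p z > 0" for z
      using f'(3) p(3) by (simp_all add: flip_def)
    show "has_bochner_integral lborel (\<lambda>t. flip p (x, t)) (marg1 (flip f') x)" for x
      using p(1) by (simp add: admissible_def marg1_flip)
  qed
  have finX: "fibre_cost f p < \<infinity>" and finY: "fibre_cost (flip f') (flip p) < \<infinity>"
    using finite_cost by (auto simp: cost_eq_fibre_costs)
  have stationary: "(LBINT x. a x * X.variation p B x) + (LBINT y. b y * Y.variation (flip p) A y) = 0"
    if A: "test_pair A a" and B: "test_pair B b" for A a B b
  proof -
    have am: "a \<in> borel_measurable borel" "b \<in> borel_measurable borel" using A B by (auto simp: test_pair_def)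
    define U where "U = (\<lambda>c. (LBINT x. a x * X.variation (X.perturb c a b) B x)
      + (LBINT y. b y * Y.variation (Y.perturb c b a) A y))"
    obtain e where e: "e > 0" "\<And>c z. \<bar>c\<bar> \<le> e \<Longrightarrow> X.perturb c a b z > 0"
      using X.perturb_pos[OF A B] by blast
    \<comment> \<open>Exchanging coordinates swaps \<open>a\<close> and \<open>b\<close>, so a
      single admissible perturbation has the same form in both problems.\<close>
    have tr: "Y.perturb c b a = flip (X.perturb c a b)" for c
      unfolding X.perturb_def Y.perturb_def by (simp add: flip_def mult.commute mult.left_commute)
    have dX: "fibre_density f (X.perturb c a b)" if "\<bar>c\<bar> \<le> e" for c
      by (rule X.perturb_dens[OF am(1) B e(2)[OF that]])
    have dY: "fibre_density (flip f') (Y.perturb c b a)" if "\<bar>c\<bar> \<le> e" for c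
    proof (rule Y.perturb_dens[OF am(2) A])
      show "Y.perturb c b a z > 0" for z
        using e(2)[OF that] unfolding tr by (simp add: flip_def)
    qed
    \<comment> \<open>Minimality combined with the two cost estimates gives
      \<open>0 \<le> - 2 * c * U c\<close>.\<close>
    have descent: "c * U c \<le> 0" if c: "\<bar>c\<bar> \<le> e" for c
    proof -
      let ?q = "X.perturb c a b"
      have "?q \<in> admissible f f'"
        unfolding admissible_def mem_Collect_eq
      proof (intro conjI allI)
        show "prob_density ?q" by (rule X.prob_density_if_fibre_density[OF p_prob dX[OF c]])
        show "has_bochner_integral lborel (\<lambda>t. ?q (x, t)) (marg1 f x)" for x
          by (rule X.perturb_section(1)[OF B])
        show "has_bochner_integral lborel (\<lambda>u. ?q (u, y)) (marg2 f' y)" for y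
          using Y.perturb_section(1)[OF A, of c b y] unfolding tr by (simp add: marg1_flip)
      qed
      then have "cost f f' p \<le> cost f f' ?q" using minimal by blast
      then have le: "fibre_cost f p + fibre_cost (flip f') (flip p)
          \<le> fibre_cost f ?q + fibre_cost (flip f') (Y.perturb c b a)"
        by (simp add: cost_eq_fibre_costs tr)
      note cX = X.fibre_cost_perturb[OF finX A B dX[OF c]]
      note cY = Y.fibre_cost_perturb[OF finY B A dY[OF c]]
      have "enn2real (fibre_cost f p + fibre_cost (flip f') (flip p))
          \<le> enn2real (fibre_cost f ?q + fibre_cost (flip f') (Y.perturb c b a))"
        using le cX(1) cY(1) by (intro enn2real_mono) auto
      then have "enn2real (fibre_cost f p) + enn2real (fibre_cost (flip f') (flip p))
          \<le> enn2real (fibre_cost f ?q) + enn2real (fibre_cost (flip f') (Y.perturb c b a))"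
        using finX finY cX(1) cY(1) by (simp add: enn2real_plus)
      with cX(2) cY(2) show ?thesis unfolding U_def by (simp add: algebra_simps)
    qed
    define U0 where "U0 = (LBINT x. a x * X.variation p B x) + (LBINT y. b y * Y.variation (flip p) A y)"
    have lim: "(\<lambda>n. U (c n)) \<longlonglongrightarrow> U0" if "\<And>n. \<bar>c n\<bar> \<le> e" "c \<longlonglongrightarrow> 0" for c
      unfolding U_def U0_def
      by (rule tendsto_add[OF X.weighted_variation_tendsto[OF finX A B dX[OF that(1)] that(2)]
          Y.weighted_variation_tendsto[OF finY B A dY[OF that(1)] that(2)]])
    \<comment> \<open>Steps \<open>c n\<close> and \<open>- c n\<close> within the admissible range
      give opposite signs for the same limit \<open>U0\<close>.\<close>
    define c where "c = (\<lambda>n. e * inverse (real (Suc n)))"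
    have c: "c n > 0" "c n \<le> e" for n
      using e(1) by (auto simp: c_def field_simps)
    have c0: "c \<longlonglongrightarrow> 0"
      unfolding c_def using tendsto_mult[OF tendsto_const LIMSEQ_inverse_real_of_nat, of e] by simp
    have "U0 \<le> 0"
    proof (rule LIMSEQ_le_const2[OF lim[OF _ c0]])
      show "\<bar>c n\<bar> \<le> e" for n using c[of n] by simp
      have "U (c n) \<le> 0" for n
        using descent[of "c n"] c[of n] by (simp add: mult_le_0_iff)
      then show "\<exists>N. \<forall>n\<ge>N. U (c n) \<le> 0" by blast
    qed
    moreover have "0 \<le> U0"
    proof (rule LIMSEQ_le_const[OF lim[of "\<lambda>n. - c n"]])
      show "\<bar>- c n\<bar> \<le> e" for n using c[of n] by simp
      show "(\<lambda>n. - c n) \<longlonglongrightarrow> 0" using tendsto_minus[OF c0] by simp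
      have "0 \<le> U (- c n)" for n
        using descent[of "- c n"] c[of n] by (simp add: zero_le_mult_iff)
      then show "\<exists>N. \<forall>n\<ge>N. 0 \<le> U (- c n)" by blast
    qed
    ultimately show ?thesis unfolding U0_def by simp
  qed
  interpret coupled_transport f p "flip f'" "flip p"
  proof unfold_locales
    show "fibre_cost f p < \<infinity>" "fibre_cost (flip f') (flip p) < \<infinity>"
      by (rule finX finY)+
  qed (rule stationary)
  obtain fx where fx: "continuous_on UNIV fx" "\<And>x s. ((\<lambda>x. f (x, s)) has_real_derivative fx (x, s)) (at x)"
    using smooth_partial_fst[OF f(2)] by blast
  obtain px where px: "continuous_on UNIV px" "\<And>x s. ((\<lambda>x. p (x, s)) has_real_derivative px (x, s)) (at x)"
    using smooth_partial_fst[OF p(2)] by blast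
  have el: "\<exists>a b. ((\<lambda>s. G f s (1 / marg1 f s * H_x p s y)) has_real_derivative a) (at x) \<and>
      ((\<lambda>t. G_tilde f' (1 / marg2 f' t * H_y p x t) t) has_real_derivative b) (at y) \<and> a + b = 0" for x y
  proof -
    from euler_lagrange[OF fx(2,1) px(2,1), of y x]
    obtain c where "((\<lambda>s. X.T p s y) has_real_derivative c) (at x) \<and>
      ((\<lambda>t. Y.T (flip p) t x) has_real_derivative - c) (at y)" ..
    then show ?thesis
      by (intro exI[of _ c] exI[of _ "- c"])
        (simp add: transport_map_def G_flip H_x_flip marg1_flip)
  qed
  have tp: "integrable lborel (flip p)"
    using lborel_pair.integrable_product_swap[of p] p_int
    by (simp add: lborel_prod flip_def case_prod_unfold)
  have HY: "((\<lambda>x. H p x y) \<longlongrightarrow> 0) at_bot"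
    "((\<lambda>x. H p x y) \<longlongrightarrow> (LBINT v:{..y}. marg2 f' v)) at_top" for y
    using Y.H_tendsto[OF tp, of y] by (simp_all add: H_flip[OF p_int] marg1_flip)
  show ?thesis
    by (intro conjI allI el X.H_tendsto[OF p_int] HY)
qed

end
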